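(* Let $\mathrm{WSys}(F_S\curvearrowright X)$ be a warped system with stable discrete fundamental group. If $\pi_{1,\infty}(F_S\curvearrowright X)$ does not contain a proper finite index normal subgroup isomorphic to $\pi_{1,\infty}(F_S\curvearrowright X)$ itself, then $\mathrm{WSys}(F_S\curvearrowright X)$ is not coarsely equivalent to any box space.
   Context: Box spaces. A residual filtration of a group $\Lambda$ is a nested sequence of finite index normal subgroups $N_{k+1}\lhd N_k\lhd\Lambda$ (each normal in $\Lambda$) with $\bigcap_kN_k=\{e\}$. A box space $\Box_{(N_k)}\Lambda$ of an infinite finitely generated group $\Lambda$ is the sequence of Cayley graphs $(\mathrm{Cay}(\Lambda/N_k))_k$ with respect to a fixed finite generating set of $\Lambda$, for a residual filtration $(N_k)$. Coarse equivalence. Two sequences of metric spaces $(Z_k)$, $(W_k)$ are coarsely equivalent if there are constants $L,A$ such that $Z_k$ and $W_k$ are $(L,A)$-quasi-isometric for every $k$. A box space is coarsely equivalent to a warped system if it is coarsely equivalent to a sequence $(X,\delta_S^{t_k})_{k\in\mathbb{N}}$ of its spaces with $(t_k)$ unbounded. Warped systems. Given a finite set $S$ of homeomorphisms of a metric space $(X,d)$, $F_S$ is the free group on $S$, and for $t\ge1$, $\delta_S^t$ is the largest metric on $X$ with $\delta_S^t\le t\cdot d$ and $\delta_S^t(x,s(x))\le1$ for all $x\in X,s\in S$. The warped system $\mathrm{WSys}(F_S\curvearrowright X)$ is the family $\{(X,\delta_S^t)\}_{t\ge1}$ together with $S$. A jumping-path is a sequence of continuous paths $\gamma_0,\dots,\gamma_n$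 in $X$ and $\vec s_1,\dots,\vec s_n\in S\cup S^{-1}$ with $\gamma_i(0)=\vec s_i\gamma_{i-1}(1)$; its length at scale $t$ is $n+\sum_i t\|\gamma_i\|$, where $\|\gamma_i\|$ is the length in $(X,d)$. $(X,\delta_S^t)$ is jumping-geodesic if $(X,d)$ is geodesic and any two points $x,y$ are joined by a jumping-path of length exactly $\delta_S^t(x,y)$ at scale $t$. Standing assumption on all warped systems: $(X,d)$ is compact, path-connected, locally path-connected, semi-locally simply connected, every continuous path in $X$ is homotopic (rel endpoints) to one of finite length, and $(X,\delta_S^t)$ is jumping-geodesic for all $t$ large enough. Discrete fundamental group. For a metric space $(Z,\rho)$ and $\theta>0$, a $\theta$-path is a sequence $(z_0,\dots,z_n)$ with $\rho(z_i,z_{i+1})\le\theta$. Lazifications are obtained by repeating values; a $\theta$-grid homotopy between $\theta$-paths of length $n$ with the same endpoints is a $\theta$-Lipschitz map $\{0,\dots,n\}\times\{0,\dots,m\}\to Z$ ($\ell^1$ metric on the source) restricting to the two paths on the bottom and top rows and constant on the left and right sides. $\pi_{1,\theta}(Z)$ is the group of closed $\theta$-paths at a base point modulo the equivalence relation generated by lazifications and $\theta$-grid homotopies, with concatenation. Limit group. Fix $x_0\in X$ and, for $s\in S$, a continuous path $\alpha_s$ from $x_0$ to $s x_0$; put $\alpha_{s^{-1}}=s^{-1}(\alpha_s^* )$ ($^*$ denotes reversal) and $\alpha_{\vec s_1\cdots\vec s_n}=\alpha_{\vec s_1}\vec s_1(\alpha_{\vec s_2})\cdots(\vec s_1\cdots\vec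 s_{n-1})(\alpha_{\vec s_n})$. Let $\phi_S\colon F_S\to\mathrm{Aut}(\pi_1(X,x_0))$, $\phi_S(w)[\gamma]=[\alpha_w w(\gamma)\alpha_w^*]$. For integer $\theta\ge1$ let $K_\theta$ be the set of $([\beta w(\beta^* )\alpha_w^*],w)$ with $w\in F_S$ of reduced length $\le4\theta$ and $\mathrm{Fix}(w)\neq\emptyset$, and $\beta$ a path from $x_0$ to a point of $\mathrm{Fix}(w)$. For all $t$ large enough (depending on $\theta$) $\pi_{1,\theta}(X,\delta_S^t)$ is isomorphic to $(\pi_1(X,x_0)\rtimes_{\phi_S}F_S)/\langle\langle K_\theta\rangle\rangle$; this group is denoted $\pi_{1,\theta}(F_S\curvearrowright X)$. For $\theta<\theta'$ the identity of $X$ induces the natural quotient map $\pi_{1,\theta}(F_S\curvearrowright X)\to\pi_{1,\theta'}(F_S\curvearrowright X)$, and $\pi_{1,\infty}(F_S\curvearrowright X)=\varinjlim_\theta\pi_{1,\theta}(F_S\curvearrowright X)$. The warped system has stable discrete fundamental group if for some $\theta$ the natural surjection $\pi_{1,\theta}(F_S\curvearrowright X)\to\pi_{1,\infty}(F_S\curvearrowright X)$ is an isomorphism. *)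

theory Defs
  imports "HOL-Analysis.Analysis" "HOL-Algebra.Generated_Groups"
begin

text \<open>The metric space \<open>(X,d)\<close> of a warped system is the universe of a type of class
  \<^class>\<open>metric_space\<close>, with \<open>d = dist\<close>; paths are parametrised by \<open>{0..1}\<close> and only their
  values there matter.\<close>

section \<open>Warped systems\<close>

text \<open>\<open>\<delta>\<^sub>S\<^sup>t\<close>: the order on \<open>'a \<Rightarrow> 'a \<Rightarrow> real\<close> is pointwise. The greatest metric exists by
  \<open>warped_dist_greatest\<close> below.\<close>

definition warped_dist :: "('a::metric_space \<Rightarrow> 'a) set \<Rightarrow> real \<Rightarrow> 'a \<Rightarrow> 'a \<Rightarrow> real" where
  "warped_dist S t = (GREATEST \<rho>. Metric_space UNIV \<rho> \<and> (\<forall>x y. \<rho> x y \<le> t * dist x y) \<and>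
     (\<forall>s\<in>S. \<forall>x. \<rho> x (s x) \<le> 1))"

definition warped_metric :: "('a::metric_space \<Rightarrow> 'a) set \<Rightarrow> real \<Rightarrow> 'a metric" where
  "warped_metric S t = metric (UNIV, warped_dist S t)"

definition path_length :: "(real \<Rightarrow> 'a::metric_space) \<Rightarrow> ennreal" where
  "path_length \<gamma> = (SUP ts \<in> {ts. sorted ts \<and> set ts \<subseteq> {0..1}}.
     \<Sum>i<length ts - 1. ennreal (dist (\<gamma> (ts ! i)) (\<gamma> (ts ! Suc i))))"

definition jumping_path ::
  "('a::metric_space \<Rightarrow> 'a) set \<Rightarrow> nat \<Rightarrow> (nat \<Rightarrow> real \<Rightarrow> 'a) \<Rightarrow> (nat \<Rightarrow> 'a \<Rightarrow> 'a) \<Rightarrow> bool" where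
  "jumping_path S n \<gamma> s \<longleftrightarrow> (\<forall>i\<in>{0..n}. path (\<gamma> i)) \<and>
     (\<forall>i\<in>{1..n}. s i \<in> S \<union> inv_into UNIV ` S \<and> pathstart (\<gamma> i) = s i (pathfinish (\<gamma> (i - 1))))"

definition jumping_length :: "real \<Rightarrow> nat \<Rightarrow> (nat \<Rightarrow> real \<Rightarrow> 'a::metric_space) \<Rightarrow> ennreal" where
  "jumping_length t n \<gamma> = of_nat n + (\<Sum>i=0..n. ennreal t * path_length (\<gamma> i))"

definition geodesic_metric :: "'a metric \<Rightarrow> bool" where
  "geodesic_metric m \<longleftrightarrow> (\<forall>x\<in>mspace m. \<forall>y\<in>mspace m. \<exists>\<gamma>.
     \<gamma> ` {0..mdist m x y} \<subseteq> mspace m \<and> \<gamma> 0 = x \<and> \<gamma> (mdist m x y) = y \<and>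
     (\<forall>a\<in>{0..mdist m x y}. \<forall>b\<in>{0..mdist m x y}. mdist m (\<gamma> a) (\<gamma> b) = \<bar>a - b\<bar>))"

text \<open>\<^const>\<open>euclidean_metric\<close> is the library's name for the metric \<open>dist\<close> of an arbitrary metric
  space type.\<close>

definition jumping_geodesic :: "('a::metric_space \<Rightarrow> 'a) set \<Rightarrow> real \<Rightarrow> bool" where
  "jumping_geodesic S t \<longleftrightarrow> geodesic_metric (euclidean_metric :: 'a metric) \<and>
     (\<forall>x y. \<exists>n \<gamma> s. jumping_path S n \<gamma> s \<and> pathstart (\<gamma> 0) = x \<and> pathfinish (\<gamma> n) = y \<and>
        jumping_length t n \<gamma> = ennreal (warped_dist S t x y))"

definition semilocally_simply_connected :: "'a::topological_space set \<Rightarrow> bool" where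
  "semilocally_simply_connected X \<longleftrightarrow> (\<forall>x\<in>X. \<exists>U. openin (top_of_set X) U \<and> x \<in> U \<and>
     (\<forall>\<gamma>. path \<gamma> \<and> path_image \<gamma> \<subseteq> U \<and> pathstart \<gamma> = x \<and> pathfinish \<gamma> = x \<longrightarrow>
        homotopic_paths X \<gamma> (\<lambda>_. x)))"

definition warped_system :: "('a::metric_space \<Rightarrow> 'a) set \<Rightarrow> bool" where
  "warped_system S \<longleftrightarrow>
     finite S \<and> (\<forall>s\<in>S. homeomorphism UNIV UNIV s (inv_into UNIV s)) \<and>
     compact (UNIV :: 'a set) \<and> path_connected (UNIV :: 'a set) \<and>
     locally path_connected (UNIV :: 'a set) \<and> semilocally_simply_connected (UNIV :: 'a set) \<and>
     (\<forall>\<gamma> :: real \<Rightarrow> 'a. path \<gamma> \<longrightarrow> (\<exists>\<gamma>'. homotopic_paths UNIV \<gamma> \<gamma>' \<and> path_length \<gamma>' < \<infinity>)) \<and>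
     (\<forall>\<^sub>F t in at_top. jumping_geodesic S t)"


section \<open>Groups\<close>

text \<open>A letter \<open>(s, True)\<close> stands for \<open>s\<close> and \<open>(s, False)\<close> for \<open>s\<^sup>-\<^sup>1\<close>. Elements of the free group
  are reduced words, so the reduced length of an element is its \<^const>\<open>length\<close>.\<close>

type_synonym 's word = "('s \<times> bool) list"

definition inv_letter :: "'s \<times> bool \<Rightarrow> 's \<times> bool" where
  "inv_letter a = (fst a, \<not> snd a)"

definition reduced :: "'s word \<Rightarrow> bool" where
  "reduced w \<longleftrightarrow> (\<forall>i. Suc i < length w \<longrightarrow> w ! Suc i \<noteq> inv_letter (w ! i))"

definition reduced_Cons :: "'s \<times> bool \<Rightarrow> 's word \<Rightarrow> 's word" where
  "reduced_Cons a w = (if w \<noteq> [] \<and> hd w = inv_letter a then tl w else a # w)"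

definition free_group :: "'s set \<Rightarrow> 's word monoid" where
  "free_group S = \<lparr>carrier = {w. reduced w \<and> fst ` set w \<subseteq> S},
     mult = (\<lambda>v w. foldr reduced_Cons v w), one = []\<rparr>"

definition semidirect :: "('a, 'm) monoid_scheme \<Rightarrow> ('b, 'n) monoid_scheme \<Rightarrow> ('b \<Rightarrow> 'a \<Rightarrow> 'a) \<Rightarrow>
    ('a \<times> 'b) monoid" where
  "semidirect G H \<phi> = \<lparr>carrier = carrier G \<times> carrier H,
     mult = (\<lambda>(g, h) (g', h'). (g \<otimes>\<^bsub>G\<^esub> \<phi> h g', h \<otimes>\<^bsub>H\<^esub> h')), one = (\<one>\<^bsub>G\<^esub>, \<one>\<^bsub>H\<^esub>)\<rparr>"

definition normal_closure :: "('a, 'm) monoid_scheme \<Rightarrow> 'a set \<Rightarrow> 'a set" where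
  "normal_closure G K = (\<lambda>N. N \<lhd> G) hull K"

text \<open>Direct limit of groups \<open>G i\<close>, \<open>i \<in> I\<close>, along homomorphisms \<open>f i j\<close> for \<open>i \<le> j\<close>, for a
  directed index set \<open>I\<close>: pairs \<open>(i, x)\<close> with \<open>x \<in> G i\<close> modulo becoming equal at a later index.\<close>

definition limit_rel :: "'i::order set \<Rightarrow> ('i \<Rightarrow> 'a monoid) \<Rightarrow> ('i \<Rightarrow> 'i \<Rightarrow> 'a \<Rightarrow> 'a) \<Rightarrow>
    (('i \<times> 'a) \<times> ('i \<times> 'a)) set" where
  "limit_rel I G f = {((i, x), (j, y)). i \<in> I \<and> x \<in> carrier (G i) \<and> j \<in> I \<and> y \<in> carrier (G j) \<and>
     (\<exists>k\<in>I. i \<le> k \<and> j \<le> k \<and> f i k x = f j k y)}"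

definition limit_map :: "'i::order set \<Rightarrow> ('i \<Rightarrow> 'a monoid) \<Rightarrow> ('i \<Rightarrow> 'i \<Rightarrow> 'a \<Rightarrow> 'a) \<Rightarrow>
    'i \<Rightarrow> 'a \<Rightarrow> ('i \<times> 'a) set" where
  "limit_map I G f i x = limit_rel I G f `` {(i, x)}"

definition direct_limit :: "'i::order set \<Rightarrow> ('i \<Rightarrow> 'a monoid) \<Rightarrow> ('i \<Rightarrow> 'i \<Rightarrow> 'a \<Rightarrow> 'a) \<Rightarrow>
    ('i \<times> 'a) set monoid" where
  "direct_limit I G f = \<lparr>carrier = (SIGMA i:I. carrier (G i)) // limit_rel I G f,
     mult = (\<lambda>A B. \<Union>(i, x)\<in>A. \<Union>(j, y)\<in>B. \<Union>k\<in>{k\<in>I. i \<le> k \<and> j \<le> k}.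
       limit_map I G f k (f i k x \<otimes>\<^bsub>G k\<^esub> f j k y)),
     one = (\<Union>i\<in>I. limit_map I G f i \<one>\<^bsub>G i\<^esub>)\<rparr>"


section \<open>The limit group of a warped system\<close>

definition path_class :: "(real \<Rightarrow> 'a::topological_space) \<Rightarrow> (real \<Rightarrow> 'a) set" where
  "path_class p = {q. homotopic_paths UNIV p q}"

definition fundamental_group :: "'a::topological_space \<Rightarrow> (real \<Rightarrow> 'a) set monoid" where
  "fundamental_group x0 =
     \<lparr>carrier = {path_class p |p. path p \<and> pathstart p = x0 \<and> pathfinish p = x0},
      mult = (\<lambda>A B. \<Union>p\<in>A. \<Union>q\<in>B. path_class (p +++ q)), one = path_class (\<lambda>_. x0)\<rparr>"

definition letter_map :: "('a \<Rightarrow> 'a) \<times> bool \<Rightarrow> 'a \<Rightarrow> 'a" where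
  "letter_map a = (if snd a then fst a else inv_into UNIV (fst a))"

definition word_map :: "('a \<Rightarrow> 'a) word \<Rightarrow> 'a \<Rightarrow> 'a" where
  "word_map w = foldr (\<lambda>a g. letter_map a \<circ> g) w id"

definition Fix :: "('a \<Rightarrow> 'a) word \<Rightarrow> 'a set" where
  "Fix w = {x. word_map w x = x}"

definition letter_path :: "(('a \<Rightarrow> 'a) \<Rightarrow> real \<Rightarrow> 'a::topological_space) \<Rightarrow> ('a \<Rightarrow> 'a) \<times> bool \<Rightarrow> real \<Rightarrow> 'a"
  where
  "letter_path \<alpha> a = (if snd a then \<alpha> (fst a) else inv_into UNIV (fst a) \<circ> reversepath (\<alpha> (fst a)))"

text \<open>\<open>\<alpha>\<^sub>w\<close>, bracketed as \<open>\<alpha>\<^bsub>a w\<^esub> = \<alpha>\<^sub>a a(\<alpha>\<^sub>w)\<close> and ending in a constant path; only its homotopy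
  class is used.\<close>

primrec word_path :: "'a \<Rightarrow> (('a \<Rightarrow> 'a) \<Rightarrow> real \<Rightarrow> 'a::topological_space) \<Rightarrow> ('a \<Rightarrow> 'a) word \<Rightarrow> real \<Rightarrow> 'a"
  where
  "word_path x0 \<alpha> [] = (\<lambda>_. x0)"
| "word_path x0 \<alpha> (a # w) = letter_path \<alpha> a +++ (letter_map a \<circ> word_path x0 \<alpha> w)"

definition phi :: "'a \<Rightarrow> (('a \<Rightarrow> 'a) \<Rightarrow> real \<Rightarrow> 'a::topological_space) \<Rightarrow> ('a \<Rightarrow> 'a) word \<Rightarrow>
    (real \<Rightarrow> 'a) set \<Rightarrow> (real \<Rightarrow> 'a) set" where
  "phi x0 \<alpha> w A = (\<Union>\<gamma>\<in>A.
     path_class (word_path x0 \<alpha> w +++ (word_map w \<circ> \<gamma>) +++ reversepath (word_path x0 \<alpha> w)))"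

definition warped_semidirect :: "('a \<Rightarrow> 'a) set \<Rightarrow> 'a \<Rightarrow> (('a \<Rightarrow> 'a) \<Rightarrow> real \<Rightarrow> 'a::topological_space) \<Rightarrow>
    ((real \<Rightarrow> 'a) set \<times> ('a \<Rightarrow> 'a) word) monoid" where
  "warped_semidirect S x0 \<alpha> = semidirect (fundamental_group x0) (free_group S) (phi x0 \<alpha>)"

definition K_theta :: "('a \<Rightarrow> 'a) set \<Rightarrow> 'a \<Rightarrow> (('a \<Rightarrow> 'a) \<Rightarrow> real \<Rightarrow> 'a::topological_space) \<Rightarrow> nat \<Rightarrow>
    ((real \<Rightarrow> 'a) set \<times> ('a \<Rightarrow> 'a) word) set" where
  "K_theta S x0 \<alpha> \<theta> = {(path_class (\<beta> +++ (word_map w \<circ> reversepath \<beta>) +++ reversepath (word_path x0 \<alpha> w)), w) |w \<beta>.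
     w \<in> carrier (free_group S) \<and> length w \<le> 4 * \<theta> \<and>
     path \<beta> \<and> pathstart \<beta> = x0 \<and> pathfinish \<beta> \<in> Fix w}"

definition pi_theta :: "('a \<Rightarrow> 'a) set \<Rightarrow> 'a \<Rightarrow> (('a \<Rightarrow> 'a) \<Rightarrow> real \<Rightarrow> 'a::topological_space) \<Rightarrow> nat \<Rightarrow>
    ((real \<Rightarrow> 'a) set \<times> ('a \<Rightarrow> 'a) word) set monoid" where
  "pi_theta S x0 \<alpha> \<theta> =
     warped_semidirect S x0 \<alpha> Mod normal_closure (warped_semidirect S x0 \<alpha>) (K_theta S x0 \<alpha> \<theta>)"

text \<open>As \<open>K\<^sub>\<theta> \<subseteq> K\<^sub>\<theta>\<^sub>'\<close>, the quotient map sends a coset \<open>C\<close> of \<open>\<langle>\<langle>K\<^sub>\<theta>\<rangle>\<rangle>\<close> to the coset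
  \<open>\<langle>\<langle>K\<^sub>\<theta>\<^sub>'\<rangle>\<rangle> C\<close> containing it; the map does not depend on \<open>\<theta>\<close> otherwise.\<close>

definition quotient_map_theta :: "('a \<Rightarrow> 'a) set \<Rightarrow> 'a \<Rightarrow> (('a \<Rightarrow> 'a) \<Rightarrow> real \<Rightarrow> 'a::topological_space) \<Rightarrow>
    nat \<Rightarrow> nat \<Rightarrow> ((real \<Rightarrow> 'a) set \<times> ('a \<Rightarrow> 'a) word) set \<Rightarrow> ((real \<Rightarrow> 'a) set \<times> ('a \<Rightarrow> 'a) word) set" where
  "quotient_map_theta S x0 \<alpha> \<theta> \<theta>' C =
     normal_closure (warped_semidirect S x0 \<alpha>) (K_theta S x0 \<alpha> \<theta>') <#>\<^bsub>warped_semidirect S x0 \<alpha>\<^esub> C"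

definition pi_infinity :: "('a \<Rightarrow> 'a) set \<Rightarrow> 'a \<Rightarrow> (('a \<Rightarrow> 'a) \<Rightarrow> real \<Rightarrow> 'a::topological_space) \<Rightarrow>
    (nat \<times> ((real \<Rightarrow> 'a) set \<times> ('a \<Rightarrow> 'a) word) set) set monoid" where
  "pi_infinity S x0 \<alpha> = direct_limit {1..} (pi_theta S x0 \<alpha>) (quotient_map_theta S x0 \<alpha>)"

definition stable_discrete_fundamental_group ::
  "('a \<Rightarrow> 'a) set \<Rightarrow> 'a \<Rightarrow> (('a \<Rightarrow> 'a) \<Rightarrow> real \<Rightarrow> 'a::topological_space) \<Rightarrow> bool" where
  "stable_discrete_fundamental_group S x0 \<alpha> \<longleftrightarrow> (\<exists>\<theta>\<ge>1.
     limit_map {1..} (pi_theta S x0 \<alpha>) (quotient_map_theta S x0 \<alpha>) \<theta>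
       \<in> iso (pi_theta S x0 \<alpha> \<theta>) (pi_infinity S x0 \<alpha>))"


section \<open>Box spaces and coarse equivalence\<close>

text \<open>A Cayley graph is represented by its vertex set with the path metric.\<close>

definition cayley_edges :: "('a, 'm) monoid_scheme \<Rightarrow> 'a set \<Rightarrow> ('a \<times> 'a) set" where
  "cayley_edges G T = {(g, g \<otimes>\<^bsub>G\<^esub> s) |g s. g \<in> carrier G \<and> s \<in> T}"

definition cayley_dist :: "('a, 'm) monoid_scheme \<Rightarrow> 'a set \<Rightarrow> 'a \<Rightarrow> 'a \<Rightarrow> real" where
  "cayley_dist G T g h = real (LEAST n. (g, h) \<in> (cayley_edges G T \<union> (cayley_edges G T)\<inverse>) ^^ n)"

definition cayley_metric :: "('a, 'm) monoid_scheme \<Rightarrow> 'a set \<Rightarrow> 'a metric" where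
  "cayley_metric G T = metric (carrier G, cayley_dist G T)"

definition residual_filtration :: "('a, 'm) monoid_scheme \<Rightarrow> (nat \<Rightarrow> 'a set) \<Rightarrow> bool" where
  "residual_filtration G N \<longleftrightarrow>
     (\<forall>k. N k \<lhd> G \<and> finite (rcosets\<^bsub>G\<^esub> N k) \<and> N (Suc k) \<lhd> G\<lparr>carrier := N k\<rparr>) \<and>
     (\<Inter>k. N k) = {\<one>\<^bsub>G\<^esub>}"

definition box_space :: "(nat \<Rightarrow> 'b set metric) \<Rightarrow> bool" where
  "box_space B \<longleftrightarrow> (\<exists>(G :: 'b monoid) T N.
     group G \<and> infinite (carrier G) \<and>
     finite T \<and> T \<subseteq> carrier G \<and> generate G T = carrier G \<and>
     residual_filtration G N \<and>
     (\<forall>k. B k = cayley_metric (G Mod N k) ((\<lambda>s. N k #>\<^bsub>G\<^esub> s) ` T)))"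

definition quasi_isometric :: "real \<Rightarrow> real \<Rightarrow> 'a metric \<Rightarrow> 'b metric \<Rightarrow> bool" where
  "quasi_isometric L A Z W \<longleftrightarrow> (\<exists>f \<in> mspace Z \<rightarrow> mspace W.
     (\<forall>x\<in>mspace Z. \<forall>y\<in>mspace Z. mdist Z x y / L - A \<le> mdist W (f x) (f y) \<and>
        mdist W (f x) (f y) \<le> L * mdist Z x y + A) \<and>
     (\<forall>w\<in>mspace W. \<exists>z\<in>mspace Z. mdist W w (f z) \<le> A))"

definition coarsely_equivalent :: "(nat \<Rightarrow> 'a metric) \<Rightarrow> (nat \<Rightarrow> 'b metric) \<Rightarrow> bool" where
  "coarsely_equivalent Z W \<longleftrightarrow> (\<exists>L\<ge>1. \<exists>A\<ge>0. \<forall>k. quasi_isometric L A (Z k) (W k))"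

definition coarsely_equivalent_warped :: "(nat \<Rightarrow> 'b metric) \<Rightarrow> ('a::metric_space \<Rightarrow> 'a) set \<Rightarrow> bool" where
  "coarsely_equivalent_warped B S \<longleftrightarrow> (\<exists>t :: nat \<Rightarrow> real. (\<forall>k. t k \<ge> 1) \<and> \<not> bdd_above (range t) \<and>
     coarsely_equivalent B (\<lambda>k. warped_metric S (t k)))"


section \<open>Well-definedness of the two metrics\<close>

lemma warped_dist_greatest:
  fixes S :: "('a::metric_space \<Rightarrow> 'a) set"
  assumes t: "t > 0"
  shows "Metric_space UNIV (warped_dist S t)"
    and "warped_dist S t x y \<le> t * dist x y"
    and "s \<in> S \<Longrightarrow> warped_dist S t x (s x) \<le> 1"
    and "\<lbrakk>Metric_space UNIV \<rho>; \<And>x y. \<rho> x y \<le> t * dist x y; \<And>s x. s \<in> S \<Longrightarrow> \<rho> x (s x) \<le> 1\<rbrakk>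
           \<Longrightarrow> \<rho> x y \<le> warped_dist S t x y"
proof -
  define P where "P \<rho> \<longleftrightarrow> Metric_space UNIV \<rho> \<and> (\<forall>x y. \<rho> x y \<le> t * dist x y) \<and>
     (\<forall>s\<in>S. \<forall>x. \<rho> x (s x) \<le> 1)" for \<rho> :: "'a \<Rightarrow> 'a \<Rightarrow> real"
  define m where "m x y = min (t * dist x y) 1" for x y :: 'a
  define d where "d x y = (SUP \<rho>\<in>Collect P. \<rho> x y)" for x y
  have m: "P m"
    unfolding P_def m_def
  proof (intro conjI allI ballI)
    show "Metric_space UNIV (\<lambda>x y :: 'a. min (t * dist x y) 1)"
    proof
      fix x y z :: 'a
      have "t * dist x z \<le> t * dist x y + t * dist y z"
        using t by (simp add: dist_triangle flip: distrib_left)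
      moreover have "0 \<le> t * dist x y" "0 \<le> t * dist y z" using t by auto
      ultimately show "min (t * dist x z) 1 \<le> min (t * dist x y) 1 + min (t * dist y z) 1"
        by linarith
    qed (use t in \<open>auto simp: dist_commute min_def\<close>)
  qed auto
  have bdd: "bdd_above ((\<lambda>\<rho>. \<rho> x y) ` Collect P)" for x y
    by (rule bdd_aboveI2[where M = "t * dist x y"]) (auto simp: P_def)
  have ne: "Collect P \<noteq> {}" using m by auto
  have upper: "\<rho> x y \<le> d x y" if "P \<rho>" for \<rho> x y
    unfolding d_def using that by (intro cSUP_upper bdd) auto
  have least: "d x y \<le> c" if "\<And>\<rho>. P \<rho> \<Longrightarrow> \<rho> x y \<le> c" for x y c
    unfolding d_def using ne that by (intro cSUP_least) auto
  have "Metric_space UNIV d"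
  proof
    fix x y z
    show "0 \<le> d x y"
      using upper[OF m, of x y] m unfolding P_def Metric_space_def by (meson order_trans)
    have "\<rho> x y = \<rho> y x" if "P \<rho>" for \<rho>
      using that Metric_space.commute[of UNIV \<rho>] unfolding P_def by blast
    then show "d x y = d y x"
      unfolding d_def by (intro SUP_cong) auto
    show "d x z \<le> d x y + d y z"
    proof (rule least)
      fix \<rho> assume "P \<rho>"
      then have "\<rho> x z \<le> \<rho> x y + \<rho> y z"
        using Metric_space.triangle[of UNIV \<rho> x y z] unfolding P_def by blast
      with upper[OF \<open>P \<rho>\<close>, of x y] upper[OF \<open>P \<rho>\<close>, of y z] show "\<rho> x z \<le> d x y + d y z"
        by linarith
    qed
    have "d x x \<le> 0"
      by (rule least) (metis P_def Metric_space.zero UNIV_I order_refl)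
    moreover have "0 \<le> d x x"
      using upper[OF m, of x x] by (simp add: m_def)
    moreover have "m x y > 0" if "x \<noteq> y" using that t by (simp add: m_def)
    ultimately show "(d x y = 0) = (x = y)"
      using upper[OF m, of x y] by force
  qed
  then have "P d"
    unfolding P_def by (auto intro!: least simp: P_def)
  then have "warped_dist S t = d"
    unfolding warped_dist_def P_def[symmetric]
    by (intro Greatest_equality) (auto simp: le_fun_def upper)
  with \<open>P d\<close> upper show "Metric_space UNIV (warped_dist S t)"
    and "warped_dist S t x y \<le> t * dist x y"
    and "s \<in> S \<Longrightarrow> warped_dist S t x (s x) \<le> 1"
    and "\<lbrakk>Metric_space UNIV \<rho>; \<And>x y. \<rho> x y \<le> t * dist x y; \<And>s x. s \<in> S \<Longrightarrow> \<rho> x (s x) \<le> 1\<rbrakk>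
           \<Longrightarrow> \<rho> x y \<le> warped_dist S t x y"
    by (auto simp: P_def)
qed

lemma Metric_space_cayley_dist:
  fixes G (structure)
  assumes "group G" and T: "T \<subseteq> carrier G" and gen: "generate G T = carrier G"
  shows "Metric_space (carrier G) (cayley_dist G T)"
proof -
  interpret group G by fact
  define E where "E = cayley_edges G T \<union> (cayley_edges G T)\<inverse>"
  have dist: "cayley_dist G T g h = real (LEAST n. (g, h) \<in> E ^^ n)" for g h
    by (simp add: cayley_dist_def E_def)
  have "sym E" by (auto simp: E_def sym_def)
  then have sym: "(g, h) \<in> E ^^ n \<longleftrightarrow> (h, g) \<in> E ^^ n" for g h n
  proof -
    have "(h, g) \<in> E ^^ n" if "(g, h) \<in> E ^^ n" for g h n
      using that
    proof (induction n arbitrary: h)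
      case (Suc n)
      then obtain k where "(g, k) \<in> E ^^ n" "(k, h) \<in> E" by auto
      then show ?case using Suc.IH \<open>sym E\<close> by (meson relpow_Suc_I2 symD)
    qed simp
    then show ?thesis by blast
  qed
  have step: "\<exists>n. (g, g \<otimes> h) \<in> E ^^ n" if "h \<in> generate G T" "g \<in> carrier G" for g h
    using that
  proof (induction h arbitrary: g rule: generate.induct)
    case one
    then show ?case by (auto intro: exI[of _ 0])
  next
    case (incl h)
    then have "(g, g \<otimes> h) \<in> E ^^ 1" by (auto simp: E_def cayley_edges_def)
    then show ?case by blast
  next
    case (inv h)
    then have "(g \<otimes> inv h) \<otimes> h = g" "g \<otimes> inv h \<in> carrier G"
      using T by (auto simp: m_assoc subset_iff)
    then have "(g \<otimes> inv h, g) \<in> cayley_edges G T"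
      using inv.hyps unfolding cayley_edges_def by force
    then have "(g, g \<otimes> inv h) \<in> E ^^ 1" by (auto simp: E_def)
    then show ?case by blast
  next
    case (eng h1 h2)
    have h: "h1 \<in> carrier G" "h2 \<in> carrier G"
      using eng.hyps gen by auto
    obtain n1 where "(g, g \<otimes> h1) \<in> E ^^ n1" using eng by blast
    moreover obtain n2 where "(g \<otimes> h1, (g \<otimes> h1) \<otimes> h2) \<in> E ^^ n2"
      using eng h by (meson m_closed)
    ultimately have "(g, (g \<otimes> h1) \<otimes> h2) \<in> E ^^ (n1 + n2)"
      by (auto simp: relpow_add)
    with h \<open>g \<in> carrier G\<close> show ?case by (auto simp: m_assoc)
  qed
  have conn: "\<exists>n. (g, h) \<in> E ^^ n" if "g \<in> carrier G" "h \<in> carrier G" for g h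
    using step[of "inv g \<otimes> h" g] that gen by (simp add: m_assoc[symmetric])
  have least: "(g, h) \<in> E ^^ (LEAST n. (g, h) \<in> E ^^ n)" if "g \<in> carrier G" "h \<in> carrier G" for g h
    using conn[OF that] by (rule LeastI_ex)
  show ?thesis
  proof
    show "0 \<le> cayley_dist G T g h" for g h by (simp add: dist)
    show "cayley_dist G T g h = cayley_dist G T h g" for g h by (simp add: dist sym[of g h])
    show "(cayley_dist G T g h = 0) = (g = h)" if "g \<in> carrier G" "h \<in> carrier G" for g h
      using least[OF that] by (auto simp: dist intro: Least_eq_0)
    show "cayley_dist G T g k \<le> cayley_dist G T g h + cayley_dist G T h k"
      if "g \<in> carrier G" "h \<in> carrier G" "k \<in> carrier G" for g h k
    proof -
      have "(g, k) \<in> E ^^ ((LEAST n. (g, h) \<in> E ^^ n) + (LEAST n. (h, k) \<in> E ^^ n))"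
        using least[of g h] least[of h k] that by (auto simp: relpow_add)
      then show ?thesis
        unfolding dist by (metis Least_le of_nat_add of_nat_mono)
    qed
  qed
qed

end

theory Submission
  imports Defs
begin

text \<open>A warped system carries a transformation groupoid whose morphisms \<open>x \<rightarrow> y\<close> are pairs of a word \<open>w\<close> and
  a homotopy class of paths from \<open>x\<close> to \<open>w y\<close>; its vertex group at \<open>x\<^sub>0\<close> is \<open>\<pi>\<^sub>1(X) \<rtimes> F\<^sub>S\<close>. Write \<open>D\<close> for
  the normal closure of \<open>K\<^sub>\<theta>\<close> at a stable \<open>\<theta>\<close>. A short closed jumping path comes from a word that almost
  fixes a point, hence fixes a nearby one by compactness, and so lies in \<open>D\<close>. Conversely, a coarse
  equivalence with the Cayley graph of \<open>\<Lambda>/N\<^sub>k\<close> develops jumping paths into words over the generators of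
  \<open>\<Lambda>\<close>, well defined in every group in which the short relations of \<open>\<Lambda>\<close> hold, and this development kills
  \<open>K\<^sub>\<theta>\<close>. A relator of \<open>\<Lambda>\<close> of arbitrary length becomes, for large \<open>k\<close>, a short closed jumping path; it is
  therefore killed by the development, so \<open>\<Lambda>\<close> is presented by its short relations. Now jumping paths
  and words determine each other and \<open>\<pi>\<^sub>1\<^sub>,\<^sub>\<infinity> \<cong> N\<^sub>k\<close> for infinitely many \<open>k\<close>. Comparing two of these gives a
  proper finite index normal subgroup of \<open>\<pi>\<^sub>1\<^sub>,\<^sub>\<infinity>\<close> isomorphic to \<open>\<pi>\<^sub>1\<^sub>,\<^sub>\<infinity>\<close>.\<close>

section \<open>Free groups\<close>

text \<open>The obstacle is a conflict of sizes. The cocycle behind the development is known only up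
  to a fixed distance \<open>P\<close>, so it kills generators of bounded word length only, whereas
  relators of \<open>\<Lambda>\<close>, and hence the loops that have to be trivial, have no length
  bound. Stability resolves this: fixers of words of every length lie in the normal closure of those
  of length at most 4 * \<theta>. So \<open>P\<close> and the relation length \<open>r\<close>
  depend on L, A and \<theta> alone, and a longer relator is paid for by a larger scale t, never by
  a larger \<open>r\<close>. The target of the development is an arbitrary group because it is used
  twice: with the group presented by the short relations, where it yields the presentation of
  \<open>\<Lambda>\<close>, and then with \<open>\<Lambda>\<close> itself. Small steps have moving
  end points, which is the reason for the groupoid: base points and conjugating paths enter only
  when \<open>D\<close> is formed. Steps are measured by diameter, not length, so that every
  continuous path is a product of small steps and the shadowing by words reaches the whole vertex
  group.\<close>

lemma inv_letter_inv_letter [simp]: "inv_letter (inv_letter a) = a"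
  and fst_inv_letter [simp]: "fst (inv_letter a) = fst a"
  and snd_inv_letter [simp]: "snd (inv_letter a) = (\<not> snd a)"
  by (auto simp: inv_letter_def prod_eq_iff)

lemma reduced_Nil [simp]: "reduced []"
  by (simp add: reduced_def)

lemma reduced_Cons_iff: "reduced (a # w) \<longleftrightarrow> (w \<noteq> [] \<longrightarrow> hd w \<noteq> inv_letter a) \<and> reduced w"
proof
  assume *: "reduced (a # w)"
  have "w ! Suc i \<noteq> inv_letter (w ! i)" if "Suc i < length w" for i
    using *[unfolded reduced_def, rule_format, of "Suc i"] that by simp
  moreover have "w \<noteq> [] \<longrightarrow> hd w \<noteq> inv_letter a"
    using *[unfolded reduced_def, rule_format, of 0] by (auto simp: hd_conv_nth)
  ultimately show "(w \<noteq> [] \<longrightarrow> hd w \<noteq> inv_letter a) \<and> reduced w" by (simp add: reduced_def)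
next
  assume *: "(w \<noteq> [] \<longrightarrow> hd w \<noteq> inv_letter a) \<and> reduced w"
  show "reduced (a # w)"
    unfolding reduced_def
  proof (intro allI impI)
    fix i assume "Suc i < length (a # w)"
    with * show "(a # w) ! Suc i \<noteq> inv_letter ((a # w) ! i)"
      by (cases i) (auto simp: reduced_def hd_conv_nth)
  qed
qed

lemma reduced_reduced_Cons: "reduced w \<Longrightarrow> reduced (reduced_Cons a w)"
  by (cases w) (auto simp: reduced_Cons_def reduced_Cons_iff)

lemma reduced_Cons_cancel: "reduced w \<Longrightarrow> reduced_Cons a (reduced_Cons (inv_letter a) w) = w"
proof (cases w)
  case (Cons b u)
  assume "reduced w"
  with Cons have "u \<noteq> [] \<longrightarrow> hd u \<noteq> inv_letter b" by (simp add: reduced_Cons_iff)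
  with Cons show ?thesis by (cases "b = a") (auto simp: reduced_Cons_def)
qed (simp add: reduced_Cons_def)

lemma reduced_Cons_reduced: "reduced (a # w) \<Longrightarrow> reduced_Cons a w = a # w"
  by (auto simp: reduced_Cons_iff reduced_Cons_def)

abbreviation free_mult :: "'s word \<Rightarrow> 's word \<Rightarrow> 's word" where
  "free_mult v w \<equiv> foldr reduced_Cons v w"

lemma reduced_free_mult: "reduced w \<Longrightarrow> reduced (free_mult v w)"
  by (induction v) (auto simp: reduced_reduced_Cons)

lemma letters_reduced_Cons: "set (reduced_Cons a w) \<subseteq> insert a (set w)"
  by (cases w) (auto simp: reduced_Cons_def)

lemma letters_free_mult: "set (free_mult v w) \<subseteq> set v \<union> set w"
  by (induction v) (use letters_reduced_Cons in fastforce)+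

text \<open>Van der Waerden's argument: letters act on reduced words through
  \<open>reduced_Cons\<close>, and by \<open>reduced_Cons_cancel\<close> a letter and its inverse
  act as mutually inverse maps. Associativity of the free group becomes an induction on the left
  factor.\<close>

lemma free_mult_reduced_Cons:
  assumes "reduced w"
  shows "free_mult (reduced_Cons a v) w = reduced_Cons a (free_mult v w)"
proof (cases "v \<noteq> [] \<and> hd v = inv_letter a")
  case True
  then have "v = inv_letter a # tl v" by (metis list.collapse)
  then have "free_mult v w = reduced_Cons (inv_letter a) (free_mult (tl v) w)" by (metis foldr.simps(2) o_apply)
  with True assms show ?thesis
    by (simp add: reduced_Cons_def[of a v] reduced_Cons_cancel reduced_free_mult)
qed (auto simp: reduced_Cons_def[of a v])

lemma free_mult_assoc: "reduced w \<Longrightarrow> free_mult (free_mult u v) w = free_mult u (free_mult v w)"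
  by (induction u) (auto simp: free_mult_reduced_Cons)

lemma free_mult_Nil_right: "reduced w \<Longrightarrow> free_mult w [] = w"
  by (induction w) (auto simp: reduced_Cons_reduced reduced_Cons_iff)

lemma free_mult_inverse: "free_mult (rev (map inv_letter w)) w = []"
  by (induction w) (auto simp: reduced_Cons_def)

lemma length_reduced_Cons: "length (reduced_Cons a w) \<le> Suc (length w)"
  by (auto simp: reduced_Cons_def)

lemma length_free_mult: "length (free_mult v w) \<le> length v + length w"
  by (induction v) (use length_reduced_Cons le_trans in fastforce)+

lemma carrier_free_group: "carrier (free_group S) = {w. reduced w \<and> fst ` set w \<subseteq> S}"
  and mult_free_group: "mult (free_group S) v w = free_mult v w"
  and one_free_group: "one (free_group S) = []"
  by (simp_all add: free_group_def)

lemma free_mult_closed: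
  "\<lbrakk>v \<in> carrier (free_group S); w \<in> carrier (free_group S)\<rbrakk> \<Longrightarrow> free_mult v w \<in> carrier (free_group S)"
  using letters_free_mult[of v w] by (force simp: carrier_free_group reduced_free_mult)

lemma group_free_group: "group (free_group S)"
proof (rule groupI)
  show "x \<otimes>\<^bsub>free_group S\<^esub> y \<in> carrier (free_group S)"
    if "x \<in> carrier (free_group S)" "y \<in> carrier (free_group S)" for x y
    using that by (simp add: mult_free_group free_mult_closed)
  fix w assume w: "w \<in> carrier (free_group S)"
  let ?v = "free_mult (rev (map inv_letter w)) []"
  have "?v \<in> carrier (free_group S)"
    using w letters_free_mult[of "rev (map inv_letter w)" "[]"]
    by (fastforce simp: carrier_free_group reduced_free_mult)
  moreover have "free_mult ?v w = []"
    using w by (simp add: free_mult_assoc carrier_free_group free_mult_inverse)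
  ultimately show "\<exists>v\<in>carrier (free_group S). v \<otimes>\<^bsub>free_group S\<^esub> w = \<one>\<^bsub>free_group S\<^esub>"
    by (auto simp: mult_free_group one_free_group)
qed (auto simp: carrier_free_group mult_free_group one_free_group free_mult_assoc)

section \<open>Homotopy classes of paths\<close>

text \<open>Joining only at a common endpoint makes the product of homotopy classes a semigroup with
  zero \<open>{}\<close>, so that associativity needs no side conditions.\<close>

definition pjoin :: "(real \<Rightarrow> 'a::topological_space) set \<Rightarrow> (real \<Rightarrow> 'a) set \<Rightarrow> (real \<Rightarrow> 'a) set"
    (infixr "\<odot>" 75) where
  "A \<odot> B = {r. \<exists>p\<in>A. \<exists>q\<in>B. pathfinish p = pathstart q \<and> homotopic_paths UNIV (p +++ q) r}"

definition push :: "('a \<Rightarrow> 'b) \<Rightarrow> (real \<Rightarrow> 'a::topological_space) set \<Rightarrow> (real \<Rightarrow> 'b::topological_space) set" where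
  "push g A = (\<Union>p\<in>A. path_class (g \<circ> p))"

lemma path_class_eq_iff: "path p \<Longrightarrow> path_class p = path_class q \<longleftrightarrow> homotopic_paths UNIV p q"
  by (auto simp: path_class_def intro: homotopic_paths_trans homotopic_paths_sym)

lemma path_class_eqI: "homotopic_paths UNIV p q \<Longrightarrow> path_class p = path_class q"
  using path_class_eq_iff homotopic_paths_imp_path by blast

lemma mem_path_class: "path p \<Longrightarrow> p \<in> path_class p"
  by (simp add: path_class_def)

lemma path_class_nonpath: "\<not> path p \<Longrightarrow> path_class p = {}"
  using homotopic_paths_imp_path by (auto simp: path_class_def)

lemma mem_path_classD:
  assumes "q \<in> path_class p"
  shows "path p" "path q" "pathstart q = pathstart p" "pathfinish q = pathfinish p"
  using homotopic_paths_imp_path[of UNIV p q] homotopic_paths_imp_pathstart[of UNIV p q]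
    homotopic_paths_imp_pathfinish[of UNIV p q] assms
  by (auto simp: path_class_def)

lemma path_class_join:
  assumes "pathfinish p = pathstart q"
  shows "path_class (p +++ q) = path_class p \<odot> path_class q"
proof (intro subset_antisym subsetI)
  fix r assume r: "r \<in> path_class (p +++ q)"
  then have "path p" "path q" using mem_path_classD(1)[OF r] assms by auto
  with r assms show "r \<in> path_class p \<odot> path_class q"
    unfolding pjoin_def path_class_def
    by (simp, intro exI[of _ p] exI[of _ q] conjI) auto
next
  fix r assume "r \<in> path_class p \<odot> path_class q"
  then obtain p' q' where "homotopic_paths UNIV p p'" "homotopic_paths UNIV q q'"
    "homotopic_paths UNIV (p' +++ q') r"
    by (auto simp: pjoin_def path_class_def)
  with assms show "r \<in> path_class (p +++ q)"
    unfolding path_class_def by (auto intro: homotopic_paths_trans[OF homotopic_paths_join])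
qed

lemma pjoin_assoc: "(A \<odot> B) \<odot> C = A \<odot> B \<odot> C"
proof (intro subset_antisym subsetI)
  fix x assume "x \<in> (A \<odot> B) \<odot> C"
  then obtain p q s r where *: "p \<in> A" "q \<in> B" "r \<in> C" "pathfinish p = pathstart q"
    and s: "homotopic_paths UNIV (p +++ q) s" "pathfinish s = pathstart r" "homotopic_paths UNIV (s +++ r) x"
    by (auto simp: pjoin_def)
  have fin: "pathfinish q = pathstart r"
    using homotopic_paths_imp_pathfinish[OF s(1)] s(2) by simp
  have path: "path p" "path q" "path r"
    using homotopic_paths_imp_path[OF s(1)] homotopic_paths_imp_path[OF s(3)] * s(2) by auto
  have "homotopic_paths UNIV ((p +++ q) +++ r) (s +++ r)"
    using s(1) path(3) fin by (intro homotopic_paths_join) auto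
  moreover have "homotopic_paths UNIV (p +++ (q +++ r)) ((p +++ q) +++ r)"
    using path * fin by (intro homotopic_paths_assoc) auto
  ultimately have "homotopic_paths UNIV (p +++ (q +++ r)) x"
    using s(3) homotopic_paths_trans by blast
  moreover have "q +++ r \<in> B \<odot> C"
    unfolding pjoin_def using * fin path by force
  ultimately show "x \<in> A \<odot> B \<odot> C"
    unfolding pjoin_def[of A "B \<odot> C"] using *
    by (simp, intro bexI[of _ p] bexI[of _ "q +++ r"]) auto
next
  fix x assume "x \<in> A \<odot> B \<odot> C"
  then obtain p q s r where *: "p \<in> A" "q \<in> B" "r \<in> C" "pathfinish q = pathstart r"
    and s: "homotopic_paths UNIV (q +++ r) s" "pathfinish p = pathstart s" "homotopic_paths UNIV (p +++ s) x"
    by (auto simp: pjoin_def)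
  have fin: "pathfinish p = pathstart q"
    using homotopic_paths_imp_pathstart[OF s(1)] s(2) by simp
  have path: "path p" "path q" "path r"
    using homotopic_paths_imp_path[OF s(1)] homotopic_paths_imp_path[OF s(3)] * s(2) by auto
  have "homotopic_paths UNIV (p +++ (q +++ r)) (p +++ s)"
    using s(1) path(1) fin by (intro homotopic_paths_join) auto
  moreover have "homotopic_paths UNIV (p +++ (q +++ r)) ((p +++ q) +++ r)"
    using path * fin by (intro homotopic_paths_assoc) auto
  ultimately have "homotopic_paths UNIV ((p +++ q) +++ r) x"
    using s(3) homotopic_paths_trans homotopic_paths_sym by blast
  moreover have "p +++ q \<in> A \<odot> B"
    unfolding pjoin_def using * fin path by force
  ultimately show "x \<in> (A \<odot> B) \<odot> C"
    unfolding pjoin_def[of "A \<odot> B" C] using * fin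
    by (simp, intro bexI[of _ "p +++ q"] bexI[of _ r]) auto
qed

lemma path_const [simp]: "path (\<lambda>_. x)"
  by (simp add: path_def)

lemma pathstart_const [simp]: "pathstart (\<lambda>_. x) = x"
  and pathfinish_const [simp]: "pathfinish (\<lambda>_. x) = x"
  by (simp_all add: pathstart_def pathfinish_def)

lemma const_pjoin:
  assumes "pathstart p = x"
  shows "path_class (\<lambda>_. x) \<odot> path_class p = path_class p"
proof (cases "path p")
  case True
  have "homotopic_paths UNIV p ((\<lambda>_. x) +++ p)"
    unfolding joinpaths_def
    by (rule homotopic_paths_reparametrize[OF True, where f = "\<lambda>t. if t \<le> 1/2 then 0 else 2 *\<^sub>R t - 1"])
      (use assms in \<open>auto simp: pathstart_def split_01 intro!: continuous_intros continuous_on_cases\<close>)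
  from path_class_eqI[OF this] show ?thesis
    using assms by (simp add: path_class_join)
qed (use mem_path_classD(1) in \<open>auto simp: path_class_nonpath pjoin_def\<close>)

lemma pjoin_const:
  assumes "pathfinish p = x"
  shows "path_class p \<odot> path_class (\<lambda>_. x) = path_class p"
proof (cases "path p")
  case True
  have "homotopic_paths UNIV p (p +++ (\<lambda>_. x))"
    unfolding joinpaths_def
    by (rule homotopic_paths_reparametrize[OF True, where f = "\<lambda>t. if t \<le> 1/2 then 2 *\<^sub>R t else 1"])
      (use assms in \<open>auto simp: pathfinish_def split_01 intro!: continuous_intros continuous_on_cases\<close>)
  from path_class_eqI[OF this] show ?thesis
    using assms by (simp add: path_class_join)
qed (use mem_path_classD(1) in \<open>auto simp: path_class_nonpath pjoin_def\<close>)

lemma pjoin_reversepath: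
  assumes p: "path p"
  shows "path_class p \<odot> path_class (reversepath p) = path_class (\<lambda>_. pathstart p)"
proof -
  \<comment> \<open>At stage \<open>fst y\<close> the path runs out along \<open>p\<close> up to
    parameter \<open>fst y\<close> and back; the factor with the absolute value is the tent
    function.\<close>
  define h where "h y = p (fst y * (1 - \<bar>2 * snd y - 1\<bar>))" for y :: "real \<times> real"
  have "fst y * (1 - \<bar>2 * snd y - 1\<bar>) \<in> {0..1}" if "y \<in> {0..1} \<times> {0..1}" for y :: "real \<times> real"
    using that by (auto intro!: mult_le_one mult_nonneg_nonneg)
  then have "continuous_on ({0..1} \<times> {0..1}) h"
    unfolding h_def
    by (intro continuous_on_compose2[OF p[unfolded path_def]] continuous_intros) auto
  moreover have "h (1, x) = (p +++ reversepath p) x" for x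
    by (auto simp: h_def joinpaths_def reversepath_def algebra_simps)
  ultimately have "homotopic_paths UNIV (\<lambda>_. pathstart p) (p +++ reversepath p)"
    unfolding homotopic_paths
    by (intro exI[of _ h]) (auto simp: h_def pathstart_def pathfinish_def joinpaths_def reversepath_def)
  from path_class_eqI[OF this] show ?thesis
    by (simp add: path_class_join)
qed

lemma push_path_class:
  assumes g: "continuous_on UNIV g" and p: "path p"
  shows "push g (path_class p) = path_class (g \<circ> p)"
proof -
  have "path_class (g \<circ> q) = path_class (g \<circ> p)" if "q \<in> path_class p" for q
  proof -
    from that have "homotopic_paths UNIV p q" by (simp add: path_class_def)
    then have "homotopic_paths UNIV (g \<circ> p) (g \<circ> q)"
      using g by (rule homotopic_paths_continuous_image) auto
    then show ?thesis by (simp add: path_class_eqI)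
  qed
  then have "push g (path_class p) = (\<Union>q\<in>path_class p. path_class (g \<circ> p))"
    unfolding push_def by (intro SUP_cong refl)
  moreover have "path_class p \<noteq> {}" using mem_path_class[OF p] by blast
  ultimately show ?thesis by simp
qed

lemma path_compose: "continuous_on UNIV g \<Longrightarrow> path p \<Longrightarrow> path (g \<circ> p)"
  using path_continuous_image continuous_on_subset by blast

lemma compose_join: "g \<circ> (p +++ q) = (g \<circ> p) +++ (g \<circ> q)"
  by (auto simp: joinpaths_def)

lemma pathstart_comp: "pathstart (g \<circ> p) = g (pathstart p)"
  and pathfinish_comp: "pathfinish (g \<circ> p) = g (pathfinish p)"
  by (simp_all add: pathstart_def pathfinish_def)

section \<open>The transformation groupoid\<close>

text \<open>Serves to read off the group axioms of \<open>\<Gamma>\<close> from the vertex group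
  \<open>J0 x0\<close>, in place of a verification that \<open>phi\<close> is an action by
  automorphisms.\<close>

lemma group_if_bij_hom:
  fixes G (structure) and H (structure)
  assumes "group H" and h: "h \<in> hom G H" "bij_betw h (carrier G) (carrier H)"
    and closed: "\<And>x y. \<lbrakk>x \<in> carrier G; y \<in> carrier G\<rbrakk> \<Longrightarrow> x \<otimes>\<^bsub>G\<^esub> y \<in> carrier G"
    and one: "\<one>\<^bsub>G\<^esub> \<in> carrier G" "h \<one>\<^bsub>G\<^esub> = \<one>\<^bsub>H\<^esub>"
  shows "group G"
proof -
  interpret H: group H by fact
  have inj: "x = y" if "h x = h y" "x \<in> carrier G" "y \<in> carrier G" for x y
    using that h(2) by (auto simp: bij_betw_def inj_on_def)
  have mem: "h x \<in> carrier H" if "x \<in> carrier G" for x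
    using that h(1) by (auto simp: hom_def)
  have mult: "h (x \<otimes>\<^bsub>G\<^esub> y) = h x \<otimes>\<^bsub>H\<^esub> h y" if "x \<in> carrier G" "y \<in> carrier G" for x y
    using that h(1) by (auto simp: hom_def)
  show ?thesis
  proof (rule groupI)
    show "x \<otimes>\<^bsub>G\<^esub> y \<otimes>\<^bsub>G\<^esub> z = x \<otimes>\<^bsub>G\<^esub> (y \<otimes>\<^bsub>G\<^esub> z)"
      if "x \<in> carrier G" "y \<in> carrier G" "z \<in> carrier G" for x y z
      using that by (intro inj) (simp_all add: mult mem closed H.m_assoc)
    show "\<one>\<^bsub>G\<^esub> \<otimes>\<^bsub>G\<^esub> x = x" if "x \<in> carrier G" for x
      using that by (intro inj) (simp_all add: mult mem closed one)
    show "\<exists>y\<in>carrier G. y \<otimes>\<^bsub>G\<^esub> x = \<one>\<^bsub>G\<^esub>" if x: "x \<in> carrier G" for x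
    proof -
      have "inv\<^bsub>H\<^esub> (h x) \<in> h ` carrier G"
        using h(2) mem[OF x] by (simp add: bij_betw_def)
      then obtain y where y: "y \<in> carrier G" "h y = inv\<^bsub>H\<^esub> (h x)" by auto
      then have "y \<otimes>\<^bsub>G\<^esub> x = \<one>\<^bsub>G\<^esub>"
        using x by (intro inj) (simp_all add: mult mem closed one)
      with y show ?thesis by blast
    qed
  qed (use closed one in auto)
qed

type_synonym 'a jelem = "(real \<Rightarrow> 'a) set \<times> ('a \<Rightarrow> 'a) word"

locale homeo_system =
  fixes S :: "('a::metric_space \<Rightarrow> 'a) set"
  assumes homeo: "s \<in> S \<Longrightarrow> homeomorphism UNIV UNIV s (inv_into UNIV s)"
begin

abbreviation "F \<equiv> carrier (free_group S)"

lemma continuous_letter_map: "fst a \<in> S \<Longrightarrow> continuous_on UNIV (letter_map a)"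
  using homeo[of "fst a"] by (auto simp: homeomorphism_def letter_map_def)

lemma letter_map_inverse: "fst a \<in> S \<Longrightarrow> letter_map a (letter_map (inv_letter a) x) = x"
  "fst a \<in> S \<Longrightarrow> letter_map (inv_letter a) (letter_map a x) = x"
  using homeo[of "fst a"] by (auto simp: homeomorphism_def letter_map_def)

lemma word_map_Nil [simp]: "word_map [] = id"
  and word_map_Cons: "word_map (a # w) = letter_map a \<circ> word_map w"
  by (auto simp: word_map_def)

lemma continuous_word_map: "fst ` set w \<subseteq> S \<Longrightarrow> continuous_on UNIV (word_map w)"
proof (induction w)
  case (Cons a w)
  then show ?case
    by (auto simp: word_map_Cons comp_def intro!: continuous_on_compose2[OF continuous_letter_map])
qed (simp add: continuous_on_id)

lemma word_map_reduced_Cons: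
  assumes "fst a \<in> S"
  shows "word_map (reduced_Cons a w) = letter_map a \<circ> word_map w"
proof (cases "w \<noteq> [] \<and> hd w = inv_letter a")
  case True
  then have "w = inv_letter a # tl w" by (metis list.collapse)
  then have "word_map w = letter_map (inv_letter a) \<circ> word_map (tl w)"
    by (metis word_map_Cons)
  with True show ?thesis
    by (auto simp: reduced_Cons_def fun_eq_iff letter_map_inverse[OF assms])
qed (auto simp: reduced_Cons_def word_map_Cons)

lemma word_map_free_mult:
  "fst ` set v \<subseteq> S \<Longrightarrow> word_map (free_mult v w) = word_map v \<circ> word_map w"
  by (induction v) (auto simp: word_map_reduced_Cons word_map_Cons)

lemma letters_F: "w \<in> F \<Longrightarrow> fst ` set w \<subseteq> S"
  by (auto simp: carrier_free_group)

lemma reduced_F: "w \<in> F \<Longrightarrow> reduced w"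
  by (auto simp: carrier_free_group)

lemma Nil_in_F [simp]: "[] \<in> F"
  by (simp add: carrier_free_group)

lemma word_map_F: "\<lbrakk>v \<in> F; w \<in> F\<rbrakk> \<Longrightarrow> word_map (free_mult v w) x = word_map v (word_map w x)"
  by (simp add: word_map_free_mult letters_F)

lemma continuous_F: "w \<in> F \<Longrightarrow> continuous_on UNIV (word_map w)"
  by (simp add: continuous_word_map letters_F)

definition winv :: "('a \<Rightarrow> 'a) word \<Rightarrow> ('a \<Rightarrow> 'a) word" where
  "winv w = inv\<^bsub>free_group S\<^esub> w"

lemma winv:
  assumes "w \<in> F"
  shows "winv w \<in> F" "free_mult w (winv w) = []" "free_mult (winv w) w = []"
    "word_map w (word_map (winv w) x) = x" "word_map (winv w) (word_map w x) = x"
proof -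
  interpret group "free_group S" by (rule group_free_group)
  show *: "winv w \<in> F" "free_mult w (winv w) = []" "free_mult (winv w) w = []"
    using assms r_inv[OF assms] l_inv[OF assms] inv_closed[OF assms]
    by (auto simp: winv_def mult_free_group one_free_group)
  show "word_map w (word_map (winv w) x) = x" "word_map (winv w) (word_map w x) = x"
    using word_map_F[OF assms *(1), of x] word_map_F[OF *(1) assms, of x] * by auto
qed

definition J :: "'a \<Rightarrow> 'a \<Rightarrow> 'a jelem set" where
  "J x y = {(path_class p, w) |p w.
     path p \<and> pathstart p = x \<and> w \<in> F \<and> pathfinish p = word_map w y}"

definition jmult :: "'a jelem \<Rightarrow> 'a jelem \<Rightarrow>
    'a jelem" (infixr "\<star>" 70) where
  "g \<star> h = (fst g \<odot> push (word_map (snd g)) (fst h), free_mult (snd g) (snd h))"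

definition jone :: "'a \<Rightarrow> 'a jelem" where
  "jone x = (path_class (\<lambda>_. x), [])"

definition jinv :: "'a jelem \<Rightarrow> 'a jelem" where
  "jinv g = (push (word_map (winv (snd g))) (\<Union>p\<in>fst g. path_class (reversepath p)), winv (snd g))"

lemma J_I: "\<lbrakk>path p; pathstart p = x; w \<in> F; pathfinish p = word_map w y\<rbrakk> \<Longrightarrow> (path_class p, w) \<in> J x y"
  by (auto simp: J_def)

lemma J_E:
  assumes "g \<in> J x y"
  obtains p w where "g = (path_class p, w)" "path p" "pathstart p = x" "w \<in> F"
    "pathfinish p = word_map w y"
  using assms by (auto simp: J_def)

lemma jmult_path:
  assumes "path p" "path q" "w \<in> F" "pathfinish p = word_map w (pathstart q)"
  shows "(path_class p, w) \<star> (path_class q, v) =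
    (path_class (p +++ (word_map w \<circ> q)), free_mult w v)"
  using assms
  by (simp add: jmult_def push_path_class continuous_F path_class_join pathstart_comp)

lemma jmult_closed: "\<lbrakk>g \<in> J x y; h \<in> J y z\<rbrakk> \<Longrightarrow> g \<star> h \<in> J x z"
  by (elim J_E)
    (auto simp: jmult_path pathstart_comp pathfinish_comp path_compose continuous_F
      word_map_F free_mult_closed intro!: J_I path_join_imp)

lemma jmult_assoc:
  assumes "g \<in> J x y" "h \<in> J y z" "k \<in> J z u"
  shows "(g \<star> h) \<star> k = g \<star> h \<star> k"
proof -
  from assms obtain p w q v r s where
    *: "g = (path_class p, w)" "path p" "w \<in> F" "pathfinish p = word_map w y"
    "h = (path_class q, v)" "path q" "pathstart q = y" "v \<in> F" "pathfinish q = word_map v z"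
    "k = (path_class r, s)" "path r" "pathstart r = z" "s \<in> F"
    by (elim J_E) blast
  have gh: "g \<star> h = (path_class (p +++ (word_map w \<circ> q)), free_mult w v)"
    and hk: "h \<star> k = (path_class (q +++ (word_map v \<circ> r)), free_mult v s)"
    using * by (simp_all add: jmult_path)
  have paths: "path (p +++ (word_map w \<circ> q))" "path (q +++ (word_map v \<circ> r))"
    using * by (simp_all add: path_compose continuous_F pathstart_comp)
  have "(g \<star> h) \<star> k = (path_class ((p +++ (word_map w \<circ> q)) +++ (word_map (free_mult w v) \<circ> r)),
      free_mult (free_mult w v) s)"
    unfolding gh using * paths(1)
    by (simp add: jmult_path free_mult_closed pathfinish_comp word_map_F)
  moreover have "g \<star> h \<star> k = (path_class (p +++ (word_map w \<circ> (q +++ (word_map v \<circ> r)))),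
      free_mult w (free_mult v s))"
    unfolding hk using * paths(2) by (simp add: jmult_path)
  moreover have "word_map (free_mult w v) \<circ> r = word_map w \<circ> (word_map v \<circ> r)"
    using * by (auto simp: word_map_F)
  ultimately show ?thesis
    using * by (simp add: compose_join path_class_join pathfinish_comp pathstart_comp pjoin_assoc
        free_mult_assoc reduced_F)
qed

lemma jone_closed [simp]: "jone x \<in> J x x"
  unfolding jone_def by (rule J_I) auto

lemma jone_left: "g \<in> J x y \<Longrightarrow> jone x \<star> g = g"
  unfolding jone_def
  by (elim J_E) (simp add: jmult_path path_class_join const_pjoin)

lemma jone_right: "g \<in> J x y \<Longrightarrow> g \<star> jone y = g"
  unfolding jone_def
  by (elim J_E) (simp add: jmult_path path_class_join comp_def pjoin_const free_mult_Nil_right reduced_F)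

lemma jinv_path:
  assumes "path p" "w \<in> F"
  shows "jinv (path_class p, w) = (path_class (word_map (winv w) \<circ> reversepath p), winv w)"
proof -
  have "path_class (reversepath q) = path_class (reversepath p)" if "q \<in> path_class p" for q
  proof -
    from that have "homotopic_paths UNIV p q" by (simp add: path_class_def)
    then have "homotopic_paths UNIV (reversepath p) (reversepath q)"
      by (simp add: homotopic_paths_reversepath)
    then show ?thesis by (simp add: path_class_eqI)
  qed
  then have "(\<Union>q\<in>path_class p. path_class (reversepath q)) = (\<Union>q\<in>path_class p. path_class (reversepath p))"
    by (intro SUP_cong refl)
  moreover have "path_class p \<noteq> {}" using mem_path_class[OF assms(1)] by blast
  ultimately have "(\<Union>q\<in>path_class p. path_class (reversepath q)) = path_class (reversepath p)"
    by simp
  with assms show ?thesis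
    by (simp add: jinv_def push_path_class continuous_F winv)
qed

lemma jinv_closed: "g \<in> J x y \<Longrightarrow> jinv g \<in> J y x"
  by (elim J_E) (auto simp: jinv_path winv pathstart_comp pathfinish_comp intro!: J_I path_compose continuous_F)

lemma jinv_right:
  assumes "g \<in> J x y"
  shows "g \<star> jinv g = jone x"
  using assms
proof (rule J_E)
  fix p w
  assume *: "g = (path_class p, w)" "path p" "pathstart p = x" "w \<in> F" "pathfinish p = word_map w y"
  have "word_map w \<circ> (word_map (winv w) \<circ> reversepath p) = reversepath p"
    using * by (auto simp: winv)
  with * show ?thesis
    by (simp add: jinv_path jmult_path path_compose continuous_F winv pathstart_comp path_class_join
        pjoin_reversepath jone_def)
qed

lemma jinv_left:
  assumes "g \<in> J x y"
  shows "jinv g \<star> g = jone y"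
proof -
  note g = jinv_closed[OF assms]
  have "jinv g \<star> g = (jinv g \<star> g) \<star> (jinv g \<star> jinv (jinv g))"
    using assms g jmult_closed[OF g assms] by (simp add: jinv_right jone_right)
  also have "\<dots> = jinv g \<star> (g \<star> jinv g) \<star> jinv (jinv g)"
    using assms g jinv_closed[OF g] jmult_closed[OF g assms] jmult_closed[OF assms g]
      jmult_closed[OF g jinv_closed[OF g]]
    by (metis jmult_assoc)
  also have "\<dots> = jone y"
    using assms g jinv_closed[OF g] by (simp add: jinv_right jone_left)
  finally show ?thesis .
qed

definition J0 :: "'a \<Rightarrow> 'a jelem monoid" where
  "J0 x = \<lparr>carrier = J x x, mult = (\<star>), one = jone x\<rparr>"

lemma J0_simps [simp]: "carrier (J0 x) = J x x" "mult (J0 x) = (\<star>)" "one (J0 x) = jone x"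
  by (simp_all add: J0_def)

lemma group_J0: "group (J0 x)"
  by (rule groupI) (auto simp: jmult_closed jmult_assoc jone_left intro: jinv_closed jinv_left)

end

section \<open>The group of a warped system as a vertex group\<close>

lemma (in group) normal_closure_normal: "K \<subseteq> carrier G \<Longrightarrow> normal_closure G K \<lhd> G"
proof -
  assume K: "K \<subseteq> carrier G"
  let ?T = "{N. N \<lhd> G \<and> K \<subseteq> N}"
  have "carrier G \<in> ?T"
    using K normal_invI[OF subgroup_self] by auto
  then have "subgroup (\<Inter> ?T) G"
    by (intro subgroups_Inter) (auto simp: normal_imp_subgroup)
  then show ?thesis
    unfolding normal_closure_def hull_def
    by (rule normal_invI) (auto simp: normal_invE(2))
qed

lemma normal_closure_superset: "K \<subseteq> normal_closure G K"
  unfolding normal_closure_def by (rule hull_subset)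

lemma normal_closure_minimal: "\<lbrakk>N \<lhd> G; K \<subseteq> N\<rbrakk> \<Longrightarrow> normal_closure G K \<subseteq> N"
  unfolding normal_closure_def by (rule hull_minimal)

locale warped_paths = homeo_system S for S :: "('a::metric_space \<Rightarrow> 'a) set" +
  fixes x0 :: 'a and \<alpha> :: "('a \<Rightarrow> 'a) \<Rightarrow> real \<Rightarrow> 'a"
  assumes alpha: "s \<in> S \<Longrightarrow> path (\<alpha> s) \<and> pathstart (\<alpha> s) = x0 \<and> pathfinish (\<alpha> s) = s x0"
begin

abbreviation "\<Gamma> \<equiv> warped_semidirect S x0 \<alpha>"
abbreviation "wp \<equiv> word_path x0 \<alpha>"

lemma letter_path:
  assumes "fst a \<in> S"
  shows "path (letter_path \<alpha> a)" "pathstart (letter_path \<alpha> a) = x0"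
    "pathfinish (letter_path \<alpha> a) = letter_map a x0"
    "letter_map a \<circ> letter_path \<alpha> (inv_letter a) = reversepath (letter_path \<alpha> a)"
proof -
  show "path (letter_path \<alpha> a)" "pathstart (letter_path \<alpha> a) = x0"
    "pathfinish (letter_path \<alpha> a) = letter_map a x0"
    using alpha[OF assms] homeo[OF assms]
    by (auto simp: letter_path_def letter_map_def homeomorphism_def pathstart_comp pathfinish_comp
        intro!: path_compose)
  show "letter_map a \<circ> letter_path \<alpha> (inv_letter a) = reversepath (letter_path \<alpha> a)"
    using homeo[OF assms]
    by (auto simp: letter_path_def letter_map_def homeomorphism_def fun_eq_iff reversepath_def)
qed

lemma word_path:
  assumes "fst ` set w \<subseteq> S"
  shows "path (wp w)" "pathstart (wp w) = x0" "pathfinish (wp w) = word_map w x0"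
  using assms
  by (induction w) (auto simp: letter_path pathstart_comp pathfinish_comp word_map_Cons
      intro!: path_compose continuous_letter_map)

lemma path_class_word_path_Cons:
  assumes "fst a \<in> S" "fst ` set w \<subseteq> S"
  shows "path_class (wp (a # w)) = path_class (letter_path \<alpha> a) \<odot> push (letter_map a) (path_class (wp w))"
  using assms by (simp add: path_class_join letter_path pathstart_comp word_path push_path_class
      continuous_letter_map)

text \<open>By the choice of \<alpha> on inverse letters, a cancelling pair contributes
  \<open>letter_path \<alpha> a\<close> followed by its reverse, which is null homotopic.\<close>

lemma path_class_word_path_reduced_Cons:
  assumes "fst a \<in> S" "fst ` set w \<subseteq> S"
  shows "path_class (wp (reduced_Cons a w)) = path_class (wp (a # w))"
proof (cases "w \<noteq> [] \<and> hd w = inv_letter a")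
  case True
  then obtain v where v: "w = inv_letter a # v" by (metis list.collapse)
  have letters: "fst ` set v \<subseteq> S" "fst (inv_letter a) \<in> S" using assms v by auto
  have "wp (a # w) = letter_path \<alpha> a +++ (reversepath (letter_path \<alpha> a) +++ wp v)"
    by (simp add: v compose_join letter_path assms o_assoc letter_map_inverse flip: o_assoc)
      (simp add: fun_eq_iff letter_map_inverse assms comp_def)
  moreover have "path_class \<dots> =
      (path_class (letter_path \<alpha> a) \<odot> path_class (reversepath (letter_path \<alpha> a))) \<odot> path_class (wp v)"
    using assms letters by (simp add: path_class_join letter_path word_path pjoin_assoc)
  ultimately have "path_class (wp (a # w)) = path_class (wp v)"
    using assms letters by (simp add: pjoin_reversepath letter_path word_path const_pjoin)
  with True v show ?thesis by (simp add: reduced_Cons_def)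
qed (auto simp: reduced_Cons_def)

lemma path_class_word_path_free_mult:
  assumes "fst ` set v \<subseteq> S" "fst ` set w \<subseteq> S"
  shows "path_class (wp (free_mult v w)) = path_class (wp v +++ (word_map v \<circ> wp w))"
  using assms(1)
proof (induction v)
  case Nil
  then show ?case using assms(2) by (simp add: path_class_join const_pjoin word_path)
next
  case (Cons a v)
  have letters: "fst a \<in> S" "fst ` set v \<subseteq> S" "fst ` set (free_mult v w) \<subseteq> S"
    using Cons.prems assms(2) image_mono[OF letters_free_mult[of v w], of fst]
    by (simp_all add: image_Un) blast
  have "path_class (wp (free_mult (a # v) w)) =
      path_class (letter_path \<alpha> a) \<odot> push (letter_map a) (path_class (wp v +++ (word_map v \<circ> wp w)))"
    using path_class_word_path_reduced_Cons[OF letters(1,3)]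
    unfolding path_class_word_path_Cons[OF letters(1,3)] Cons.IH[OF letters(2)] by simp
  also have "\<dots> = path_class (letter_path \<alpha> a) \<odot>
      path_class ((letter_map a \<circ> wp v) +++ (word_map (a # v) \<circ> wp w))"
    using letters assms(2)
    by (simp add: push_path_class continuous_letter_map path_compose continuous_word_map word_path
        pathstart_comp compose_join word_map_Cons o_assoc)
  also have "\<dots> = path_class (wp (a # v) +++ (word_map (a # v) \<circ> wp w))"
    using letters assms(2)
    by (simp add: path_class_join letter_path word_path pathstart_comp pathfinish_comp word_map_Cons
        pjoin_assoc)
  finally show ?case .
qed

text \<open>The product is defined as a union over all representatives; homotopic factors have
  homotopic joins, so the union is a single class.\<close>

lemma fundamental_group_mult:
  assumes "path p" "path q" "pathfinish p = pathstart q"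
  shows "path_class p \<otimes>\<^bsub>fundamental_group x0\<^esub> path_class q = path_class (p +++ q)"
proof -
  have "path_class (p' +++ q') = path_class (p +++ q)"
    if "p' \<in> path_class p" "q' \<in> path_class q" for p' q'
  proof -
    from that assms have "homotopic_paths UNIV (p +++ q) (p' +++ q')"
      by (intro homotopic_paths_join) (auto simp: path_class_def)
    then show ?thesis by (simp add: path_class_eqI)
  qed
  then have "path_class p \<otimes>\<^bsub>fundamental_group x0\<^esub> path_class q =
      (\<Union>p'\<in>path_class p. \<Union>q'\<in>path_class q. path_class (p +++ q))"
    unfolding fundamental_group_def by (simp del: UN_constant UN_simps cong: SUP_cong)
  moreover have "path_class p \<noteq> {}" "path_class q \<noteq> {}"
    using mem_path_class assms by blast+
  ultimately show ?thesis by simp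
qed

lemma phi_path_class:
  assumes "path p" "pathstart p = x0" "pathfinish p = x0" "w \<in> F"
  shows "phi x0 \<alpha> w (path_class p) = path_class (wp w +++ (word_map w \<circ> p) +++ reversepath (wp w))"
proof -
  note w = letters_F[OF assms(4)]
  have "path_class (wp w +++ (word_map w \<circ> q) +++ reversepath (wp w)) =
      path_class (wp w +++ (word_map w \<circ> p) +++ reversepath (wp w))" if "q \<in> path_class p" for q
  proof -
    from that have "homotopic_paths UNIV p q" by (simp add: path_class_def)
    then have "homotopic_paths UNIV (word_map w \<circ> p) (word_map w \<circ> q)"
      using w by (intro homotopic_paths_continuous_image[where S = UNIV] continuous_word_map) auto
    then have "homotopic_paths UNIV (wp w +++ (word_map w \<circ> p) +++ reversepath (wp w))
        (wp w +++ (word_map w \<circ> q) +++ reversepath (wp w))"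
      using assms w by (intro homotopic_paths_join) (auto simp: word_path pathstart_comp pathfinish_comp)
    then show ?thesis by (simp add: path_class_eqI)
  qed
  then have "phi x0 \<alpha> w (path_class p) =
      (\<Union>q\<in>path_class p. path_class (wp w +++ (word_map w \<circ> p) +++ reversepath (wp w)))"
    unfolding phi_def by (intro SUP_cong refl)
  moreover have "path_class p \<noteq> {}" using mem_path_class assms by blast
  ultimately show ?thesis by simp
qed

lemma \<Gamma>_simps:
  "carrier \<Gamma> = {(path_class p, w) |p w. path p \<and> pathstart p = x0 \<and> pathfinish p = x0 \<and> w \<in> F}"
  "\<one>\<^bsub>\<Gamma>\<^esub> = (path_class (\<lambda>_. x0), [])"
  by (auto simp: warped_semidirect_def semidirect_def fundamental_group_def one_free_group)

lemma \<Gamma>_I: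
  "\<lbrakk>path p; pathstart p = x0; pathfinish p = x0; w \<in> F\<rbrakk> \<Longrightarrow> (path_class p, w) \<in> carrier \<Gamma>"
  by (auto simp: \<Gamma>_simps)

lemma \<Gamma>_mult:
  assumes "path p" "pathstart p = x0" "pathfinish p = x0" "w \<in> F"
    "path q" "pathstart q = x0" "pathfinish q = x0" "v \<in> F"
  shows "(path_class p, w) \<otimes>\<^bsub>\<Gamma>\<^esub> (path_class q, v) =
    (path_class (p +++ (wp w +++ (word_map w \<circ> q) +++ reversepath (wp w))), free_mult w v)"
  using assms word_path[OF letters_F[OF assms(4)]]
  by (simp add: warped_semidirect_def semidirect_def phi_path_class fundamental_group_mult
      mult_free_group pathstart_comp pathfinish_comp path_compose continuous_F)

text \<open>Appending \<open>wp w\<close> turns a loop at \<open>x0\<close> into a path from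
  \<open>x0\<close> to \<open>w x0\<close>. It cancels the conjugation by \<open>wp w\<close> inside
  \<open>phi\<close>, so that the twisted multiplication becomes the plain one of the
  groupoid.\<close>

definition \<Psi> :: "'a jelem \<Rightarrow> 'a jelem" where
  "\<Psi> g = (fst g \<odot> path_class (wp (snd g)), snd g)"

lemma \<Psi>_path:
  assumes "pathfinish p = x0" "w \<in> F"
  shows "\<Psi> (path_class p, w) = (path_class (p +++ wp w), w)"
  using assms by (simp add: \<Psi>_def path_class_join word_path letters_F)

lemma pjoin_wp_cancel:
  assumes "w \<in> F"
  shows "path_class (wp w) \<odot> path_class (reversepath (wp w)) = path_class (\<lambda>_. x0)"
    "path_class (reversepath (wp w)) \<odot> path_class (wp w) = path_class (\<lambda>_. word_map w x0)"
  using pjoin_reversepath[of "wp w"] pjoin_reversepath[of "reversepath (wp w)"] assms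
  by (simp_all add: word_path letters_F)

lemma \<Psi>_hom: "\<Psi> \<in> hom \<Gamma> (J0 x0)"
proof (rule homI)
  fix g assume "g \<in> carrier \<Gamma>"
  then obtain p w where g: "g = (path_class p, w)" "path p" "pathstart p = x0" "pathfinish p = x0" "w \<in> F"
    unfolding \<Gamma>_simps by blast
  then show "\<Psi> g \<in> carrier (J0 x0)"
    using word_path[OF letters_F[OF g(5)]] by (simp add: \<Psi>_path J_I)
  fix h assume "h \<in> carrier \<Gamma>"
  then obtain q v where h: "h = (path_class q, v)" "path q" "pathstart q = x0" "pathfinish q = x0" "v \<in> F"
    unfolding \<Gamma>_simps by blast
  note W = word_path[OF letters_F[OF g(5)]] word_path[OF letters_F[OF h(5)]]
  have "\<Psi> (g \<otimes>\<^bsub>\<Gamma>\<^esub> h) =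
      (path_class (p +++ (wp w +++ (word_map w \<circ> q) +++ reversepath (wp w))) \<odot>
       path_class (wp w +++ (word_map w \<circ> wp v)), free_mult w v)"
    using g h by (simp add: \<Gamma>_mult \<Psi>_def path_class_word_path_free_mult letters_F)
  also have "path_class (p +++ (wp w +++ (word_map w \<circ> q) +++ reversepath (wp w))) \<odot>
       path_class (wp w +++ (word_map w \<circ> wp v)) =
      path_class p \<odot> path_class (wp w) \<odot> path_class (word_map w \<circ> q) \<odot>
      (path_class (reversepath (wp w)) \<odot> path_class (wp w)) \<odot> path_class (word_map w \<circ> wp v)"
    using g h W by (simp add: path_class_join pathstart_comp pathfinish_comp pjoin_assoc)
  also have "\<dots> = path_class p \<odot> path_class (wp w) \<odot> path_class (word_map w \<circ> q) \<odot>
      path_class (word_map w \<circ> wp v)"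
    using g h W by (simp add: pjoin_wp_cancel const_pjoin pathstart_comp)
  also have "\<dots> = path_class ((p +++ wp w) +++ (word_map w \<circ> (q +++ wp v)))"
    using g h W by (simp add: path_class_join compose_join pathstart_comp pathfinish_comp pjoin_assoc)
  finally show "\<Psi> (g \<otimes>\<^bsub>\<Gamma>\<^esub> h) = \<Psi> g \<otimes>\<^bsub>J0 x0\<^esub> \<Psi> h"
    using g h W by (simp add: \<Psi>_path jmult_path)
qed

lemma \<Psi>_bij: "bij_betw \<Psi> (carrier \<Gamma>) (carrier (J0 x0))"
proof (rule bij_betwI[where g = "\<lambda>g. (fst g \<odot> path_class (reversepath (wp (snd g))), snd g)"])
  show "\<Psi> \<in> carrier \<Gamma> \<rightarrow> carrier (J0 x0)"
    using \<Psi>_hom by (auto simp: hom_def)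
  show "(\<lambda>g. (fst g \<odot> path_class (reversepath (wp (snd g))), snd g)) \<in> carrier (J0 x0) \<rightarrow> carrier \<Gamma>"
  proof
    fix g assume "g \<in> carrier (J0 x0)"
    then obtain p w where g: "g = (path_class p, w)" "path p" "pathstart p = x0" "w \<in> F"
      "pathfinish p = word_map w x0" by (auto elim: J_E)
    with word_path[OF letters_F[OF g(4)]]
    have "(path_class (p +++ reversepath (wp w)), w) \<in> carrier \<Gamma>" by (intro \<Gamma>_I) simp_all
    with g word_path[OF letters_F[OF g(4)]]
    show "(fst g \<odot> path_class (reversepath (wp (snd g))), snd g) \<in> carrier \<Gamma>"
      by (simp add: path_class_join)
  qed
  show "(\<lambda>g. (fst g \<odot> path_class (reversepath (wp (snd g))), snd g)) (\<Psi> g) = g" if "g \<in> carrier \<Gamma>" for g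
  proof -
    from that obtain p w where "g = (path_class p, w)" "w \<in> F" "pathfinish p = x0"
      unfolding \<Gamma>_simps by blast
    then show ?thesis by (simp add: \<Psi>_def pjoin_assoc pjoin_wp_cancel pjoin_const)
  qed
  show "\<Psi> ((\<lambda>g. (fst g \<odot> path_class (reversepath (wp (snd g))), snd g)) g) = g"
    if "g \<in> carrier (J0 x0)" for g
  proof -
    from that obtain p w where "g = (path_class p, w)" "w \<in> F" "pathfinish p = word_map w x0"
      by (auto elim: J_E)
    then show ?thesis by (simp add: \<Psi>_def pjoin_assoc pjoin_wp_cancel pjoin_const)
  qed
qed

lemma group_\<Gamma>: "group \<Gamma>"
proof (rule group_if_bij_hom[OF group_J0 \<Psi>_hom \<Psi>_bij])
  fix g h assume "g \<in> carrier \<Gamma>" "h \<in> carrier \<Gamma>"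
  then obtain p w q v where
    g: "g = (path_class p, w)" "path p" "pathstart p = x0" "pathfinish p = x0" "w \<in> F" and
    h: "h = (path_class q, v)" "path q" "pathstart q = x0" "pathfinish q = x0" "v \<in> F"
    unfolding \<Gamma>_simps by blast
  have "path (p +++ (wp w +++ (word_map w \<circ> q) +++ reversepath (wp w)))"
    using g h word_path[OF letters_F[OF g(5)]]
    by (simp add: pathstart_comp pathfinish_comp path_compose continuous_F)
  with g h show "g \<otimes>\<^bsub>\<Gamma>\<^esub> h \<in> carrier \<Gamma>"
    unfolding g(1) h(1) \<Gamma>_mult[OF g(2-5) h(2-5)]
    using word_path[OF letters_F[OF g(5)]]
    by (intro \<Gamma>_I) (simp_all add: free_mult_closed pathstart_comp pathfinish_comp)
next
  show "\<one>\<^bsub>\<Gamma>\<^esub> \<in> carrier \<Gamma>" unfolding \<Gamma>_simps using Nil_in_F by fastforce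
  show "\<Psi> \<one>\<^bsub>\<Gamma>\<^esub> = \<one>\<^bsub>J0 x0\<^esub>"
    by (simp add: \<Gamma>_simps \<Psi>_def jone_def const_pjoin)
qed

lemma \<Psi>_iso: "\<Psi> \<in> iso \<Gamma> (J0 x0)"
  using \<Psi>_hom \<Psi>_bij by (simp add: iso_def)

text \<open>What \<open>\<Psi>\<close> makes of the generators \<open>K_theta\<close>: the final
  reversed \<open>wp w\<close> cancels. The index bounds the word length itself, because loops of
  \<open>n\<close> small steps will produce words of length at most \<open>n\<close>;
  \<open>K_theta\<close> corresponds to 4 * \<theta>.\<close>

definition fixers :: "nat \<Rightarrow> 'a jelem set" where
  "fixers n = {(path_class (p +++ (word_map w \<circ> reversepath p)), w) |p w.
     w \<in> F \<and> length w \<le> n \<and> path p \<and> pathstart p = x0 \<and> word_map w (pathfinish p) = pathfinish p}"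

abbreviation "K \<theta> \<equiv> K_theta S x0 \<alpha> \<theta>"
abbreviation "N \<theta> \<equiv> normal_closure \<Gamma> (K \<theta>)"

lemma K_subset: "K \<theta> \<subseteq> carrier \<Gamma>"
proof
  fix g assume "g \<in> K \<theta>"
  then obtain w p where g: "g = (path_class (p +++ (word_map w \<circ> reversepath p) +++ reversepath (wp w)), w)"
    "w \<in> F" "path p" "pathstart p = x0" "pathfinish p \<in> Fix w"
    by (auto simp: K_theta_def)
  have "path (p +++ (word_map w \<circ> reversepath p) +++ reversepath (wp w))"
    using g word_path[OF letters_F[OF g(2)]]
    by (simp add: pathstart_comp pathfinish_comp path_compose continuous_F Fix_def)
  with g show "g \<in> carrier \<Gamma>"
    using word_path[OF letters_F[OF g(2)]] unfolding g(1) by (intro \<Gamma>_I) simp_all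
qed

lemma \<Psi>_image_K: "\<Psi> ` K \<theta> = fixers (4 * \<theta>)"
proof -
  have *: "\<Psi> (path_class (p +++ (word_map w \<circ> reversepath p) +++ reversepath (wp w)), w) =
      (path_class (p +++ (word_map w \<circ> reversepath p)), w)"
    if "w \<in> F" "path p" "pathstart p = x0" "pathfinish p \<in> Fix w" for p w
    using that word_path[OF letters_F[OF that(1)]]
    by (simp add: \<Psi>_def path_class_join pathstart_comp pathfinish_comp Fix_def pjoin_assoc
        pjoin_wp_cancel pjoin_const)
  show ?thesis
  proof (intro subset_antisym subsetI)
    fix g assume "g \<in> \<Psi> ` K \<theta>"
    then obtain p w where "g = (path_class (p +++ (word_map w \<circ> reversepath p)), w)"
      "w \<in> F" "length w \<le> 4 * \<theta>" "path p" "pathstart p = x0" "pathfinish p \<in> Fix w"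
      unfolding K_theta_def using * by blast
    then show "g \<in> fixers (4 * \<theta>)"
      unfolding fixers_def Fix_def by blast
  next
    fix g assume "g \<in> fixers (4 * \<theta>)"
    then obtain p w where g: "g = (path_class (p +++ (word_map w \<circ> reversepath p)), w)"
      "w \<in> F" "length w \<le> 4 * \<theta>" "path p" "pathstart p = x0" "pathfinish p \<in> Fix w"
      by (auto simp: fixers_def Fix_def)
    then have "g = \<Psi> (path_class (p +++ (word_map w \<circ> reversepath p) +++ reversepath (wp w)), w)"
      by (simp add: *)
    moreover have "(path_class (p +++ (word_map w \<circ> reversepath p) +++ reversepath (wp w)), w) \<in> K \<theta>"
      using g unfolding K_theta_def by blast
    ultimately show "g \<in> \<Psi> ` K \<theta>" by blast
  qed
qed

lemma N_normal: "N \<theta> \<lhd> \<Gamma>"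
  using group.normal_closure_normal[OF group_\<Gamma> K_subset] .

lemma \<Psi>_N_normal: "\<Psi> ` N \<theta> \<lhd> J0 x0"
  using iso_normal_subgroup[OF \<Psi>_iso group_\<Gamma> group_J0 N_normal] .

lemma fixers_subset: "fixers (4 * \<theta>) \<subseteq> \<Psi> ` N \<theta>"
  using image_mono[OF normal_closure_superset[of "K \<theta>" \<Gamma>], of \<Psi>] by (simp add: \<Psi>_image_K)

text \<open>Pulled back along \<open>\<Psi>\<close>, the kernel of \<open>f\<close> is a normal
  subgroup containing \<open>K \<theta>\<close>, hence contains the normal closure.\<close>

lemma kills_N:
  assumes "group_hom (J0 x0) U f" and kill: "\<And>g. g \<in> fixers (4 * \<theta>) \<Longrightarrow> f g = \<one>\<^bsub>U\<^esub>"
    and g: "g \<in> \<Psi> ` N \<theta>"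
  shows "f g = \<one>\<^bsub>U\<^esub>"
proof -
  interpret group_hom "J0 x0" U f by fact
  interpret f: group_hom \<Gamma> U "f \<circ> \<Psi>"
    using \<Psi>_hom homh group_\<Gamma>
    by (auto simp: group_hom_def group_hom_axioms_def H.group_axioms hom_def Pi_iff)
  have "K \<theta> \<subseteq> kernel \<Gamma> U (f \<circ> \<Psi>)"
  proof
    fix g assume g: "g \<in> K \<theta>"
    then have "\<Psi> g \<in> fixers (4 * \<theta>)" using \<Psi>_image_K by blast
    with g show "g \<in> kernel \<Gamma> U (f \<circ> \<Psi>)"
      using K_subset[of \<theta>] kill[of "\<Psi> g"] by (auto simp: kernel_def)
  qed
  then have "N \<theta> \<subseteq> kernel \<Gamma> U (f \<circ> \<Psi>)"
    by (intro normal_closure_minimal f.normal_kernel)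
  with g show ?thesis by (auto simp: kernel_def)
qed

end

section \<open>Small elements of the groupoid\<close>

lemma dist_le_path_length:
  assumes "a \<in> {0..1}" "b \<in> {0..1}"
  shows "ennreal (dist (p a) (p b)) \<le> path_length p"
proof -
  have *: "ennreal (dist (p a) (p b)) \<le> path_length p" if "a \<le> b" "a \<in> {0..1}" "b \<in> {0..1}" for a b
    unfolding path_length_def
    by (rule SUP_upper2[where i = "[a, b]"]) (use that in auto)
  show ?thesis
    using *[of a b] *[of b a] assms by (cases "a \<le> b") (auto simp: dist_commute)
qed

definition path_diam_le :: "real \<Rightarrow> (real \<Rightarrow> 'a::metric_space) \<Rightarrow> bool" where
  "path_diam_le \<eta> p \<longleftrightarrow> (\<forall>a\<in>{0..1}. \<forall>b\<in>{0..1}. dist (p a) (p b) \<le> \<eta>)"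

lemma path_diam_leD: "\<lbrakk>path_diam_le \<eta> p; a \<in> {0..1}; b \<in> {0..1}\<rbrakk> \<Longrightarrow> dist (p a) (p b) \<le> \<eta>"
  by (simp add: path_diam_le_def)

lemma path_diam_le_ends: "path_diam_le \<eta> p \<Longrightarrow> dist (pathstart p) (pathfinish p) \<le> \<eta>"
  by (simp add: path_diam_le_def pathstart_def pathfinish_def)

lemma path_diam_le_reversepath: "path_diam_le \<eta> p \<Longrightarrow> path_diam_le \<eta> (reversepath p)"
  by (auto simp: path_diam_le_def reversepath_def)

lemma path_diam_le_join:
  assumes "path_diam_le \<eta> p" "path_diam_le \<eta>' q" "pathfinish p = pathstart q"
  shows "path_diam_le (\<eta> + \<eta>') (p +++ q)"
proof -
  have pos: "0 \<le> \<eta>" "0 \<le> \<eta>'"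
    using path_diam_leD[OF assms(1), of 0 0] path_diam_leD[OF assms(2), of 0 0] by auto
  have cross: "dist (p a) (q b) \<le> \<eta> + \<eta>'" if "a \<in> {0..1}" "b \<in> {0..1}" for a b
  proof -
    have "dist (p a) (q b) \<le> dist (p a) (p 1) + dist (q 0) (q b)"
      using dist_triangle[of "p a" "q b" "p 1"] assms(3) by (simp add: pathfinish_def pathstart_def)
    also have "\<dots> \<le> \<eta> + \<eta>'"
      using that by (intro add_mono path_diam_leD[OF assms(1)] path_diam_leD[OF assms(2)]) auto
    finally show ?thesis .
  qed
  show ?thesis
    unfolding path_diam_le_def
  proof (intro ballI)
    fix a b :: real assume ab: "a \<in> {0..1}" "b \<in> {0..1}"
    have 1: "dist (p (2 * a)) (p (2 * b)) \<le> \<eta> + \<eta>'" if "a \<le> 1/2" "b \<le> 1/2"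
      using path_diam_leD[OF assms(1), of "2 * a" "2 * b"] pos ab that by simp
    have 2: "dist (q (2 * a - 1)) (q (2 * b - 1)) \<le> \<eta> + \<eta>'" if "\<not> a \<le> 1/2" "\<not> b \<le> 1/2"
      using path_diam_leD[OF assms(2), of "2 * a - 1" "2 * b - 1"] pos ab that by simp
    have 3: "dist (p (2 * a)) (q (2 * b - 1)) \<le> \<eta> + \<eta>'" if "a \<le> 1/2" "\<not> b \<le> 1/2"
      using cross[of "2 * a" "2 * b - 1"] ab that by simp
    have 4: "dist (q (2 * a - 1)) (p (2 * b)) \<le> \<eta> + \<eta>'" if "\<not> a \<le> 1/2" "b \<le> 1/2"
      using cross[of "2 * b" "2 * a - 1"] ab that by (simp add: dist_commute)
    show "dist ((p +++ q) a) ((p +++ q) b) \<le> \<eta> + \<eta>'"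
      using 1 2 3 4 unfolding joinpaths_def by presburger
  qed
qed

context homeo_system
begin

text \<open>Paths are measured by their diameter in \<open>dist\<close>, so every continuous path
  can be cut into such steps and no scale t is involved. Later \<eta> is \<open>C / t\<close>, which
  makes a path step one of warped diameter at most \<open>C\<close>. The rule \<open>weaken\<close>
  turns the count into an upper bound. A jump is the constant path at \<open>a z\<close> with the
  letter \<open>a\<close>, a morphism from \<open>a z\<close> to \<open>z\<close>.\<close>

inductive small :: "real \<Rightarrow> nat \<Rightarrow> 'a \<Rightarrow> 'a jelem \<Rightarrow> 'a \<Rightarrow> bool"
  for \<eta> :: real where
  unit: "small \<eta> 0 x (jone x) x"
| weaken: "small \<eta> n x g y \<Longrightarrow> small \<eta> (Suc n) x g y"
| path: "\<lbrakk>small \<eta> n x g (pathstart p); path p; path_diam_le \<eta> p\<rbrakk> \<Longrightarrow>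
    small \<eta> (Suc n) x (g \<star> (path_class p, [])) (pathfinish p)"
| jump: "\<lbrakk>small \<eta> n x g (letter_map a z); fst a \<in> S\<rbrakk> \<Longrightarrow>
    small \<eta> (Suc n) x (g \<star> (path_class (\<lambda>_. letter_map a z), [a])) z"

lemma path_in_J: "path p \<Longrightarrow> (path_class p, []) \<in> J (pathstart p) (pathfinish p)"
  by (rule J_I) auto

lemma singleton_in_F: "fst a \<in> S \<Longrightarrow> [a] \<in> F"
  by (simp add: carrier_free_group reduced_Cons_iff)

lemma jump_in_J: "fst a \<in> S \<Longrightarrow> (path_class (\<lambda>_. letter_map a z), [a]) \<in> J (letter_map a z) z"
  by (rule J_I) (auto simp: singleton_in_F word_map_Cons)

lemma small_in_J: "small \<eta> n x g y \<Longrightarrow> g \<in> J x y"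
  by (induction rule: small.induct) (auto intro: jmult_closed path_in_J jump_in_J)

lemma small_mono: "small \<eta> n x g y \<Longrightarrow> n \<le> m \<Longrightarrow> small \<eta> m x g y"
  by (induction m) (auto simp: le_Suc_eq intro: small.weaken)

lemma small_mult:
  assumes "small \<eta> n x g y" "small \<eta> m y h z"
  shows "small \<eta> (n + m) x (g \<star> h) z"
  using assms(2,1)
proof (induction arbitrary: rule: small.induct)
  case (unit x)
  then show ?case by (simp add: jone_right[OF small_in_J])
next
  case (weaken n x g y)
  then show ?case by (simp add: small.weaken)
next
  case (path m y h p)
  then show ?case
    using small.path[of \<eta> "n + m" x "g \<star> h" p]
    by (simp add: jmult_assoc[OF small_in_J small_in_J path_in_J])
next
  case (jump m y h a z)
  then show ?case
    using small.jump[of \<eta> "n + m" x "g \<star> h" a z]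
    by (simp add: jmult_assoc[OF small_in_J small_in_J jump_in_J])
qed

lemma small_path:
  "\<lbrakk>path p; path_diam_le \<eta> p\<rbrakk> \<Longrightarrow> small \<eta> 1 (pathstart p) (path_class p, []) (pathfinish p)"
  using small.path[OF small.unit[of \<eta> "pathstart p"]] by (simp add: jone_left[OF path_in_J])

lemma small_jump:
  "fst a \<in> S \<Longrightarrow> small \<eta> 1 (letter_map a z) (path_class (\<lambda>_. letter_map a z), [a]) z"
  using small.jump[OF small.unit[of \<eta> "letter_map a z"]] by (simp add: jone_left[OF jump_in_J])

lemma winv_Nil [simp]: "winv [] = []"
  using winv(2)[of "[]"] by simp

lemma jinv_unique:
  assumes "g \<in> J x y" "h \<in> J y x" "g \<star> h = jone x"
  shows "jinv g = h"
proof -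
  have "jinv g = jinv g \<star> g \<star> h"
    unfolding assms(3) by (rule jone_right[OF jinv_closed[OF assms(1)], symmetric])
  also have "\<dots> = h"
    unfolding jmult_assoc[OF jinv_closed[OF assms(1)] assms(1,2), symmetric]
    using assms by (simp add: jinv_left jone_left)
  finally show ?thesis .
qed

lemma jinv_jone: "jinv (jone x) = jone x"
  by (rule jinv_unique[OF jone_closed jone_closed jone_left[OF jone_closed]])

lemma jinv_jmult:
  assumes "g \<in> J x y" "h \<in> J y z"
  shows "jinv (g \<star> h) = jinv h \<star> jinv g"
proof (rule jinv_unique)
  note i = jinv_closed[OF assms(1)] jinv_closed[OF assms(2)]
  show "g \<star> h \<in> J x z" "jinv h \<star> jinv g \<in> J z x" using assms i by (auto intro: jmult_closed)
  have "(g \<star> h) \<star> jinv h \<star> jinv g = g \<star> (h \<star> jinv h) \<star> jinv g"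
    using jmult_assoc[OF assms jmult_closed[OF i(2,1)]] jmult_assoc[OF assms(2) i(2,1)] by simp
  then show "(g \<star> h) \<star> jinv h \<star> jinv g = jone x"
    using assms i by (simp add: jinv_right jone_left)
qed

lemma small_jinv: "small \<eta> n x g y \<Longrightarrow> small \<eta> n y (jinv g) x"
proof (induction rule: small.induct)
  case (unit x)
  show ?case by (simp add: jinv_jone small.unit)
next
  case (weaken n x g y)
  then show ?case by (simp add: small.weaken)
next
  case (path n x g p)
  have "jinv (path_class p, []) = (path_class (reversepath p), [])"
    using path by (simp add: jinv_path comp_def)
  then have "small \<eta> 1 (pathfinish p) (jinv (path_class p, [])) (pathstart p)"
    using small_path[of "reversepath p" \<eta>] path path_diam_le_reversepath[OF path.hyps(3)] by simp
  from small_mult[OF this path.IH] show ?case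
    using path by (simp add: jinv_jmult[OF small_in_J path_in_J])
next
  case (jump n x g a z)
  have "jinv (path_class (\<lambda>_. letter_map a z), [a]) = (path_class (\<lambda>_. z), [inv_letter a])"
  proof (rule jinv_unique[OF jump_in_J])
    have "z = letter_map (inv_letter a) (letter_map a z)" using jump by (simp add: letter_map_inverse)
    then show "(path_class (\<lambda>_. z), [inv_letter a]) \<in> J z (letter_map a z)"
      using jump_in_J[of "inv_letter a" "letter_map a z"] jump by simp
    show "(path_class (\<lambda>_. letter_map a z), [a]) \<star> (path_class (\<lambda>_. z), [inv_letter a]) = jone (letter_map a z)"
      using jump by (simp add: jmult_path singleton_in_F word_map_Cons comp_def path_class_join
          pjoin_const jone_def reduced_Cons_def)
  qed (use jump in auto)
  then have "small \<eta> 1 z (jinv (path_class (\<lambda>_. letter_map a z), [a])) (letter_map a z)"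
    using small_jump[of "inv_letter a" \<eta> "letter_map a z"] jump by (simp add: letter_map_inverse)
  from small_mult[OF this jump.IH] show ?case
    using jump by (simp add: jinv_jmult[OF small_in_J jump_in_J])
qed

lemma J_path_small:
  assumes p: "path p" and \<eta>: "\<eta> > 0"
  shows "\<exists>n. small \<eta> n (pathstart p) (path_class p, []) (pathfinish p)"
proof -
  have "uniformly_continuous_on {0..1} p"
    using p by (intro compact_uniformly_continuous) (auto simp: path_def)
  then obtain \<epsilon> where \<epsilon>: "\<epsilon> > 0" "\<And>a b. \<lbrakk>a \<in> {0..1}; b \<in> {0..1}; dist a b < \<epsilon>\<rbrakk> \<Longrightarrow> dist (p a) (p b) < \<eta>"
    unfolding uniformly_continuous_on_def using \<eta> by metis
  obtain N where N: "N > 0" "1 / real N < \<epsilon>"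
    using \<epsilon>(1) by (metis nat_approx_posE zero_less_Suc of_nat_Suc)
  \<comment> \<open>\<open>r a b\<close> is \<open>p\<close> restricted to the interval from
    \<open>a\<close> to \<open>b\<close> and rescaled; for a = b = 0 it is constant, which starts
    the induction below.\<close>
  define r where "r a b x = p (a + (b - a) * x)" for a b x
  have in01: "a + (b - a) * x \<in> {0..1}" if "0 \<le> a" "a \<le> b" "b \<le> 1" "x \<in> {0..1}" for a b x :: real
  proof -
    have "(b - a) * x \<le> (b - a) * 1" "0 \<le> (b - a) * x"
      using that by (simp_all add: mult_left_le)
    then show ?thesis using that by auto
  qed
  have path_r: "path (r a b)" if "0 \<le> a" "a \<le> b" "b \<le> 1" for a b
    unfolding path_def r_def
    by (rule continuous_on_compose2[OF p[unfolded path_def]])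
      (use in01[OF that] in \<open>auto intro!: continuous_intros\<close>)
  have ends_r [simp]: "pathstart (r a b) = p a" "pathfinish (r a b) = p b" for a b
    by (auto simp: r_def pathstart_def pathfinish_def)
  have join_r: "path_class (r 0 a +++ r a b) = path_class (r 0 b)" if "0 \<le> a" "a \<le> b" "0 < b" "b \<le> 1" for a b
  proof -
    \<comment> \<open>\<open>f\<close> carries the parameter of the joined path to that of
      \<open>r 0 b\<close>. Dividing by \<open>b\<close> is what requires 0 < b, while
      \<open>a\<close> may be 0.\<close>
    define f where "f t = (if t \<le> 1/2 then a * (2 * t) else a + (b - a) * (2 * t - 1)) / b" for t :: real
    have "f t \<in> {0..1}" if t: "t \<in> {0..1}" for t
    proof (cases "t \<le> 1/2")
      case True
      have "a * (2 * t) \<le> b * 1" using True t \<open>0 \<le> a\<close> \<open>a \<le> b\<close> by (intro mult_mono) auto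
      then show ?thesis using True t \<open>0 \<le> a\<close> \<open>0 < b\<close> by (auto simp: f_def)
    next
      case False
      have "(b - a) * (2 * t - 1) \<le> (b - a) * 1" "0 \<le> (b - a) * (2 * t - 1)"
        using False t \<open>a \<le> b\<close> by (intro mult_left_mono mult_nonneg_nonneg; simp)+
      then have "a + (b - a) * (2 * t - 1) \<le> b" "0 \<le> a + (b - a) * (2 * t - 1)"
        using \<open>0 \<le> a\<close> by auto
      then show ?thesis using False \<open>0 < b\<close> by (auto simp: f_def)
    qed
    moreover have "continuous_on {0..1} f"
      unfolding f_def split_01
      by (intro continuous_intros continuous_on_cases) (use that in \<open>auto simp: mult.commute[of 2]\<close>)
    moreover have "(r 0 a +++ r a b) t = r 0 b (f t)" for t
      using that by (auto simp: joinpaths_def r_def f_def)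
    ultimately have "homotopic_paths UNIV (r 0 b) (r 0 a +++ r a b)"
      using path_r[of 0 b] that
      by (intro homotopic_paths_reparametrize[where f = f]) (auto simp: f_def)
    then show ?thesis by (simp add: path_class_eqI)
  qed
  have "small \<eta> i (p 0) (path_class (r 0 (real i / N)), []) (p (real i / N))" if "i \<le> N" for i
    using that
  proof (induction i)
    case 0
    have "r 0 0 = (\<lambda>_. p 0)" by (simp add: r_def fun_eq_iff)
    then show ?case using small.unit[of \<eta> "p 0"] by (simp add: jone_def)
  next
    case (Suc i)
    let ?a = "real i / N" and ?b = "real (Suc i) / N"
    have ab: "0 \<le> ?a" "?a \<le> ?b" "0 < ?b" "?b \<le> 1" "?b - ?a = 1 / N"
      using Suc N by (auto simp: divide_simps)
    note q = path_r[OF ab(1,2,4)]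
    have "path_diam_le \<eta> (r ?a ?b)"
      unfolding path_diam_le_def
    proof (intro ballI)
      fix u v :: real assume uv: "u \<in> {0..1}" "v \<in> {0..1}"
      then have "\<bar>u - v\<bar> / N \<le> 1 / N" using N by (intro divide_right_mono) auto
      then have "dist (?a + (?b - ?a) * u) (?a + (?b - ?a) * v) \<le> 1 / N"
        using N unfolding ab(5) dist_real_def by (simp flip: diff_divide_distrib)
      then show "dist (r ?a ?b u) (r ?a ?b v) \<le> \<eta>"
        unfolding r_def using \<epsilon>(2)[OF in01[OF ab(1,2,4) uv(1)] in01[OF ab(1,2,4) uv(2)]] N(2) by simp
    qed
    moreover have "small \<eta> i (p 0) (path_class (r 0 ?a), []) (pathstart (r ?a ?b))"
      using Suc by simp
    ultimately have "small \<eta> (Suc i) (p 0) ((path_class (r 0 ?a), []) \<star> (path_class (r ?a ?b), [])) (p ?b)"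
      using small.path[of \<eta> i "p 0" _ "r ?a ?b"] q by simp
    moreover have "(path_class (r 0 ?a), []) \<star> (path_class (r ?a ?b), []) = (path_class (r 0 ?b), [])"
      using join_r[OF ab(1-4)] q path_r[of 0 ?a] ab by (simp add: jmult_path)
    ultimately show ?case by simp
  qed
  from this[of N] N have "small \<eta> N (pathstart p) (path_class (r 0 1), []) (pathfinish p)"
    by (simp add: pathstart_def pathfinish_def)
  moreover have "r 0 1 = p" by (simp add: r_def fun_eq_iff)
  ultimately show ?thesis by auto
qed

text \<open>A morphism is a path from \<open>x\<close> to \<open>w y\<close> followed by the letters
  of \<open>w\<close>, one jump each. As \<open>w\<close> is reduced, multiplying the letters
  restores \<open>w\<close> without cancellation.\<close>

lemma J_small:
  assumes g: "g \<in> J x y" and \<eta>: "\<eta> > 0"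
  shows "\<exists>n. small \<eta> n x g y"
proof -
  obtain p w where p: "g = (path_class p, w)" "path p" "pathstart p = x" "w \<in> F" "pathfinish p = word_map w y"
    using g by (rule J_E)
  obtain n where n: "small \<eta> n x (path_class p, []) (word_map w y)"
    using J_path_small[OF p(2) \<eta>] p by auto
  have "small \<eta> (length w) (word_map w y) (path_class (\<lambda>_. word_map w y), w) y"
    using p(4)
  proof (induction w)
    case Nil
    then show ?case using small.unit[of \<eta> y] by (simp add: jone_def)
  next
    case (Cons a w)
    have w: "w \<in> F" "fst a \<in> S" "reduced (a # w)"
      using Cons.prems by (auto simp: carrier_free_group reduced_Cons_iff)
    have "(path_class (\<lambda>_. letter_map a (word_map w y)), [a]) \<star> (path_class (\<lambda>_. word_map w y), w) =
        (path_class (\<lambda>_. word_map (a # w) y), a # w)"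
      using w by (simp add: jmult_path singleton_in_F word_map_Cons path_class_join comp_def pjoin_const
          reduced_Cons_reduced)
    with small_mult[OF small_jump[OF w(2), of \<eta> "word_map w y"] Cons.IH[OF w(1)]]
    show ?case by (simp add: word_map_Cons)
  qed
  from small_mult[OF n this]
  have "small \<eta> (n + length w) x ((path_class p, []) \<star> (path_class (\<lambda>_. word_map w y), w)) y" .
  moreover have "(path_class p, []) \<star> (path_class (\<lambda>_. word_map w y), w) = g"
    using p by (simp add: jmult_path path_class_join pjoin_const)
  ultimately show ?thesis by auto
qed

end

section \<open>Small loops and fixed points\<close>

lemma finite_uniform:
  assumes "finite W" "\<And>w. w \<in> W \<Longrightarrow> \<exists>\<eta>>0. P w (\<eta>::real)"
    and mono: "\<And>w \<eta> \<eta>'. \<lbrakk>P w \<eta>; 0 < \<eta>'; \<eta>' \<le> \<eta>\<rbrakk> \<Longrightarrow> P w \<eta>'"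
  shows "\<exists>\<eta>>0. \<forall>w\<in>W. P w \<eta>"
  using assms(1,2)
proof (induction W rule: finite_induct)
  case empty
  then show ?case by (auto intro: exI[of _ 1])
next
  case (insert w W)
  then obtain \<eta> \<eta>' where "\<eta> > 0" "\<forall>w\<in>W. P w \<eta>" "\<eta>' > 0" "P w \<eta>'" by blast
  then show ?case using mono[of _ \<eta> "min \<eta> \<eta>'"] mono[of w \<eta>' "min \<eta> \<eta>'"]
    by (intro exI[of _ "min \<eta> \<eta>'"]) auto
qed

text \<open>The points at distance at least \<epsilon> from every fixed point form a compact set on
  which the displacement has a positive minimum; half of it serves as \<delta>. If \<open>g\<close>
  has no fixed point, this set is the whole space and the premise on \<open>x\<close> is never
  met.\<close>

lemma almost_fixed_near_fixed:
  fixes g :: "'a::metric_space \<Rightarrow> 'a"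
  assumes cpt: "compact (UNIV :: 'a set)" and g: "continuous_on UNIV g" and "\<epsilon> > 0"
  shows "\<exists>\<delta>>0. \<forall>x. dist x (g x) \<le> \<delta> \<longrightarrow> (\<exists>y. g y = y \<and> dist x y < \<epsilon>)"
proof -
  define C where "C = (\<Inter>y\<in>{y. g y = y}. {x. \<epsilon> \<le> dist x y})"
  have "closed C"
    unfolding C_def by (intro closed_INT ballI closed_Collect_le continuous_intros)
  then have C: "compact C" using compact_Int_closed[OF cpt] by auto
  have out: "\<exists>y. g y = y \<and> dist x y < \<epsilon>" if "x \<notin> C" for x
    using that by (auto simp: C_def not_le)
  show ?thesis
  proof (cases "C = {}")
    case True
    then show ?thesis using out by (intro exI[of _ 1]) auto
  next
    case False
    have "continuous_on C (\<lambda>x. dist x (g x))"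
      by (intro continuous_intros continuous_on_subset[OF g]) auto
    then obtain c where c: "c \<in> C" "\<forall>x\<in>C. dist c (g c) \<le> dist x (g x)"
      using continuous_attains_inf[OF C False] by blast
    have "g c \<noteq> c" using c(1) \<open>\<epsilon> > 0\<close> by (force simp: C_def)
    then have pos: "dist c (g c) > 0" by auto
    show ?thesis
    proof (intro exI[of _ "dist c (g c) / 2"] conjI allI impI)
      show "dist c (g c) / 2 > 0" using pos by simp
      fix x assume "dist x (g x) \<le> dist c (g c) / 2"
      then have "x \<notin> C" using c(2) pos by fastforce
      then show "\<exists>y. g y = y \<and> dist x y < \<epsilon>" by (rule out)
    qed
  qed
qed

lemma geodesic_path:
  fixes x y :: "'a::metric_space"
  assumes "geodesic_metric (euclidean_metric :: 'a metric)"
  obtains b where "path b" "pathstart b = x" "pathfinish b = y" "path_diam_le (dist x y) b"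
proof -
  obtain \<gamma> where \<gamma>: "\<gamma> 0 = x" "\<gamma> (dist x y) = y"
    "\<And>a b. \<lbrakk>a \<in> {0..dist x y}; b \<in> {0..dist x y}\<rbrakk> \<Longrightarrow> dist (\<gamma> a) (\<gamma> b) = \<bar>a - b\<bar>"
    using assms unfolding geodesic_metric_def by (auto simp: Ball_def) metis
  define b where "b t = \<gamma> (dist x y * t)" for t
  have mem: "dist x y * t \<in> {0..dist x y}" if "t \<in> {0..1}" for t
    using that by (auto simp: mult_left_le)
  have b: "dist (b s) (b t) = dist x y * \<bar>s - t\<bar>" if "s \<in> {0..1}" "t \<in> {0..1}" for s t
    using \<gamma>(3)[OF mem[OF that(1)] mem[OF that(2)]]
    by (simp add: b_def abs_mult flip: right_diff_distrib)
  show ?thesis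
  proof
    have "(dist x y)-lipschitz_on {0..1} b"
      using b by (intro lipschitz_onI) (auto simp: dist_real_def)
    then show "path b" unfolding path_def by (rule lipschitz_on_continuous_on)
    show "path_diam_le (dist x y) b"
      unfolding path_diam_le_def by (auto simp: b mult_left_le)
  qed (auto simp: b_def pathstart_def pathfinish_def \<gamma>)
qed

lemma path_image_dist_le:
  "\<lbrakk>path_diam_le \<eta> p; z \<in> path_image p\<rbrakk> \<Longrightarrow> dist (pathstart p) z \<le> \<eta>"
  by (auto simp: path_image_def pathstart_def path_diam_le_def)

text \<open>A Lebesgue number argument. Semi-local simple connectivity speaks only of loops based at
  the centre of the neighbourhood, so a loop elsewhere is first joined to the centre by a geodesic,
  which stays in the same ball, and conjugated back afterwards.\<close>

lemma small_loops_null: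
  assumes cpt: "compact (UNIV :: 'a::metric_space set)"
    and geo: "geodesic_metric (euclidean_metric :: 'a metric)"
    and slsc: "semilocally_simply_connected (UNIV :: 'a set)"
  shows "\<exists>\<epsilon>>0. \<forall>p :: real \<Rightarrow> 'a. path p \<and> pathfinish p = pathstart p \<and> path_diam_le \<epsilon> p \<longrightarrow>
    path_class p = path_class (\<lambda>_. pathstart p)"
proof -
  have "\<exists>r>0. \<forall>\<gamma>. path \<gamma> \<and> path_image \<gamma> \<subseteq> ball x r \<and> pathstart \<gamma> = x \<and> pathfinish \<gamma> = x \<longrightarrow>
      homotopic_paths UNIV \<gamma> (\<lambda>_. x)" for x :: 'a
  proof -
    obtain U where U: "open U" "x \<in> U" "\<forall>\<gamma>. path \<gamma> \<and> path_image \<gamma> \<subseteq> U \<and> pathstart \<gamma> = x \<and>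
        pathfinish \<gamma> = x \<longrightarrow> homotopic_paths UNIV \<gamma> (\<lambda>_. x)"
      using slsc[unfolded semilocally_simply_connected_def, rule_format, of x] by auto
    from U(1,2) obtain r where "r > 0" "ball x r \<subseteq> U" by (meson open_contains_ball)
    with U(3) show ?thesis by (intro exI[of _ r]) auto
  qed
  then obtain r where r: "\<And>x :: 'a. r x > 0" "\<And>x \<gamma>. \<lbrakk>path \<gamma>; path_image \<gamma> \<subseteq> ball x (r x); pathstart \<gamma> = x;
      pathfinish \<gamma> = x\<rbrakk> \<Longrightarrow> homotopic_paths UNIV \<gamma> (\<lambda>_. x)"
    by metis
  have "y \<in> ball y (r y / 2)" for y using r(1)[of y] by simp
  then have "UNIV \<subseteq> (\<Union>x. ball x (r x / 2))" by blast
  then obtain e where e: "e > 0" "\<And>y. \<exists>G\<in>range (\<lambda>x. ball x (r x / 2)). ball y e \<subseteq> G"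
    by (rule Heine_Borel_lemma[OF cpt, of "range (\<lambda>x. ball x (r x / 2))"]) auto
  show ?thesis
  proof (intro exI[of _ "e / 2"] conjI allI impI)
    show "e / 2 > 0" using e by simp
    fix p :: "real \<Rightarrow> 'a" assume p: "path p \<and> pathfinish p = pathstart p \<and> path_diam_le (e / 2) p"
    obtain x where x: "ball (pathstart p) e \<subseteq> ball x (r x / 2)" using e(2)[of "pathstart p"] by blast
    have start: "dist x (pathstart p) < r x / 2" using x e(1) by (metis centre_in_ball mem_ball subsetD)
    obtain b where b: "path b" "pathstart b = x" "pathfinish b = pathstart p"
      "path_diam_le (dist x (pathstart p)) b"
      using geodesic_path[OF geo] .
    have "path_image p \<subseteq> ball (pathstart p) e"
      using path_image_dist_le[of "e / 2" p] p e(1) by force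
    moreover have "path_image b \<subseteq> ball x (r x)"
      using path_image_dist_le[OF b(4)] b(2) start r(1)[of x] by force
    moreover have "ball x (r x / 2) \<subseteq> ball x (r x)" using r(1)[of x] by auto
    ultimately have "path_image (b +++ p +++ reversepath b) \<subseteq> ball x (r x)"
      using x b p by (auto simp: path_image_join)
    then have "homotopic_paths UNIV (b +++ p +++ reversepath b) (\<lambda>_. x)"
      using b p by (intro r(2)) auto
    from path_class_eqI[OF this]
    have *: "path_class b \<odot> path_class p \<odot> path_class (reversepath b) = path_class (\<lambda>_. x)"
      using b p by (simp add: path_class_join)
    have inv: "path_class (reversepath b) \<odot> path_class b = path_class (\<lambda>_. pathstart p)"
      using pjoin_reversepath[of "reversepath b"] b by simp
    have "path_class p = (path_class (reversepath b) \<odot> path_class b) \<odot> path_class p \<odot>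
        (path_class (reversepath b) \<odot> path_class b)"
      unfolding inv using p by (simp add: const_pjoin pjoin_const)
    also have "\<dots> = path_class (reversepath b) \<odot> (path_class b \<odot> path_class p \<odot> path_class (reversepath b))
        \<odot> path_class b"
      by (simp only: pjoin_assoc)
    also have "\<dots> = path_class (\<lambda>_. pathstart p)"
      unfolding * using b by (simp add: const_pjoin inv)
    finally show "path_class p = path_class (\<lambda>_. pathstart p)" .
  qed
qed

context homeo_system
begin

lemma small_antimono_scale: "small \<eta> n x g y \<Longrightarrow> \<eta> \<le> \<eta>' \<Longrightarrow> small \<eta>' n x g y"
proof (induction rule: small.induct)
  case (path n x g p)
  then have "path_diam_le \<eta>' p" by (force simp: path_diam_le_def)
  with path show ?case by (intro small.path) auto
qed (auto intro: small.intros)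

lemma finite_words: "finite S \<Longrightarrow> finite {w \<in> F. length w \<le> n}"
proof -
  assume "finite S"
  then have "finite {w. set w \<subseteq> S \<times> (UNIV :: bool set) \<and> length w \<le> n}"
    by (intro finite_lists_length_le) auto
  then show ?thesis by (rule finite_subset[rotated]) (auto simp: carrier_free_group)
qed

lemma words_equicontinuous:
  assumes "compact (UNIV :: 'a set)" "finite S" "\<epsilon> > 0"
  shows "\<exists>\<eta>>0. \<forall>w\<in>F. length w \<le> n \<longrightarrow>
    (\<forall>x y. dist x y \<le> \<eta> \<longrightarrow> dist (word_map w x) (word_map w y) \<le> \<epsilon>)"
proof -
  have "\<exists>\<eta>>0. \<forall>w\<in>{w \<in> F. length w \<le> n}.
      \<forall>x y. dist x y \<le> \<eta> \<longrightarrow> dist (word_map w x) (word_map w y) \<le> \<epsilon>"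
  proof (rule finite_uniform[OF finite_words[OF assms(2)]])
    fix w assume "w \<in> {w \<in> F. length w \<le> n}"
    then have "uniformly_continuous_on UNIV (word_map w)"
      using assms(1) by (intro compact_uniformly_continuous) (auto simp: continuous_F)
    then obtain d where d: "d > 0" "\<And>x y. dist x y < d \<Longrightarrow> dist (word_map w x) (word_map w y) < \<epsilon>"
      unfolding uniformly_continuous_on_def using assms(3) by (metis UNIV_I)
    then show "\<exists>\<eta>>0. \<forall>x y. dist x y \<le> \<eta> \<longrightarrow> dist (word_map w x) (word_map w y) \<le> \<epsilon>"
      by (intro exI[of _ "d / 2"]) (force intro: less_imp_le)
  qed auto
  then show ?thesis by blast
qed

text \<open>In a product the later paths occur translated by the word collected so far. The finitely
  many words of length at most \<open>n\<close> are equicontinuous, so the translates stay small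
  once \<eta> is chosen in terms of \<open>n\<close>.\<close>

lemma small_representative:
  assumes cpt: "compact (UNIV :: 'a set)" and fin: "finite S" and "\<epsilon> > 0"
  shows "\<exists>\<eta>>0. \<forall>x g y. small \<eta> n x g y \<longrightarrow> (\<exists>p w. g = (path_class p, w) \<and> path p \<and>
    pathstart p = x \<and> w \<in> F \<and> length w \<le> n \<and> pathfinish p = word_map w y \<and> path_diam_le \<epsilon> p)"
  using \<open>\<epsilon> > 0\<close>
proof (induction n arbitrary: \<epsilon>)
  case 0
  have "\<exists>p w. g = (path_class p, w) \<and> path p \<and> pathstart p = x \<and> w \<in> F \<and> length w \<le> 0 \<and>
      pathfinish p = word_map w y \<and> path_diam_le \<epsilon> p" if "small 1 0 x g y" for x g y
    using that 0
    by cases (auto simp: jone_def path_diam_le_def intro!: exI[of _ "\<lambda>_. y"])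
  then show ?case by (intro exI[of _ 1]) auto
next
  case (Suc n)
  obtain \<eta>1 where \<eta>1: "\<eta>1 > 0" "\<And>x g y. small \<eta>1 n x g y \<Longrightarrow> \<exists>p w. g = (path_class p, w) \<and> path p \<and>
    pathstart p = x \<and> w \<in> F \<and> length w \<le> n \<and> pathfinish p = word_map w y \<and> path_diam_le (\<epsilon> / 2) p"
    using Suc.IH[of "\<epsilon> / 2"] Suc.prems by auto
  obtain \<eta>2 where \<eta>2: "\<eta>2 > 0" "\<And>w x y. \<lbrakk>w \<in> F; length w \<le> n; dist x y \<le> \<eta>2\<rbrakk> \<Longrightarrow>
      dist (word_map w x) (word_map w y) \<le> \<epsilon> / 2"
    using words_equicontinuous[OF cpt fin, of "\<epsilon> / 2" n] Suc.prems by auto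
  let ?\<eta> = "min \<eta>1 \<eta>2"
  have "\<exists>p w. g = (path_class p, w) \<and> path p \<and> pathstart p = x \<and> w \<in> F \<and> length w \<le> Suc n \<and>
      pathfinish p = word_map w y \<and> path_diam_le \<epsilon> p" if "small ?\<eta> (Suc n) x g y" for x g y
    using that
  proof cases
    case weaken
    from \<eta>1(2)[OF small_antimono_scale[OF this min.cobounded1]] obtain p w where
      p: "g = (path_class p, w)" "path p" "pathstart p = x" "w \<in> F" "length w \<le> n"
      "pathfinish p = word_map w y" "path_diam_le (\<epsilon> / 2) p" by blast
    have "path_diam_le \<epsilon> p" using p(7) Suc.prems by (force simp: path_diam_le_def)
    with p show ?thesis by auto
  next
    case (path h q)
    from \<eta>1(2)[OF small_antimono_scale[OF path(3) min.cobounded1]] obtain p w where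
      p: "h = (path_class p, w)" "path p" "pathstart p = x" "w \<in> F" "length w \<le> n"
      "pathfinish p = word_map w (pathstart q)" "path_diam_le (\<epsilon> / 2) p" by blast
    have "path_diam_le (\<epsilon> / 2) (word_map w \<circ> q)"
      using \<eta>2(2)[OF p(4,5)] path(5) by (auto simp: path_diam_le_def)
    then have "path_diam_le (\<epsilon> / 2 + \<epsilon> / 2) (p +++ (word_map w \<circ> q))"
      using p by (intro path_diam_le_join) (auto simp: pathstart_comp)
    moreover have "g = (path_class (p +++ (word_map w \<circ> q)), w)"
      using path p by (simp add: jmult_path free_mult_Nil_right reduced_F)
    ultimately show ?thesis
      using path p by (intro exI[of _ "p +++ (word_map w \<circ> q)"] exI[of _ w])
        (simp add: pathstart_comp pathfinish_comp path_compose continuous_F)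
  next
    case (jump h a)
    from \<eta>1(2)[OF small_antimono_scale[OF jump(2) min.cobounded1]] obtain p w where
      p: "h = (path_class p, w)" "path p" "pathstart p = x" "w \<in> F" "length w \<le> n"
      "pathfinish p = word_map w (letter_map a y)" "path_diam_le (\<epsilon> / 2) p" by blast
    have "path_diam_le \<epsilon> p" using p(7) Suc.prems by (force simp: path_diam_le_def)
    moreover have "g = (path_class p, free_mult w [a])"
      using jump p by (simp add: jmult_path comp_def path_class_join pjoin_const)
    moreover have "free_mult w [a] \<in> F" "length (free_mult w [a]) \<le> Suc n"
      "word_map (free_mult w [a]) y = word_map w (letter_map a y)"
      using p jump free_mult_closed[OF p(4) singleton_in_F[OF jump(3)]] length_free_mult[of w "[a]"]
      by (auto simp: word_map_F singleton_in_F word_map_Cons)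
    ultimately show ?thesis using p by (intro exI[of _ p] exI[of _ "free_mult w [a]"]) simp
  qed
  then show ?case using \<eta>1(1) \<eta>2(1) by (intro exI[of _ ?\<eta>]) auto
qed

end

context warped_paths
begin

text \<open>A short closed jumping path is a short path from \<open>x\<close> to \<open>w x\<close>; by compactness \<open>x\<close> is then close to a
  fixed point \<open>y\<close> of \<open>w\<close>, and the path is homotopic to the one running through \<open>y\<close>.\<close>

lemma small_loop_fixer:
  assumes cpt: "compact (UNIV :: 'a set)" and fin: "finite S"
    and geo: "geodesic_metric (euclidean_metric :: 'a metric)"
    and slsc: "semilocally_simply_connected (UNIV :: 'a set)"
  shows "\<exists>\<eta>>0. \<forall>x g. small \<eta> n x g x \<longrightarrow> (\<forall>q. path q \<and> pathstart q = x0 \<and> pathfinish q = x \<longrightarrow>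
    (path_class q, []) \<star> g \<star> jinv (path_class q, []) \<in> fixers n)"
proof -
  obtain \<epsilon>0 where \<epsilon>0: "\<epsilon>0 > 0" "\<And>p :: real \<Rightarrow> 'a. \<lbrakk>path p; pathfinish p = pathstart p; path_diam_le \<epsilon>0 p\<rbrakk> \<Longrightarrow>
      path_class p = path_class (\<lambda>_. pathstart p)"
    using small_loops_null[OF cpt geo slsc] by blast
  obtain \<epsilon>1 where \<epsilon>1: "\<epsilon>1 > 0" "\<And>w x y. \<lbrakk>w \<in> F; length w \<le> n; dist x y \<le> \<epsilon>1\<rbrakk> \<Longrightarrow>
      dist (word_map w x) (word_map w y) \<le> \<epsilon>0 / 3"
    using words_equicontinuous[OF cpt fin, of "\<epsilon>0 / 3" n] \<epsilon>0(1) by auto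
  \<comment> \<open>The loop shown to be null homotopic consists of three paths: \<open>p\<close>,
    the translate of a geodesic \<open>b\<close> to the fixed point, and \<open>b\<close> reversed.
    Each may have diameter \<epsilon>0 / 3; \<epsilon>1 takes care of the translate.\<close>
  let ?e = "min \<epsilon>1 (\<epsilon>0 / 3)"
  have "?e > 0" using \<epsilon>0 \<epsilon>1 by simp
  have "\<exists>\<delta>>0. \<forall>w\<in>{w \<in> F. length w \<le> n}. \<forall>x. dist x (word_map w x) \<le> \<delta> \<longrightarrow> (\<exists>y. word_map w y = y \<and> dist x y < ?e)"
    by (rule finite_uniform[OF finite_words[OF fin]])
      (use almost_fixed_near_fixed[OF cpt _ \<open>?e > 0\<close>] continuous_F in \<open>auto intro: order_trans\<close>)
  then obtain \<delta> where \<delta>: "\<delta> > 0" "\<And>w x. \<lbrakk>w \<in> F; length w \<le> n; dist x (word_map w x) \<le> \<delta>\<rbrakk> \<Longrightarrow>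
      \<exists>y. word_map w y = y \<and> dist x y < ?e"
    by blast
  obtain \<eta> where \<eta>: "\<eta> > 0" "\<And>x g y. small \<eta> n x g y \<Longrightarrow> \<exists>p w. g = (path_class p, w) \<and> path p \<and>
    pathstart p = x \<and> w \<in> F \<and> length w \<le> n \<and> pathfinish p = word_map w y \<and> path_diam_le (min \<delta> (\<epsilon>0 / 3)) p"
    using small_representative[OF cpt fin, of "min \<delta> (\<epsilon>0 / 3)" n] \<delta>(1) \<epsilon>0(1) by auto
  show ?thesis
  proof (intro exI[of _ \<eta>] conjI allI impI \<eta>(1))
    fix x g q assume "small \<eta> n x g x" and q: "path q \<and> pathstart q = x0 \<and> pathfinish q = x"
    from \<eta>(2)[OF this(1)] obtain p w where p: "g = (path_class p, w)" "path p" "pathstart p = x" "w \<in> F"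
      "length w \<le> n" "pathfinish p = word_map w x" "path_diam_le (min \<delta> (\<epsilon>0 / 3)) p" by blast
    have diam: "path_diam_le \<delta> p" "path_diam_le (\<epsilon>0 / 3) p" using p(7) by (auto simp: path_diam_le_def)
    obtain y where y: "word_map w y = y" "dist x y < ?e"
      using \<delta>(2)[OF p(4,5), of x] path_diam_le_ends[OF diam(1)] p by auto
    obtain b where b: "path b" "pathstart b = x" "pathfinish b = y" "path_diam_le (dist x y) b"
      using geodesic_path[OF geo] .
    have db: "path_diam_le (\<epsilon>0 / 3) (reversepath b)"
      using b(4) y(2) by (intro path_diam_le_reversepath) (force simp: path_diam_le_def)
    have "dist (b s) (b t) \<le> \<epsilon>1" if "s \<in> {0..1}" "t \<in> {0..1}" for s t
      using path_diam_leD[OF b(4) that] y(2) by simp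
    then have dwb: "path_diam_le (\<epsilon>0 / 3) (word_map w \<circ> b)"
      using \<epsilon>1(2)[OF p(4,5)] by (auto simp: path_diam_le_def)
    have wb: "path (word_map w \<circ> b)" "pathstart (word_map w \<circ> b) = word_map w x"
      "pathfinish (word_map w \<circ> b) = y"
      using b y p by (auto simp: path_compose continuous_F pathstart_comp pathfinish_comp)
    have "path_diam_le (\<epsilon>0 / 3 + (\<epsilon>0 / 3 + \<epsilon>0 / 3)) (p +++ (word_map w \<circ> b) +++ reversepath b)"
      using p b wb by (intro path_diam_le_join diam db dwb) simp_all
    then have "path_class (p +++ (word_map w \<circ> b) +++ reversepath b) = path_class (\<lambda>_. x)"
      using \<epsilon>0(2)[of "p +++ (word_map w \<circ> b) +++ reversepath b"] p b wb by simp
    then have *: "path_class p \<odot> path_class (word_map w \<circ> b) \<odot> path_class (reversepath b) = path_class (\<lambda>_. x)"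
      using p b wb by (simp add: path_class_join)
    have rb: "path_class (reversepath b) \<odot> path_class b = path_class (\<lambda>_. y)"
      using pjoin_reversepath[of "reversepath b"] b by simp
    have rwb: "path_class (word_map w \<circ> b) \<odot> path_class (word_map w \<circ> reversepath b) = path_class (\<lambda>_. word_map w x)"
      using pjoin_reversepath[OF wb(1)] wb by (simp add: reversepath_def comp_def)
    \<comment> \<open>This is the shape required in \<open>fixers\<close>: out to the fixed point
      along \<open>b\<close> and back along the translate of \<open>b\<close>.\<close>
    have wr: "path_class p = path_class b \<odot> path_class (word_map w \<circ> reversepath b)"
    proof -
      have "path_class p = path_class p \<odot> path_class (word_map w \<circ> b) \<odot> path_class (\<lambda>_. y) \<odot>
          path_class (word_map w \<circ> reversepath b)"
        using p b y by (simp add: const_pjoin pathstart_comp rwb pjoin_const)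
      also have "\<dots> = (path_class p \<odot> path_class (word_map w \<circ> b) \<odot> path_class (reversepath b)) \<odot>
          path_class b \<odot> path_class (word_map w \<circ> reversepath b)"
        unfolding rb[symmetric] by (simp only: pjoin_assoc)
      also have "\<dots> = path_class b \<odot> path_class (word_map w \<circ> reversepath b)"
        unfolding * using b y by (simp add: const_pjoin pathstart_comp pathfinish_comp flip: path_class_join)
      finally show ?thesis .
    qed
    have jq: "jinv (path_class q, []) = (path_class (reversepath q), [])"
      using q by (simp add: jinv_path comp_def)
    have "g \<star> jinv (path_class q, []) = (path_class (p +++ (word_map w \<circ> reversepath q)), w)"
      using q p unfolding jq by (simp add: jmult_path free_mult_Nil_right reduced_F)
    then have "(path_class q, []) \<star> g \<star> jinv (path_class q, []) =
        (path_class (q +++ p +++ (word_map w \<circ> reversepath q)), w)"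
      using q p by (simp add: jmult_path pathstart_comp path_compose continuous_F)
    also have "\<dots> = (path_class q \<odot> path_class p \<odot> path_class (word_map w \<circ> reversepath q), w)"
      using q p by (simp add: path_class_join pathstart_comp)
    also have "\<dots> = (path_class ((q +++ b) +++ (word_map w \<circ> reversepath (q +++ b))), w)"
      unfolding wr using q b y p
      by (simp add: reversepath_joinpaths compose_join path_class_join pathstart_comp pathfinish_comp
          pjoin_assoc)
    finally show "(path_class q, []) \<star> g \<star> jinv (path_class q, []) \<in> fixers n"
      unfolding fixers_def using q b y p by (auto intro!: exI[of _ "q +++ b"])
  qed
qed

end

section \<open>Developing local cocycles along jumping paths\<close>

lemma locally_constant_unit_interval:
  fixes f :: "real \<Rightarrow> 'b"
  assumes "\<epsilon> > 0" and f: "\<And>a b. \<lbrakk>a \<in> {0..1}; b \<in> {0..1}; \<bar>a - b\<bar> < \<epsilon>\<rbrakk> \<Longrightarrow> f a = f b"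
  shows "f 0 = f 1"
proof -
  obtain N where N: "N > 0" "1 / real N < \<epsilon>"
    using assms(1) by (metis nat_approx_posE zero_less_Suc of_nat_Suc)
  have "f (real i / N) = f 0" if "i \<le> N" for i
    using that
  proof (induction i)
    case (Suc i)
    have "f (real i / N) = f (real (Suc i) / N)"
      using Suc N by (intro f) (auto simp: field_simps)
    with Suc show ?case by simp
  qed simp
  from this[of N] N show ?thesis by simp
qed

text \<open>A \<open>U\<close>-valued 1-cocycle on the Rips complex of \<open>\<rho>\<close> at
  scale \<open>P\<close>: nothing is known about \<open>c\<close> at larger distances. It behaves
  like a flat connection and is integrated along paths and jumps, which gives a functor
  \<open>Phi\<close> from the groupoid to \<open>U\<close>.\<close>

locale local_cocycle = warped_paths S x0 \<alpha> + U: group U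
  for S :: "('a::metric_space \<Rightarrow> 'a) set" and x0 :: 'a and \<alpha> :: "('a \<Rightarrow> 'a) \<Rightarrow> real \<Rightarrow> 'a"
    and U :: "('u, 'm) monoid_scheme" (structure) +
  fixes \<rho> :: "'a \<Rightarrow> 'a \<Rightarrow> real" and t P :: real and c :: "'a \<Rightarrow> 'a \<Rightarrow> 'u"
  assumes metric: "Metric_space UNIV \<rho>"
    and t_pos: "t > 0" and \<rho>_dist: "\<rho> x y \<le> t * dist x y"
    and \<rho>_jump: "fst a \<in> S \<Longrightarrow> \<rho> (letter_map a x) x \<le> 1"
    and P: "P \<ge> 3"
    and c_closed: "\<rho> x y \<le> P \<Longrightarrow> c x y \<in> carrier U"
    and c_mult: "\<lbrakk>\<rho> x y \<le> P; \<rho> y z \<le> P; \<rho> x z \<le> P\<rbrakk> \<Longrightarrow> c x y \<otimes> c y z = c x z"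
begin

lemma \<rho>_simps: "\<rho> x x = 0" "\<rho> x y = \<rho> y x" "0 \<le> \<rho> x y"
  using metric Metric_space.commute[OF metric] Metric_space.mdist_zero[OF metric]
    Metric_space.nonneg[OF metric] by auto

lemma \<rho>_triangle: "\<rho> x z \<le> \<rho> x y + \<rho> y z"
  using Metric_space.triangle[OF metric] by auto

lemma c_refl: "c x x = \<one>"
proof -
  have x: "\<rho> x x \<le> P" using \<rho>_simps(1) P by simp
  show ?thesis using c_mult[OF x x x] c_closed[OF x] by simp
qed

lemma c_sym: "\<rho> x y \<le> P \<Longrightarrow> c x y \<otimes> c y x = \<one>"
  using c_mult[of x y x] c_refl[of x] \<rho>_simps(1)[of x] \<rho>_simps(2)[of x y] P by simp

lemma path_fine:
  assumes "path p"
  obtains \<epsilon> where "\<epsilon> > 0" "\<And>a b. \<lbrakk>a \<in> {0..1}; b \<in> {0..1}; \<bar>a - b\<bar> < \<epsilon>\<rbrakk> \<Longrightarrow> \<rho> (p a) (p b) \<le> 1"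
proof -
  have "uniformly_continuous_on {0..1} p"
    using assms by (intro compact_uniformly_continuous) (auto simp: path_def)
  then obtain \<epsilon> where \<epsilon>: "\<epsilon> > 0" "\<And>a b. \<lbrakk>a \<in> {0..1}; b \<in> {0..1}; dist a b < \<epsilon>\<rbrakk> \<Longrightarrow> dist (p a) (p b) < 1 / t"
    unfolding uniformly_continuous_on_def using t_pos by (metis zero_less_divide_1_iff)
  show ?thesis
  proof
    fix a b :: real assume "a \<in> {0..1}" "b \<in> {0..1}" "\<bar>a - b\<bar> < \<epsilon>"
    then have "dist (p a) (p b) < 1 / t" by (intro \<epsilon>) (auto simp: dist_real_def)
    then show "\<rho> (p a) (p b) \<le> 1"
      using \<rho>_dist[of "p a" "p b"] t_pos by (simp add: field_simps)
  qed (rule \<epsilon>)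
qed

text \<open>\<open>h\<close> is a primitive of the cocycle along \<open>p\<close>. The condition is
  local since \<open>c\<close> is controlled only at nearby points. The clause
  \<open>\<rho> \<le> 1\<close> holds along every path at a fine enough scale
  (\<open>path_fine\<close>) and is included so that one \<epsilon> serves both purposes.\<close>

definition is_dev :: "(real \<Rightarrow> 'a) \<Rightarrow> (real \<Rightarrow> 'u) \<Rightarrow> bool" where
  "is_dev p h \<longleftrightarrow> (\<forall>a\<in>{0..1}. h a \<in> carrier U) \<and>
     (\<exists>\<epsilon>>0. \<forall>a\<in>{0..1}. \<forall>b\<in>{0..1}. \<bar>a - b\<bar> < \<epsilon> \<longrightarrow> \<rho> (p a) (p b) \<le> 1 \<and> h a \<otimes> c (p a) (p b) = h b)"

lemma is_devI:
  assumes "path p" "\<And>a. a \<in> {0..1} \<Longrightarrow> h a \<in> carrier U" "\<epsilon> > 0"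
    and "\<And>a b. \<lbrakk>a \<in> {0..1}; b \<in> {0..1}; \<bar>a - b\<bar> < \<epsilon>; \<rho> (p a) (p b) \<le> 1\<rbrakk> \<Longrightarrow> h a \<otimes> c (p a) (p b) = h b"
  shows "is_dev p h"
proof -
  obtain \<epsilon>' where "\<epsilon>' > 0" "\<And>a b. \<lbrakk>a \<in> {0..1}; b \<in> {0..1}; \<bar>a - b\<bar> < \<epsilon>'\<rbrakk> \<Longrightarrow> \<rho> (p a) (p b) \<le> 1"
    using path_fine[OF assms(1)] by blast
  with assms(2-4) show ?thesis
    unfolding is_dev_def by (intro conjI ballI exI[of _ "min \<epsilon> \<epsilon>'"]) auto
qed

lemma dev_exists:
  assumes p: "path p"
  shows "\<exists>h. is_dev p h \<and> h 0 = \<one>"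
proof -
  obtain \<epsilon> where \<epsilon>: "\<epsilon> > 0" "\<And>a b. \<lbrakk>a \<in> {0..1}; b \<in> {0..1}; \<bar>a - b\<bar> < \<epsilon>\<rbrakk> \<Longrightarrow> \<rho> (p a) (p b) \<le> 1"
    using path_fine[OF p] by blast
  obtain N where N: "N > 0" "1 / real N < \<epsilon>"
    using \<epsilon>(1) by (metis nat_approx_posE zero_less_Suc of_nat_Suc)
  define x where "x i = p (real i / N)" for i :: nat
  define H where "H = rec_nat \<one> (\<lambda>i u. u \<otimes> c (x i) (x (Suc i)))"
  have H: "H 0 = \<one>" "H (Suc i) = H i \<otimes> c (x i) (x (Suc i))" for i by (auto simp: H_def)
  \<comment> \<open>The index of the last sample point at or before \<open>a\<close>. Parameters
    less than 1 / N apart are separated by at most one sample point, and all points involved are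
    within distance 2, where \<open>c_mult\<close> applies.\<close>
  define m where "m a = nat \<lfloor>N * a\<rfloor>" for a :: real
  define h where "h a = H (m a) \<otimes> c (x (m a)) (p a)" for a :: real
  have m: "real (m a) \<le> N * a" "N * a < real (m a) + 1" if "0 \<le> a" for a :: real
    using that N by (auto simp: m_def)
  have m_div: "real (m a) / N \<in> {0..1}" "\<bar>real (m a) / N - a\<bar> < \<epsilon>" if "a \<in> {0..1}" for a :: real
  proof -
    have *: "real (m a) / N \<le> a" "a < real (m a) / N + 1 / N"
      using m[of a] that N by (auto simp: field_simps)
    with that show "real (m a) / N \<in> {0..1}" by auto
    show "\<bar>real (m a) / N - a\<bar> < \<epsilon>" using * N by auto
  qed
  have \<rho>_m: "\<rho> (x (m a)) (p a) \<le> 1" if "a \<in> {0..1}" for a :: real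
    unfolding x_def using m_div[OF that] that by (intro \<epsilon>)
  have \<rho>_Suc: "\<rho> (x i) (x (Suc i)) \<le> 1" if "real (Suc i) / N \<le> 1" for i
    unfolding x_def using that N by (intro \<epsilon>) (auto simp: field_simps)
  have H_closed: "H i \<in> carrier U" if "real i / N \<le> 1" for i
    using that
  proof (induction i)
    case (Suc i)
    then have "H i \<in> carrier U" using N by (simp add: field_simps)
    with \<rho>_Suc[OF Suc.prems] P show ?case by (simp add: H c_closed)
  qed (simp add: H)
  have closed: "h a \<in> carrier U" if "a \<in> {0..1}" for a :: real
    using H_closed[of "m a"] m_div[OF that] \<rho>_m[OF that] P by (simp add: h_def c_closed)
  have step: "h a \<otimes> c (p a) (p b) = h b"
    if ab: "a \<in> {0..1}" "b \<in> {0..1}" "a \<le> b" "b - a < 1 / N" for a b :: real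
  proof -
    have \<rho>: "\<rho> (p a) (p b) \<le> 1" using ab N by (intro \<epsilon>) auto
    have \<rho>2: "\<rho> (x (m a)) (p b) \<le> 2" using \<rho>_triangle[of "x (m a)" "p b" "p a"] \<rho> \<rho>_m[OF ab(1)] by linarith
    have mem: "H (m a) \<in> carrier U" "c (x (m a)) (p a) \<in> carrier U" "c (p a) (p b) \<in> carrier U"
      using H_closed[of "m a"] m_div[OF ab(1)] c_closed \<rho> \<rho>_m[OF ab(1)] P by auto
    have "h a \<otimes> c (p a) (p b) = H (m a) \<otimes> (c (x (m a)) (p a) \<otimes> c (p a) (p b))"
      using mem by (simp add: h_def U.m_assoc)
    also have "\<dots> = H (m a) \<otimes> c (x (m a)) (p b)"
      using \<rho> \<rho>2 \<rho>_m[OF ab(1)] P by (simp add: c_mult)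
    finally have 1: "h a \<otimes> c (p a) (p b) = H (m a) \<otimes> c (x (m a)) (p b)" .
    have "N * b < N * a + 1" using ab(4) N by (simp add: field_simps)
    then have "m b = m a \<or> m b = Suc (m a)"
      using m[of a] m[of b] ab mult_left_mono[OF ab(3), of "real N"] by auto
    then show ?thesis
    proof
      assume eq: "m b = Suc (m a)"
      have \<rho>3: "\<rho> (x (m a)) (x (m b)) \<le> 1"
        using \<rho>_Suc[of "m a"] m_div(1)[OF ab(2)] unfolding eq by simp
      have "c (x (m a)) (p b) = c (x (m a)) (x (m b)) \<otimes> c (x (m b)) (p b)"
        using \<rho>2 \<rho>3 \<rho>_m[OF ab(2)] P by (intro c_mult[symmetric]) auto
      moreover have "c (x (m a)) (x (m b)) \<in> carrier U" "c (x (m b)) (p b) \<in> carrier U"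
        using \<rho>3 \<rho>_m[OF ab(2)] P c_closed by auto
      ultimately show ?thesis
        using mem by (simp add: 1 h_def[of b] eq H U.m_assoc)
    qed (simp add: 1 h_def[of b])
  qed
  have "is_dev p h"
  proof (rule is_devI[OF p closed, where \<epsilon> = "1 / real N"])
    fix a b :: real assume ab: "a \<in> {0..1}" "b \<in> {0..1}" "\<bar>a - b\<bar> < 1 / N" "\<rho> (p a) (p b) \<le> 1"
    show "h a \<otimes> c (p a) (p b) = h b"
    proof (cases "a \<le> b")
      case False
      have "h b \<otimes> c (p b) (p a) = h a" using ab False by (intro step) auto
      moreover have "c (p b) (p a) \<otimes> c (p a) (p b) = \<one>" "c (p b) (p a) \<in> carrier U" "c (p a) (p b) \<in> carrier U"
        using ab(4) P \<rho>_simps(2)[of "p a" "p b"] by (auto intro: c_sym c_closed)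
      ultimately show ?thesis using closed[OF ab(2)] by (metis U.m_assoc U.r_one)
    qed (use ab in \<open>auto intro: step\<close>)
  qed (use N in auto)
  moreover have "h 0 = \<one>" by (simp add: h_def m_def H x_def c_refl)
  ultimately show ?thesis by blast
qed

text \<open>In \<open>h' a \<otimes> inv (h a)\<close> the common right factor \<open>c\<close>
  cancels, so this quotient is locally constant on the interval.\<close>

lemma dev_unique:
  assumes "is_dev p h" "is_dev p h'"
  shows "h' 0 \<otimes> inv (h 0) = h' 1 \<otimes> inv (h 1)"
proof -
  obtain \<epsilon> where \<epsilon>: "\<epsilon> > 0" "\<And>a. a \<in> {0..1} \<Longrightarrow> h a \<in> carrier U"
    "\<And>a b. \<lbrakk>a \<in> {0..1}; b \<in> {0..1}; \<bar>a - b\<bar> < \<epsilon>\<rbrakk> \<Longrightarrow> \<rho> (p a) (p b) \<le> 1"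
    "\<And>a b. \<lbrakk>a \<in> {0..1}; b \<in> {0..1}; \<bar>a - b\<bar> < \<epsilon>\<rbrakk> \<Longrightarrow> h a \<otimes> c (p a) (p b) = h b"
    using assms(1) unfolding is_dev_def by blast
  obtain \<epsilon>' where \<epsilon>': "\<epsilon>' > 0" "\<And>a. a \<in> {0..1} \<Longrightarrow> h' a \<in> carrier U"
    "\<And>a b. \<lbrakk>a \<in> {0..1}; b \<in> {0..1}; \<bar>a - b\<bar> < \<epsilon>'\<rbrakk> \<Longrightarrow> h' a \<otimes> c (p a) (p b) = h' b"
    using assms(2) unfolding is_dev_def by blast
  show ?thesis
  proof (rule locally_constant_unit_interval[of "min \<epsilon> \<epsilon>'"])
    fix a b :: real assume ab: "a \<in> {0..1}" "b \<in> {0..1}" "\<bar>a - b\<bar> < min \<epsilon> \<epsilon>'"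
    have "c (p a) (p b) \<in> carrier U" using \<epsilon>(3)[of a b] ab P by (intro c_closed) auto
    moreover have "h b = h a \<otimes> c (p a) (p b)" "h' b = h' a \<otimes> c (p a) (p b)"
      using \<epsilon>(4)[of a b] \<epsilon>'(3)[of a b] ab by auto
    ultimately show "h' a \<otimes> inv (h a) = h' b \<otimes> inv (h b)"
      using \<epsilon>(2)[OF ab(1)] \<epsilon>'(2)[OF ab(1)]
      by (simp add: U.inv_mult_group U.m_assoc U.inv_solve_left')
        (simp add: U.m_assoc[symmetric])
  qed (use \<epsilon>(1) \<epsilon>'(1) in auto)
qed

definition devel :: "(real \<Rightarrow> 'a) \<Rightarrow> 'u" where
  "devel p = (SOME h. is_dev p h \<and> h 0 = \<one>) 1"

lemma is_dev_closed: "is_dev p h \<Longrightarrow> a \<in> {0..1} \<Longrightarrow> h a \<in> carrier U"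
  by (simp add: is_dev_def)

lemma devel_witness: 
  assumes "path p"
  obtains h where "is_dev p h" "h 0 = \<one>" "h 1 = devel p"
  using someI_ex[OF dev_exists[OF assms]] unfolding devel_def by blast

lemma devel_closed: "path p \<Longrightarrow> devel p \<in> carrier U"
  using devel_witness[of p] is_dev_closed[of p _ 1] by (metis atLeastAtMost_iff order_refl zero_le_one)

lemma devel_eq:
  assumes "path p" "is_dev p h"
  shows "h 0 \<otimes> devel p = h 1"
proof -
  obtain h' where h': "is_dev p h'" "h' 0 = \<one>" "h' 1 = devel p" using devel_witness[OF assms(1)] .
  have mem: "h 0 \<in> carrier U" "h 1 \<in> carrier U" "devel p \<in> carrier U"
    using is_dev_closed[OF assms(2)] devel_closed[OF assms(1)] by auto
  have "h 0 = h 1 \<otimes> inv (devel p)" using dev_unique[OF h'(1) assms(2)] mem h' by simp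
  then show ?thesis using mem by (simp add: U.m_assoc)
qed

lemma devel_join:
  assumes "path p" "path q" "pathfinish p = pathstart q"
  shows "devel (p +++ q) = devel p \<otimes> devel q"
proof -
  have pq: "path (p +++ q)" using assms by simp
  obtain h where h: "is_dev (p +++ q) h" "h 0 = \<one>" "h 1 = devel (p +++ q)" using devel_witness[OF pq] .
  obtain \<epsilon> where \<epsilon>: "\<epsilon> > 0" "\<And>a. a \<in> {0..1} \<Longrightarrow> h a \<in> carrier U"
    "\<And>a b. \<lbrakk>a \<in> {0..1}; b \<in> {0..1}; \<bar>a - b\<bar> < \<epsilon>\<rbrakk> \<Longrightarrow> \<rho> ((p +++ q) a) ((p +++ q) b) \<le> 1"
    "\<And>a b. \<lbrakk>a \<in> {0..1}; b \<in> {0..1}; \<bar>a - b\<bar> < \<epsilon>\<rbrakk> \<Longrightarrow> h a \<otimes> c ((p +++ q) a) ((p +++ q) b) = h b"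
    using h(1) unfolding is_dev_def by blast
  have left: "(p +++ q) (a / 2) = p a" if "a \<in> {0..1}" for a
    using that by (simp add: joinpaths_def)
  have right: "(p +++ q) ((1 + a) / 2) = q a" if "a \<in> {0..1}" for a
    using that assms(3) by (cases "a = 0") (auto simp: joinpaths_def pathfinish_def pathstart_def field_simps)
  have half: "\<bar>a / 2 - b / 2\<bar> < \<epsilon>" "\<bar>(1 + a) / 2 - (1 + b) / 2\<bar> < \<epsilon>" if "\<bar>a - b\<bar> < \<epsilon>" for a b :: real
    using that by (auto simp: field_simps)
  have "is_dev p (\<lambda>a. h (a / 2))"
  proof (rule is_devI[OF assms(1) _ \<epsilon>(1)])
    fix a b :: real assume "a \<in> {0..1}" "b \<in> {0..1}" "\<bar>a - b\<bar> < \<epsilon>"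
    with \<epsilon>(4)[OF _ _ half(1), of a b] show "h (a / 2) \<otimes> c (p a) (p b) = h (b / 2)"
      by (auto simp: left)
  qed (use \<epsilon>(2) in auto)
  from devel_eq[OF assms(1) this] have 1: "devel p = h (1 / 2)"
    using h(2) devel_closed[OF assms(1)] by simp
  have "is_dev q (\<lambda>a. h ((1 + a) / 2))"
  proof (rule is_devI[OF assms(2) _ \<epsilon>(1)])
    fix a b :: real assume "a \<in> {0..1}" "b \<in> {0..1}" "\<bar>a - b\<bar> < \<epsilon>"
    with \<epsilon>(4)[OF _ _ half(2), of a b] show "h ((1 + a) / 2) \<otimes> c (q a) (q b) = h ((1 + b) / 2)"
      by (auto simp: right)
  qed (use \<epsilon>(2) in auto)
  from devel_eq[OF assms(2) this] show ?thesis using 1 h(3) by simp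
qed

text \<open>When the whole path has diameter at most \<open>P\<close>, the function
  \<open>c (p 0) (p a)\<close> is itself a primitive.\<close>

lemma devel_small:
  assumes "path p" "\<And>a b. \<lbrakk>a \<in> {0..1}; b \<in> {0..1}\<rbrakk> \<Longrightarrow> \<rho> (p a) (p b) \<le> P"
  shows "devel p = c (pathstart p) (pathfinish p)"
proof -
  have "is_dev p (\<lambda>a. c (p 0) (p a))"
    by (rule is_devI[OF assms(1), where \<epsilon> = 1]) (use assms(2) in \<open>auto intro: c_closed c_mult\<close>)
  from devel_eq[OF assms(1) this] show ?thesis
    using devel_closed[OF assms(1)] by (simp add: c_refl pathstart_def pathfinish_def)
qed

lemma devel_const: "devel (\<lambda>_. x) = \<one>"
  using devel_small[of "\<lambda>_. x"] P by (simp add: c_refl \<rho>_simps(1))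

text \<open>Transport around the strip between \<open>p\<close> and its translate is trivial:
  corresponding points are at distance at most 1, so a primitive along \<open>p\<close>, corrected
  by \<open>c\<close> at both ends, is a primitive along the translate.\<close>

lemma devel_letter:
  assumes a: "fst a \<in> S" and p: "path p"
  shows "devel (letter_map a \<circ> p) \<otimes> c (letter_map a (pathfinish p)) (pathfinish p) =
    c (letter_map a (pathstart p)) (pathstart p) \<otimes> devel p"
proof -
  let ?q = "letter_map a \<circ> p"
  have q: "path ?q" by (intro path_compose continuous_letter_map a p)
  obtain h where h: "is_dev p h" "h 0 = \<one>" "h 1 = devel p" using devel_witness[OF p] .
  obtain \<epsilon> where \<epsilon>: "\<epsilon> > 0" "\<And>a. a \<in> {0..1} \<Longrightarrow> h a \<in> carrier U"
    "\<And>a b. \<lbrakk>a \<in> {0..1}; b \<in> {0..1}; \<bar>a - b\<bar> < \<epsilon>\<rbrakk> \<Longrightarrow> \<rho> (p a) (p b) \<le> 1"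
    "\<And>a b. \<lbrakk>a \<in> {0..1}; b \<in> {0..1}; \<bar>a - b\<bar> < \<epsilon>\<rbrakk> \<Longrightarrow> h a \<otimes> c (p a) (p b) = h b"
    using h(1) unfolding is_dev_def by blast
  have \<rho>1: "\<rho> (?q u) (p u) \<le> P" "\<rho> (p u) (?q u) \<le> P" for u
    using \<rho>_jump[OF a, of "p u"] \<rho>_simps(2)[of "p u" "?q u"] P by auto
  have mem: "c (?q u) (p u) \<in> carrier U" "c (p u) (?q u) \<in> carrier U" for u
    by (intro c_closed \<rho>1)+
  have "is_dev ?q (\<lambda>u. c (?q 0) (p 0) \<otimes> h u \<otimes> c (p u) (?q u))"
  proof (rule is_devI[OF q _ \<epsilon>(1)])
    fix u v :: real assume uv: "u \<in> {0..1}" "v \<in> {0..1}" "\<bar>u - v\<bar> < \<epsilon>" and q1: "\<rho> (?q u) (?q v) \<le> 1"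
    have 2: "\<rho> (p u) (?q v) \<le> P"
      using \<rho>_triangle[of "p u" "?q v" "p v"] \<epsilon>(3)[OF uv] \<rho>_jump[OF a, of "p v"] \<rho>_simps(2)[of "p v" "?q v"] P
      by simp
    have mem2: "c (?q u) (?q v) \<in> carrier U" "c (p u) (p v) \<in> carrier U"
      using q1 \<epsilon>(3)[OF uv] P by (auto intro: c_closed)
    have "c (p u) (?q u) \<otimes> c (?q u) (?q v) = c (p u) (p v) \<otimes> c (p v) (?q v)"
      using q1 \<epsilon>(3)[OF uv] P 2 c_mult[of "p u" "?q u" "?q v"] c_mult[of "p u" "p v" "?q v"] \<rho>1 by simp
    then have "c (?q 0) (p 0) \<otimes> h u \<otimes> c (p u) (?q u) \<otimes> c (?q u) (?q v) =
        c (?q 0) (p 0) \<otimes> (h u \<otimes> c (p u) (p v)) \<otimes> c (p v) (?q v)"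
      using mem[of 0] mem[of u] mem[of v] mem2 \<epsilon>(2)[OF uv(1)] by (simp add: U.m_assoc)
    then show "c (?q 0) (p 0) \<otimes> h u \<otimes> c (p u) (?q u) \<otimes> c (?q u) (?q v) =
        c (?q 0) (p 0) \<otimes> h v \<otimes> c (p v) (?q v)"
      using \<epsilon>(4)[OF uv] by simp
  qed (use mem \<epsilon>(2) in auto)
  from devel_eq[OF q this]
  have "devel ?q = c (?q 0) (p 0) \<otimes> devel p \<otimes> c (p 1) (?q 1)"
    using mem[of 0] h devel_closed[OF q] c_sym[OF \<rho>1(1)[of 0]] by simp
  then have "devel ?q \<otimes> c (?q 1) (p 1) = c (?q 0) (p 0) \<otimes> devel p \<otimes> (c (p 1) (?q 1) \<otimes> c (?q 1) (p 1))"
    using mem[of 0] mem[of 1] devel_closed[OF p] by (simp add: U.m_assoc)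
  then show ?thesis
    using mem[of 0] devel_closed[OF p] c_sym[OF \<rho>1(2)[of 1]] by (simp add: pathstart_def pathfinish_def)
qed

text \<open>Neighbouring paths of the homotopy are compared as in \<open>devel_letter\<close>:
  multiplying by \<open>c (?p s) (?q s)\<close> gives a primitive along the next path, and this
  correction is \<open>\<one>\<close> at the fixed end points. So the development is locally
  constant in the homotopy parameter.\<close>

lemma devel_homotopic:
  assumes "homotopic_paths UNIV p q"
  shows "devel p = devel q"
proof -
  obtain H :: "real \<times> real \<Rightarrow> 'a" where H': "continuous_on ({0..1} \<times> {0..1}) H" "\<forall>x\<in>{0..1}. H (0, x) = p x"
    "\<forall>x\<in>{0..1}. H (1, x) = q x" "\<forall>u\<in>{0..1}. H (u, 0) = p 0 \<and> H (u, 1) = p 1"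
    using assms unfolding homotopic_paths pathstart_def pathfinish_def comp_apply
    by (elim exE conjE) (rule that; assumption)
  then have H: "continuous_on ({0..1} \<times> {0..1}) H" "\<And>x. x \<in> {0..1} \<Longrightarrow> H (0, x) = p x"
    "\<And>x. x \<in> {0..1} \<Longrightarrow> H (1, x) = q x"
    "\<And>u. u \<in> {0..1} \<Longrightarrow> H (u, 0) = p 0" "\<And>u. u \<in> {0..1} \<Longrightarrow> H (u, 1) = p 1"
    by auto
  have path_H: "path (\<lambda>s. H (u, s))" if "u \<in> {0..1}" for u
    unfolding path_def using that by (intro continuous_on_compose2[OF H(1)] continuous_intros) auto
  have "uniformly_continuous_on ({0..1} \<times> {0..1}) H"
    by (intro compact_uniformly_continuous H(1) compact_Times) auto
  then obtain \<epsilon> where \<epsilon>: "\<epsilon> > 0" "\<And>a b. \<lbrakk>a \<in> {0..1} \<times> {0..1}; b \<in> {0..1} \<times> {0..1}; dist a b < \<epsilon>\<rbrakk> \<Longrightarrow>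
      dist (H a) (H b) < 1 / t"
    unfolding uniformly_continuous_on_def using t_pos by (metis zero_less_divide_1_iff)
  have near: "\<rho> (H (u, s)) (H (v, s)) \<le> 1"
    if "u \<in> {0..1}" "v \<in> {0..1}" "s \<in> {0..1}" "\<bar>u - v\<bar> < \<epsilon>" for u v s
  proof -
    have "dist (H (u, s)) (H (v, s)) < 1 / t"
      using that by (intro \<epsilon>) (auto simp: dist_Pair_Pair dist_real_def)
    then show ?thesis using \<rho>_dist[of "H (u, s)" "H (v, s)"] t_pos by (simp add: field_simps)
  qed
  have "devel (\<lambda>s. H (u, s)) = devel (\<lambda>s. H (v, s))"
    if uv: "u \<in> {0..1}" "v \<in> {0..1}" "\<bar>u - v\<bar> < \<epsilon>" for u v
  proof -
    let ?p = "\<lambda>s. H (u, s)" and ?q = "\<lambda>s. H (v, s)"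
    obtain h where h: "is_dev ?p h" "h 0 = \<one>" "h 1 = devel ?p" using devel_witness[OF path_H[OF uv(1)]] .
    obtain \<epsilon>' where \<epsilon>': "\<epsilon>' > 0" "\<And>a. a \<in> {0..1} \<Longrightarrow> h a \<in> carrier U"
      "\<And>a b. \<lbrakk>a \<in> {0..1}; b \<in> {0..1}; \<bar>a - b\<bar> < \<epsilon>'\<rbrakk> \<Longrightarrow> \<rho> (?p a) (?p b) \<le> 1"
      "\<And>a b. \<lbrakk>a \<in> {0..1}; b \<in> {0..1}; \<bar>a - b\<bar> < \<epsilon>'\<rbrakk> \<Longrightarrow> h a \<otimes> c (?p a) (?p b) = h b"
      using h(1) unfolding is_dev_def by blast
    have mem: "c (?p s) (?q s) \<in> carrier U" if "s \<in> {0..1}" for s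
      using near[OF uv(1,2) that uv(3)] P by (intro c_closed) auto
    have "is_dev ?q (\<lambda>s. h s \<otimes> c (?p s) (?q s))"
    proof (rule is_devI[OF path_H[OF uv(2)] _ \<epsilon>'(1)])
      fix a b :: real assume ab: "a \<in> {0..1}" "b \<in> {0..1}" "\<bar>a - b\<bar> < \<epsilon>'" and q1: "\<rho> (?q a) (?q b) \<le> 1"
      note n = near[OF uv(1,2) ab(1) uv(3)] near[OF uv(1,2) ab(2) uv(3)] \<epsilon>'(3)[OF ab]
      have 2: "\<rho> (?p a) (?q b) \<le> P"
        using \<rho>_triangle[of "?p a" "?q b" "?p b"] n P by simp
      have "c (?p a) (?q a) \<otimes> c (?q a) (?q b) = c (?p a) (?p b) \<otimes> c (?p b) (?q b)"
        using n q1 P 2 c_mult[of "?p a" "?q a" "?q b"] c_mult[of "?p a" "?p b" "?q b"] by simp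
      moreover have "c (?q a) (?q b) \<in> carrier U" "c (?p a) (?p b) \<in> carrier U"
        using q1 n P by (auto intro: c_closed)
      ultimately have "h a \<otimes> c (?p a) (?q a) \<otimes> c (?q a) (?q b) = (h a \<otimes> c (?p a) (?p b)) \<otimes> c (?p b) (?q b)"
        using mem[OF ab(1)] mem[OF ab(2)] \<epsilon>'(2)[OF ab(1)] by (simp add: U.m_assoc)
      then show "h a \<otimes> c (?p a) (?q a) \<otimes> c (?q a) (?q b) = h b \<otimes> c (?p b) (?q b)"
        using \<epsilon>'(4)[OF ab] by simp
    qed (use mem \<epsilon>'(2) in auto)
    from devel_eq[OF path_H[OF uv(2)] this] show ?thesis
      using h uv devel_closed[OF path_H[OF uv(1)]] devel_closed[OF path_H[OF uv(2)]] by (simp add: H c_refl)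
  qed
  from locally_constant_unit_interval[of \<epsilon> "\<lambda>u. devel (\<lambda>s. H (u, s))", OF \<epsilon>(1) this]
  have "devel (\<lambda>s. H (0, s)) = devel (\<lambda>s. H (1, s))" .
  moreover have same: "devel p' = devel q'"
    if pq: "path p'" "path q'" "\<And>s. s \<in> {0..1} \<Longrightarrow> p' s = q' s" for p' q'
  proof -
    obtain h where h: "is_dev p' h" "h 0 = \<one>" "h 1 = devel p'" by (rule devel_witness[OF pq(1)])
    then have "is_dev q' h" unfolding is_dev_def using pq(3) by simp
    from devel_eq[OF pq(2) this] h devel_closed[OF pq(2)] show ?thesis by simp
  qed
  moreover have "devel p = devel (\<lambda>s. H (0, s))" "devel (\<lambda>s. H (1, s)) = devel q"
    using homotopic_paths_imp_path[OF assms] path_H[of 0] path_H[of 1] H(2,3) by (auto intro!: same)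
  ultimately show ?thesis by simp
qed

text \<open>Transport from \<open>z\<close> to the preimage of \<open>z\<close> under
  \<open>w\<close>, letter by letter. As in \<open>J\<close>, the letter \<open>a\<close> leads from
  \<open>z\<close> to its preimage under \<open>a\<close>.\<close>

primrec jumps :: "('a \<Rightarrow> 'a) word \<Rightarrow> 'a \<Rightarrow> 'u" where
  "jumps [] z = \<one>"
| "jumps (a # w) z = c z (letter_map (inv_letter a) z) \<otimes> jumps w (letter_map (inv_letter a) z)"

lemma c_jump:
  assumes "fst a \<in> S"
  shows "c z (letter_map (inv_letter a) z) \<in> carrier U" "c (letter_map a z) z \<in> carrier U"
    "c z (letter_map a z) \<in> carrier U"
  using \<rho>_jump[of a z] \<rho>_jump[of "inv_letter a" z] \<rho>_simps(2)[of z] assms P by (auto intro!: c_closed)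

lemma jumps_closed: "fst ` set w \<subseteq> S \<Longrightarrow> jumps w z \<in> carrier U"
  by (induction w arbitrary: z) (auto simp: c_jump)

lemma jumps_reduced_Cons:
  assumes "fst a \<in> S" "fst ` set w \<subseteq> S"
  shows "jumps (reduced_Cons a w) z = c z (letter_map (inv_letter a) z) \<otimes> jumps w (letter_map (inv_letter a) z)"
proof (cases "w \<noteq> [] \<and> hd w = inv_letter a")
  case True
  then obtain v where v: "w = inv_letter a # v" by (metis list.collapse)
  let ?y = "letter_map (inv_letter a) z"
  have y: "letter_map a ?y = z" using assms(1) by (simp add: letter_map_inverse)
  have "c z ?y \<otimes> c ?y z = \<one>"
    using c_sym[of z ?y] \<rho>_jump[OF assms(1), of ?y] P y by simp
  moreover have "c z ?y \<in> carrier U" "c ?y z \<in> carrier U" "jumps v z \<in> carrier U"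
    using c_jump[OF assms(1), of z] c_jump(3)[OF assms(1), of ?y] jumps_closed assms v y by auto
  ultimately have "c z ?y \<otimes> (c ?y z \<otimes> jumps v z) = jumps v z"
    by (metis U.m_assoc U.l_one)
  then show ?thesis using v y by (simp add: reduced_Cons_def)
qed (auto simp: reduced_Cons_def)

lemma jumps_free_mult:
  assumes "fst ` set v \<subseteq> S" "fst ` set w \<subseteq> S"
  shows "jumps (free_mult v w) (word_map v z) = jumps v (word_map v z) \<otimes> jumps w z"
  using assms(1)
proof (induction v)
  case Nil
  then show ?case using jumps_closed[OF assms(2)] by simp
next
  case (Cons a v)
  have letters: "fst a \<in> S" "fst ` set v \<subseteq> S" "fst ` set (free_mult v w) \<subseteq> S"
    using Cons.prems assms(2) image_mono[OF letters_free_mult[of v w], of fst]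
    by (simp_all add: image_Un) blast
  show ?case
    using letters assms(2) jumps_closed
    by (simp add: jumps_reduced_Cons word_map_Cons letter_map_inverse Cons.IH U.m_assoc c_jump)
qed

text \<open>Iterates \<open>devel_letter\<close>. Since \<open>\<star>\<close> translates its second
  path by the first word, this commutation is what makes \<open>Phi\<close> multiplicative.\<close>

lemma devel_word:
  assumes "fst ` set w \<subseteq> S" and p: "path p"
  shows "devel (word_map w \<circ> p) \<otimes> jumps w (word_map w (pathfinish p)) =
    jumps w (word_map w (pathstart p)) \<otimes> devel p"
  using assms(1)
proof (induction w)
  case Nil
  then show ?case using devel_closed[OF p] by simp
next
  case (Cons a w)
  let ?q = "word_map w \<circ> p"
  have letters: "fst a \<in> S" "fst ` set w \<subseteq> S" using Cons.prems by auto
  have q: "path ?q" using letters p by (intro path_compose continuous_word_map)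
  have aq: "path (letter_map a \<circ> ?q)" by (rule path_compose[OF continuous_letter_map[OF letters(1)] q])
  let ?y = "word_map w (pathstart p)" and ?z = "word_map w (pathfinish p)"
  have mem: "jumps w ?y \<in> carrier U" "jumps w ?z \<in> carrier U" "devel ?q \<in> carrier U"
    "devel (letter_map a \<circ> ?q) \<in> carrier U" "devel p \<in> carrier U"
    "c (letter_map a ?y) ?y \<in> carrier U" "c (letter_map a ?z) ?z \<in> carrier U"
    using letters q aq p by (auto simp: jumps_closed devel_closed c_jump)
  have "devel (letter_map a \<circ> ?q) \<otimes> (c (letter_map a ?z) ?z \<otimes> jumps w ?z) =
      (devel (letter_map a \<circ> ?q) \<otimes> c (letter_map a ?z) ?z) \<otimes> jumps w ?z"
    using mem by (simp add: U.m_assoc)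
  also have "\<dots> = c (letter_map a ?y) ?y \<otimes> (devel ?q \<otimes> jumps w ?z)"
    using devel_letter[OF letters(1) q] mem by (simp add: pathstart_comp pathfinish_comp U.m_assoc)
  also have "devel ?q \<otimes> jumps w ?z = jumps w ?y \<otimes> devel p"
    by (rule Cons.IH[OF letters(2)])
  also have "c (letter_map a ?y) ?y \<otimes> \<dots> = c (letter_map a ?y) ?y \<otimes> jumps w ?y \<otimes> devel p"
    using mem by (simp add: U.m_assoc)
  finally show ?case
    using letters by (simp add: word_map_Cons letter_map_inverse comp_assoc)
qed

text \<open>Up to \<open>P\<close> letters all intermediate points remain within the range of
  \<open>c_mult\<close>, so the product telescopes. Together with 4 * \<theta> \<le> P this is why
  generators of \<open>N \<theta>\<close> develop trivially.\<close>

lemma jumps_short: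
  assumes "fst ` set w \<subseteq> S" "length w \<le> P"
  shows "jumps w (word_map w z) = c (word_map w z) z" "\<rho> (word_map w z) z \<le> length w"
proof -
  have "jumps w (word_map w z) = c (word_map w z) z \<and> \<rho> (word_map w z) z \<le> length w"
    using assms
  proof (induction w)
    case (Cons a w)
    let ?y = "word_map w z"
    have *: "fst a \<in> S" "jumps w ?y = c ?y z" "\<rho> ?y z \<le> length w" using Cons by auto
    have 1: "\<rho> (letter_map a ?y) ?y \<le> 1" using * by (intro \<rho>_jump)
    have 2: "\<rho> (letter_map a ?y) z \<le> length (a # w)"
      using \<rho>_triangle[of "letter_map a ?y" z ?y] 1 * by simp
    have "c (letter_map a ?y) ?y \<otimes> c ?y z = c (letter_map a ?y) z"
      using 1 2 * Cons.prems P by (intro c_mult) auto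
    with * 2 show ?case by (simp add: word_map_Cons letter_map_inverse)
  qed (simp add: c_refl \<rho>_simps)
  then show "jumps w (word_map w z) = c (word_map w z) z" "\<rho> (word_map w z) z \<le> length w" by auto
qed

definition Phi :: "'a jelem \<Rightarrow> 'u" where
  "Phi g = (let p = SOME p. p \<in> fst g in devel p \<otimes> jumps (snd g) (pathfinish p))"

lemma Phi_path:
  assumes "path p"
  shows "Phi (path_class p, w) = devel p \<otimes> jumps w (pathfinish p)"
proof -
  let ?q = "SOME q. q \<in> path_class p"
  have "?q \<in> path_class p" using mem_path_class[OF assms] by (rule someI[of "\<lambda>q. q \<in> path_class p"])
  then have "devel ?q = devel p" "pathfinish ?q = pathfinish p"
    using devel_homotopic[of p ?q] mem_path_classD(4)[of ?q p] by (auto simp: path_class_def)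
  then show ?thesis by (simp add: Phi_def Let_def)
qed

lemma Phi_closed: "g \<in> J x y \<Longrightarrow> Phi g \<in> carrier U"
  by (elim J_E) (simp add: Phi_path devel_closed jumps_closed letters_F)

lemma Phi_mult:
  assumes "g \<in> J x y" "h \<in> J y z"
  shows "Phi (g \<star> h) = Phi g \<otimes> Phi h"
proof -
  obtain p w where p: "g = (path_class p, w)" "path p" "pathstart p = x" "w \<in> F" "pathfinish p = word_map w y"
    using assms(1) by (rule J_E)
  obtain q v where q: "h = (path_class q, v)" "path q" "pathstart q = y" "v \<in> F" "pathfinish q = word_map v z"
    using assms(2) by (rule J_E)
  have wq: "path (word_map w \<circ> q)" using p q by (intro path_compose continuous_F)
  note L = letters_F[OF p(4)] letters_F[OF q(4)]
  have mem: "devel p \<in> carrier U" "devel q \<in> carrier U" "devel (word_map w \<circ> q) \<in> carrier U"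
    "jumps w u \<in> carrier U" "jumps v u \<in> carrier U" for u
    using p q wq L by (auto simp: devel_closed jumps_closed)
  have "Phi (g \<star> h) = devel p \<otimes> devel (word_map w \<circ> q) \<otimes> jumps (free_mult w v) (word_map w (pathfinish q))"
    using p q wq by (simp add: jmult_path Phi_path pathstart_comp pathfinish_comp devel_join)
  also have "\<dots> = devel p \<otimes> (devel (word_map w \<circ> q) \<otimes> jumps w (word_map w (pathfinish q))) \<otimes> jumps v (pathfinish q)"
    using mem L by (simp add: jumps_free_mult U.m_assoc)
  also have "\<dots> = (devel p \<otimes> jumps w (pathfinish p)) \<otimes> (devel q \<otimes> jumps v (pathfinish q))"
    using devel_word[OF L(1) q(2)] p q mem by (simp add: U.m_assoc)
  finally show ?thesis using p q by (simp add: Phi_path)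
qed

lemma Phi_jone: "Phi (jone x) = \<one>"
  by (simp add: jone_def Phi_path devel_const)

lemma Phi_jinv: "g \<in> J x y \<Longrightarrow> Phi (jinv g) = inv (Phi g)"
  using Phi_mult[OF jinv_closed, of g x y g] Phi_closed Phi_jone
  by (metis U.inv_equality jinv_closed jinv_left)

lemma Phi_hom: "group_hom (J0 x) U Phi"
  by (auto simp: group_hom_def group_hom_axioms_def group_J0 U.group_axioms hom_def Phi_closed Phi_mult)

text \<open>\<open>devel_word\<close> moves the jumps along the translated path to the fixed point
  \<open>y\<close>, where \<open>jumps_short\<close> turns them into \<open>c y y = \<one>\<close>.
  What remains is a path followed by its reverse.\<close>

lemma Phi_fixers:
  assumes "g \<in> fixers n" "n \<le> P"
  shows "Phi g = \<one>"
proof -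
  obtain p w where p: "g = (path_class (p +++ (word_map w \<circ> reversepath p)), w)" "w \<in> F" "length w \<le> n"
    "path p" "pathstart p = x0" "word_map w (pathfinish p) = pathfinish p"
    using assms(1) by (auto simp: fixers_def)
  have wr: "path (word_map w \<circ> reversepath p)" using p by (intro path_compose continuous_F) auto
  note L = letters_F[OF p(2)]
  have mem: "devel p \<in> carrier U" "devel (reversepath p) \<in> carrier U" "devel (word_map w \<circ> reversepath p) \<in> carrier U"
    "jumps w u \<in> carrier U" for u
    using p wr L by (auto simp: devel_closed jumps_closed)
  have "Phi g = devel p \<otimes> devel (word_map w \<circ> reversepath p) \<otimes> jumps w (word_map w x0)"
    using p wr by (simp add: Phi_path devel_join pathstart_comp pathfinish_comp)
  also have "\<dots> = devel p \<otimes> (jumps w (word_map w (pathfinish p)) \<otimes> devel (reversepath p))"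
    using devel_word[OF L, of "reversepath p"] p mem by (simp add: U.m_assoc)
  also have "jumps w (word_map w (pathfinish p)) = \<one>"
    using jumps_short(1)[OF L, of "pathfinish p"] p assms(2) by (simp add: c_refl)
  also have "devel p \<otimes> (\<one> \<otimes> devel (reversepath p)) = devel (p +++ reversepath p)"
    using p mem by (simp add: devel_join)
  also have "\<dots> = devel (\<lambda>_. pathstart p)"
    using pjoin_reversepath[OF p(4)] p(4)
    by (intro devel_homotopic) (simp add: path_class_eq_iff flip: path_class_join)
  finally show ?thesis by (simp add: devel_const)
qed

text \<open>Each step, path or jump, moves a distance of at most \<open>C\<close>, so a morphism of
  \<open>n\<close> steps stays within n * C \<le> P of its start and the values of \<open>c\<close>
  telescope.\<close>

lemma Phi_small:
  assumes "small \<eta> n x g y" "t * \<eta> \<le> C" "1 \<le> C" "n * C \<le> P"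
  shows "Phi g = c x y" "\<rho> x y \<le> n * C"
proof -
  have "Phi g = c x y \<and> \<rho> x y \<le> n * C"
    using assms(1,4)
  proof (induction rule: small.induct)
    case (unit x)
    then show ?case by (simp add: Phi_jone c_refl \<rho>_simps)
  next
    case (weaken n x g y)
    then show ?case using assms(3) by (auto simp: algebra_simps)
  next
    case (path n x g p)
    have nC: "n * C \<le> P" "n * C + C \<le> P" using path.prems assms(3) by (auto simp: algebra_simps)
    have diam: "\<rho> (p a) (p b) \<le> C" if "a \<in> {0..1}" "b \<in> {0..1}" for a b
    proof -
      have "\<rho> (p a) (p b) \<le> t * \<eta>"
        using \<rho>_dist[of "p a" "p b"] path_diam_leD[OF path.hyps(3) that] t_pos
        by (meson mult_left_mono less_imp_le order_trans)
      then show ?thesis using assms(2) by simp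
    qed
    have "0 \<le> n * C" using assms(3) by simp
    have CP: "C \<le> P" using nC \<open>0 \<le> n * C\<close> by linarith
    have 1: "\<rho> (pathstart p) (pathfinish p) \<le> C" using diam[of 0 1] by (simp add: pathstart_def pathfinish_def)
    have 2: "\<rho> x (pathfinish p) \<le> n * C + C"
      using \<rho>_triangle[of x "pathfinish p" "pathstart p"] 1 path.IH nC by simp
    have "Phi (g \<star> (path_class p, [])) = c x (pathstart p) \<otimes> devel p"
      using path nC devel_closed[OF path.hyps(2)]
      by (simp add: Phi_mult[OF small_in_J path_in_J] Phi_path)
    also have "devel p = c (pathstart p) (pathfinish p)"
      using diam CP by (intro devel_small path.hyps) force
    also have "c x (pathstart p) \<otimes> \<dots> = c x (pathfinish p)"
      using path.IH nC 1 2 CP by (intro c_mult) auto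
    finally show ?case using 2 by (simp add: algebra_simps)
  next
    case (jump n x g a z)
    have nC: "n * C \<le> P" "n * C + C \<le> P" using jump.prems assms(3) by (auto simp: algebra_simps)
    have 1: "\<rho> (letter_map a z) z \<le> 1" using jump.hyps by (intro \<rho>_jump)
    have 2: "\<rho> x z \<le> n * C + C"
      using \<rho>_triangle[of x z "letter_map a z"] 1 jump.IH nC assms(3) by simp
    have "Phi (g \<star> (path_class (\<lambda>_. letter_map a z), [a])) = c x (letter_map a z) \<otimes> c (letter_map a z) z"
      using jump nC c_jump[OF jump.hyps(2)]
      by (simp add: Phi_mult[OF small_in_J jump_in_J] Phi_path devel_const letter_map_inverse)
    also have "\<dots> = c x z"
      using jump.IH nC 1 2 P by (intro c_mult) auto
    finally show ?case using 2 by (simp add: algebra_simps)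
  qed
  then show "Phi g = c x y" "\<rho> x y \<le> n * C" by auto
qed

end

section \<open>Words in a finitely generated group\<close>

locale generated_group = group \<Lambda> for \<Lambda> :: "('b, 'm) monoid_scheme" (structure) +
  fixes T :: "'b set"
  assumes T: "T \<subseteq> carrier \<Lambda>" and gen: "generate \<Lambda> T = carrier \<Lambda>"
begin

definition "letters = T \<union> m_inv \<Lambda> ` T"

definition ev :: "'b list \<Rightarrow> 'b" where "ev p = foldr (\<otimes>) p \<one>"

definition word_inv :: "'b list \<Rightarrow> 'b list" where "word_inv p = rev (map (m_inv \<Lambda>) p)"

lemma letters_closed: "s \<in> letters \<Longrightarrow> s \<in> carrier \<Lambda>"
  using T by (auto simp: letters_def)

lemma inv_letters: "s \<in> letters \<Longrightarrow> inv s \<in> letters"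
  using T by (auto simp: letters_def subset_iff)

lemma ev_simps [simp]: "ev [] = \<one>" "ev (s # p) = s \<otimes> ev p"
  by (simp_all add: ev_def)

lemma ev_closed: "p \<in> lists letters \<Longrightarrow> ev p \<in> carrier \<Lambda>"
  by (induction p) (auto simp: letters_closed)

lemma ev_append:
  "\<lbrakk>p \<in> lists letters; q \<in> lists letters\<rbrakk> \<Longrightarrow> ev (p @ q) = ev p \<otimes> ev q"
  by (induction p) (auto simp: letters_closed ev_closed m_assoc)

lemma word_inv_closed: "p \<in> lists letters \<Longrightarrow> word_inv p \<in> lists letters"
  by (auto simp: word_inv_def inv_letters in_lists_conv_set)

lemma length_word_inv [simp]: "length (word_inv p) = length p"
  by (simp add: word_inv_def)

lemma ev_word_inv: "p \<in> lists letters \<Longrightarrow> ev (word_inv p) = inv (ev p)"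
proof (induction p)
  case (Cons s p)
  then have "ev (word_inv p @ [inv s]) = ev (word_inv p) \<otimes> ev [inv s]"
    by (intro ev_append) (auto simp: word_inv_closed inv_letters)
  with Cons show ?case by (simp add: word_inv_def letters_closed ev_closed inv_mult_group)
qed (simp add: word_inv_def)

lemma ev_surj:
  assumes "a \<in> carrier \<Lambda>"
  shows "\<exists>p\<in>lists letters. ev p = a"
proof -
  have "a \<in> generate \<Lambda> T" using assms gen by simp
  then show ?thesis
  proof (induction rule: generate.induct)
    case one
    show ?case by (intro bexI[of _ "[]"]) auto
  next
    case (incl h)
    then show ?case using T by (intro bexI[of _ "[h]"]) (auto simp: letters_def)
  next
    case (inv h)
    then show ?case using T by (intro bexI[of _ "[inv h]"]) (auto simp: letters_def subset_iff)
  next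
    case (eng h1 h2)
    then obtain p1 p2 where "p1 \<in> lists letters" "ev p1 = h1" "p2 \<in> lists letters" "ev p2 = h2" by blast
    then show ?case by (intro bexI[of _ "p1 @ p2"]) (auto simp: ev_append)
  qed
qed

lemma finite_short_words: "finite T \<Longrightarrow> finite {p \<in> lists letters. length p \<le> n}"
  using finite_lists_length_le[of letters n] by (simp add: letters_def lists_eq_set)

text \<open>The quotient of the words by \<open>weq r\<close> is a group without free reduction, because cancellation is
  itself a relation of length 2. That \<open>\<Lambda>\<close> is presented by its relations of length at most \<open>r\<close> reads
  \<open>ev p = \<one> \<Longrightarrow> weq r p []\<close>.\<close>

inductive weq :: "nat \<Rightarrow> 'b list \<Rightarrow> 'b list \<Rightarrow> bool" for r where
  relation: "\<lbrakk>u \<in> lists letters; p \<in> lists letters; q \<in> lists letters; v \<in> lists letters;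
    length p + length q \<le> r; ev p = ev q\<rbrakk> \<Longrightarrow> weq r (u @ p @ v) (u @ q @ v)"
| trans: "\<lbrakk>weq r p q; weq r q s\<rbrakk> \<Longrightarrow> weq r p s"

lemma weq_refl: "p \<in> lists letters \<Longrightarrow> weq r p p"
  using weq.relation[of p "[]" "[]" "[]" r] by simp

lemma weq_sym: "weq r p q \<Longrightarrow> weq r q p"
proof (induction rule: weq.induct)
  case (relation u p q v)
  then show ?case using weq.relation[of u q p v r] by (simp add: add.commute)
qed (rule weq.trans)

lemma weq_lists: "weq r p q \<Longrightarrow> p \<in> lists letters \<and> q \<in> lists letters"
  by (induction rule: weq.induct) auto

lemma weq_append_right: "\<lbrakk>weq r p q; w \<in> lists letters\<rbrakk> \<Longrightarrow> weq r (p @ w) (q @ w)"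
proof (induction rule: weq.induct)
  case (relation u p q v)
  then show ?case using weq.relation[of u p q "v @ w" r] by simp
qed (rule weq.trans)

lemma weq_append_left: "\<lbrakk>weq r p q; w \<in> lists letters\<rbrakk> \<Longrightarrow> weq r (w @ p) (w @ q)"
proof (induction rule: weq.induct)
  case (relation u p q v)
  then show ?case using weq.relation[of "w @ u" p q v r] by simp
qed (rule weq.trans)

lemma weq_append: "\<lbrakk>weq r p p'; weq r q q'\<rbrakk> \<Longrightarrow> weq r (p @ q) (p' @ q')"
  using weq_append_right[of r p p' q] weq_append_left[of r q q' p'] weq_lists weq.trans by metis

lemma weq_cancel: "p \<in> lists letters \<Longrightarrow> r \<ge> 2 \<Longrightarrow> weq r (word_inv p @ p) []"
proof (induction p)
  case (Cons s p)
  then have *: "word_inv p \<in> lists letters" "s \<in> letters" "p \<in> lists letters" by (auto simp: word_inv_closed)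
  have "weq r (word_inv p @ [inv s, s] @ p) (word_inv p @ [] @ p)"
    using Cons.prems * by (intro weq.relation) (auto simp: inv_letters letters_closed)
  with Cons * show ?case using weq.trans by (simp add: word_inv_def)
qed (simp add: weq_refl word_inv_def)

definition wclass :: "nat \<Rightarrow> 'b list \<Rightarrow> 'b list set" where
  "wclass r p = {q. weq r p q}"

lemma wclass_eq_iff: "p \<in> lists letters \<Longrightarrow> wclass r p = wclass r q \<longleftrightarrow> weq r p q"
  unfolding wclass_def using weq_refl weq_sym weq.trans by blast

definition presented :: "nat \<Rightarrow> 'b list set monoid" where
  "presented r = \<lparr>carrier = wclass r ` lists letters,
     mult = (\<lambda>A B. \<Union>p\<in>A. \<Union>q\<in>B. wclass r (p @ q)), one = wclass r []\<rparr>"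

lemma presented_mult:
  assumes "p \<in> lists letters" "q \<in> lists letters"
  shows "wclass r p \<otimes>\<^bsub>presented r\<^esub> wclass r q = wclass r (p @ q)"
proof -
  have "wclass r (p' @ q') = wclass r (p @ q)" if "p' \<in> wclass r p" "q' \<in> wclass r q" for p' q'
    using that assms weq_append[of r p p' q q'] by (subst eq_commute, subst wclass_eq_iff) (auto simp: wclass_def)
  then have "wclass r p \<otimes>\<^bsub>presented r\<^esub> wclass r q = (\<Union>p'\<in>wclass r p. \<Union>q'\<in>wclass r q. wclass r (p @ q))"
    unfolding presented_def by (simp del: UN_constant UN_simps cong: SUP_cong)
  moreover have "wclass r p \<noteq> {}" "wclass r q \<noteq> {}"
    using assms weq_refl by (auto simp: wclass_def)
  ultimately show ?thesis by simp
qed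

lemma presented_simps:
  "carrier (presented r) = wclass r ` lists letters" "\<one>\<^bsub>presented r\<^esub> = wclass r []"
  by (simp_all add: presented_def)

lemma group_presented:
  assumes "r \<ge> 2"
  shows "group (presented r)"
proof (rule groupI)
  show "x \<otimes>\<^bsub>presented r\<^esub> y \<in> carrier (presented r)"
    if "x \<in> carrier (presented r)" "y \<in> carrier (presented r)" for x y
  proof -
    from that obtain p q where "x = wclass r p" "y = wclass r q" "p \<in> lists letters" "q \<in> lists letters"
      unfolding presented_simps by blast
    then show ?thesis by (simp add: presented_simps presented_mult del: in_lists_conv_set)
  qed
  show "x \<otimes>\<^bsub>presented r\<^esub> y \<otimes>\<^bsub>presented r\<^esub> z = x \<otimes>\<^bsub>presented r\<^esub> (y \<otimes>\<^bsub>presented r\<^esub> z)"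
    if "x \<in> carrier (presented r)" "y \<in> carrier (presented r)" "z \<in> carrier (presented r)" for x y z
  proof -
    from that obtain p q s where "x = wclass r p" "y = wclass r q" "z = wclass r s"
      "p \<in> lists letters" "q \<in> lists letters" "s \<in> lists letters"
      unfolding presented_simps by blast
    then show ?thesis by (simp add: presented_mult)
  qed
  show "\<exists>y\<in>carrier (presented r). y \<otimes>\<^bsub>presented r\<^esub> x = \<one>\<^bsub>presented r\<^esub>"
    if x: "x \<in> carrier (presented r)" for x
  proof -
    obtain p where p: "x = wclass r p" "p \<in> lists letters" using x by (auto simp: presented_simps)
    then have "wclass r (word_inv p) \<otimes>\<^bsub>presented r\<^esub> x = wclass r []"
      using weq_cancel[OF p(2) assms] word_inv_closed[OF p(2)] by (simp add: presented_mult wclass_eq_iff)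
    with p show ?thesis using word_inv_closed[OF p(2)] by (auto simp: presented_simps)
  qed
  show "\<one>\<^bsub>presented r\<^esub> \<otimes>\<^bsub>presented r\<^esub> x = x" if "x \<in> carrier (presented r)" for x
  proof -
    from that obtain p where "x = wclass r p" "p \<in> lists letters"
      unfolding presented_simps by blast
    then show ?thesis using presented_mult[of "[]" p r] by (simp add: presented_simps)
  qed
qed (simp add: presented_simps)

end

section \<open>Cayley graphs of finite quotients\<close>

locale generated_quotient = generated_group \<Lambda> T + N: normal N \<Lambda>
  for \<Lambda> :: "('b, 'm) monoid_scheme" (structure) and T N
begin

abbreviation "V \<equiv> carrier (\<Lambda> Mod N)"
abbreviation "cayley \<equiv> cayley_metric (\<Lambda> Mod N) ((\<lambda>s. N #> s) ` T)"

lemma V_E: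
  assumes "v \<in> V"
  obtains x where "x \<in> carrier \<Lambda>" "v = N #> x"
  using assms by (auto simp: carrier_FactGroup)

lemma V_I: "x \<in> carrier \<Lambda> \<Longrightarrow> N #> x \<in> V"
  by (auto simp: carrier_FactGroup)

lemma V_coset_mult: "\<lbrakk>v \<in> V; a \<in> carrier \<Lambda>; b \<in> carrier \<Lambda>\<rbrakk> \<Longrightarrow> (v #> a) #> b = v #> (a \<otimes> b)"
  by (elim V_E) (simp add: coset_mult_assoc N.subset m_assoc)

lemma V_closed: "\<lbrakk>v \<in> V; a \<in> carrier \<Lambda>\<rbrakk> \<Longrightarrow> v #> a \<in> V"
  by (elim V_E) (simp add: coset_mult_assoc N.subset V_I)

lemma V_one: "v \<in> V \<Longrightarrow> v #> \<one> = v"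
  by (elim V_E) (simp add: coset_mult_assoc N.subset)

text \<open>Since \<open>N\<close> is normal, all vertices have the same stabiliser; whether two
  words lead to the same vertex does not depend on the starting vertex.\<close>

lemma V_stabilizer:
  assumes "v \<in> V" "a \<in> carrier \<Lambda>" "b \<in> carrier \<Lambda>"
  shows "v #> a = v #> b \<longleftrightarrow> a \<otimes> inv b \<in> N"
proof -
  obtain x where x: "x \<in> carrier \<Lambda>" "v = N #> x" using assms(1) by (rule V_E)
  have "v #> a = v #> b \<longleftrightarrow> N #> (x \<otimes> a) = N #> (x \<otimes> b)"
    using x assms by (simp add: coset_mult_assoc N.subset)
  also have "\<dots> \<longleftrightarrow> (x \<otimes> a) \<otimes> inv (x \<otimes> b) \<in> N"
    using x assms N.rcos_module_imp[of "x \<otimes> b" "x \<otimes> a"] N.rcos_module_rev[of "x \<otimes> b" "x \<otimes> a"]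
      N.is_subgroup rcos_self[of "x \<otimes> a" N] repr_independence[of "x \<otimes> a" N "x \<otimes> b"] is_group
    by (metis m_closed)
  also have "(x \<otimes> a) \<otimes> inv (x \<otimes> b) = x \<otimes> (a \<otimes> inv b) \<otimes> inv x"
    using x assms by (simp add: inv_mult_group m_assoc)
  also have "\<dots> \<in> N \<longleftrightarrow> a \<otimes> inv b \<in> N"
  proof
    assume *: "x \<otimes> (a \<otimes> inv b) \<otimes> inv x \<in> N"
    have "inv x \<otimes> (x \<otimes> (a \<otimes> inv b) \<otimes> inv x) \<otimes> x = a \<otimes> inv b"
      using x assms by (simp add: m_assoc) (simp add: m_assoc[symmetric])
    with N.inv_op_closed1[OF x(1) *] show "a \<otimes> inv b \<in> N" by simp
  qed (use N.inv_op_closed2[OF x(1)] in auto)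
  finally show ?thesis .
qed

lemma coset_product: "\<lbrakk>v \<in> V; s \<in> carrier \<Lambda>\<rbrakk> \<Longrightarrow> v <#> (N #> s) = v #> s"
  by (elim V_E) (simp add: N.rcos_sum coset_mult_assoc N.subset)

definition "edges = cayley_edges (\<Lambda> Mod N) ((\<lambda>s. N #> s) ` T) \<union> (cayley_edges (\<Lambda> Mod N) ((\<lambda>s. N #> s) ` T))\<inverse>"

lemma edges_iff: "(v, u) \<in> edges \<longleftrightarrow> v \<in> V \<and> (\<exists>s\<in>letters. u = v #> s)"
proof -
  have 1: "(v, u) \<in> cayley_edges (\<Lambda> Mod N) ((\<lambda>s. N #> s) ` T) \<longleftrightarrow> v \<in> V \<and> (\<exists>s\<in>T. u = v #> s)" for v u
  proof -
    have "v <#> (N #> s) = v #> s" if "v \<in> V" "s \<in> T" for s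
      using coset_product[OF that(1)] that(2) T by (simp add: subset_iff)
    then have "(\<exists>s\<in>T. u = v <#> (N #> s)) \<longleftrightarrow> (\<exists>s\<in>T. u = v #> s)" if "v \<in> V"
      using that by auto
    moreover have "(v, u) \<in> cayley_edges (\<Lambda> Mod N) ((\<lambda>s. N #> s) ` T) \<longleftrightarrow>
        v \<in> V \<and> (\<exists>s\<in>T. u = v <#> (N #> s))"
      by (auto simp: cayley_edges_def)
    ultimately show ?thesis by blast
  qed
  have 2: "(u \<in> V \<and> (\<exists>s\<in>T. v = u #> s)) \<longleftrightarrow> v \<in> V \<and> (\<exists>s\<in>T. u = v #> inv s)"
  proof -
    have "v = u #> s \<longleftrightarrow> u = v #> inv s" if "u \<in> V" "v \<in> V" "s \<in> T" for s
    proof -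
      have "s \<in> carrier \<Lambda>" using that T by auto
      then show ?thesis using that by (auto simp: V_coset_mult V_one)
    qed
    moreover have "v \<in> V" if "u \<in> V" "s \<in> T" "v = u #> s" for s
      using that T by (auto simp: V_closed)
    moreover have "u \<in> V" if "v \<in> V" "s \<in> T" "u = v #> inv s" for s
      using that T by (auto simp: V_closed)
    ultimately show ?thesis by metis
  qed
  show ?thesis
    unfolding edges_def Un_iff converse_iff 1 2 by (auto simp: letters_def)
qed

lemma relpow_edges_iff:
  assumes "v \<in> V"
  shows "(v, u) \<in> edges ^^ n \<longleftrightarrow> (\<exists>p\<in>lists letters. length p = n \<and> u = v #> ev p)"
proof (induction n arbitrary: u)
  case 0
  then show ?case using assms by (auto simp: V_one)
next
  case (Suc n)
  show ?case
  proof
    assume "(v, u) \<in> edges ^^ Suc n"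
    then obtain w where "(v, w) \<in> edges ^^ n" "(w, u) \<in> edges" by auto
    with Suc obtain p s where "p \<in> lists letters" "length p = n" "w = v #> ev p" "s \<in> letters" "u = w #> s"
      by (auto simp: edges_iff)
    then show "\<exists>p\<in>lists letters. length p = Suc n \<and> u = v #> ev p"
      using assms by (intro bexI[of _ "p @ [s]"])
        (auto simp: ev_append letters_closed ev_closed V_coset_mult)
  next
    assume "\<exists>p\<in>lists letters. length p = Suc n \<and> u = v #> ev p"
    then obtain p where p: "p \<in> lists letters" "length p = Suc n" "u = v #> ev p" by blast
    then obtain q s where q: "p = q @ [s]" by (metis length_Suc_conv_rev)
    with p have *: "q \<in> lists letters" "s \<in> letters" "length q = n" by auto
    then have "(v, v #> ev q) \<in> edges ^^ n" using Suc by blast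
    moreover have "(v #> ev q, u) \<in> edges"
      using * p q assms by (auto simp: edges_iff ev_append letters_closed ev_closed V_coset_mult V_closed)
    ultimately show "(v, u) \<in> edges ^^ Suc n" by auto
  qed
qed

lemma generate_quotient: "generate (\<Lambda> Mod N) ((\<lambda>s. N #> s) ` T) = V"
proof -
  interpret h: group_hom \<Lambda> "\<Lambda> Mod N" "\<lambda>s. N #> s"
    using N.r_coset_hom_Mod N.factorgroup_is_group
    by (simp add: group_hom_def group_hom_axioms_def group_axioms)
  show ?thesis using h.generate_img[OF T] gen by (simp add: carrier_FactGroup)
qed

lemma cayley_simps: "mspace cayley = V" "mdist cayley = cayley_dist (\<Lambda> Mod N) ((\<lambda>s. N #> s) ` T)"
proof -
  interpret Metric_space V "cayley_dist (\<Lambda> Mod N) ((\<lambda>s. N #> s) ` T)"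
    using T by (intro Metric_space_cayley_dist N.factorgroup_is_group generate_quotient) (auto intro: V_I)
  show "mspace cayley = V" "mdist cayley = cayley_dist (\<Lambda> Mod N) ((\<lambda>s. N #> s) ` T)"
    unfolding cayley_metric_def by (simp_all add: mspace_metric mdist_metric)
qed

lemma mdist_cayley_word:
  assumes "v \<in> V" "p \<in> lists letters"
  shows "mdist cayley v (v #> ev p) \<le> length p"
proof -
  have "(v, v #> ev p) \<in> edges ^^ length p" using assms relpow_edges_iff by blast
  then show ?thesis unfolding cayley_simps cayley_dist_def edges_def by (simp add: Least_le)
qed

lemma word_of_mdist_cayley:
  assumes "v \<in> V" "u \<in> V"
  shows "\<exists>p\<in>lists letters. v #> ev p = u \<and> real (length p) = mdist cayley v u"
proof -
  obtain x y where "x \<in> carrier \<Lambda>" "v = N #> x" "y \<in> carrier \<Lambda>" "u = N #> y"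
    using assms by (metis V_E)
  then have "v #> (inv x \<otimes> y) = u" "inv x \<otimes> y \<in> carrier \<Lambda>"
    by (simp_all add: coset_mult_assoc N.subset m_assoc[symmetric])
  moreover from ev_surj[OF this(2)] obtain q where "q \<in> lists letters" "ev q = inv x \<otimes> y" by blast
  ultimately have "q \<in> lists letters" "v #> ev q = u" by simp_all
  then have "(v, u) \<in> edges ^^ length q" using relpow_edges_iff[OF assms(1)] by blast
  then have "(v, u) \<in> edges ^^ (LEAST n. (v, u) \<in> edges ^^ n)" by (rule LeastI)
  then obtain p where "p \<in> lists letters" "length p = (LEAST n. (v, u) \<in> edges ^^ n)" "u = v #> ev p"
    using relpow_edges_iff[OF assms(1)] by blast
  then show ?thesis unfolding cayley_simps cayley_dist_def edges_def by auto
qed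

end

section \<open>Comparing the two groups through a coarse equivalence\<close>

lemma (in group) conj_eq_one:
  assumes "a \<otimes> (b \<otimes> inv a) = \<one>" "a \<in> carrier G" "b \<in> carrier G"
  shows "b = \<one>"
proof -
  have "(b \<otimes> inv a) \<otimes> a = \<one>"
    by (rule inv_comm[OF assms(1)]) (simp_all add: assms)
  then have "inv a = b \<otimes> inv a"
    by (rule inv_equality) (simp_all add: assms)
  then show ?thesis using assms right_cancel[of "inv a" b \<one>] by simp
qed

text \<open>The coarse equivalence is \<open>g\<close>, from the vertices of the Cayley graph to \<open>X\<close>, with quasi-inverse
  \<open>f\<close>. Edges have length at most \<open>C\<close> in \<open>X\<close>; the local cocycle is defined at distances up to \<open>P\<close>, where
  it takes words of length at most \<open>R\<close>; \<open>Rq\<close> bounds the displacement of \<open>f \<circ> g\<close>; words of length at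
  most \<open>r\<close> inject into the quotient; points at distance at most \<open>C\<close> are joined by \<open>M1\<close> small steps,
  and loops of \<open>M\<close> small steps are trivial.\<close>

locale comparison = warped_paths S x0 \<alpha> + generated_quotient \<Lambda> T Nk
  for S :: "('a::metric_space \<Rightarrow> 'a) set" and x0 :: 'a and \<alpha> :: "('a \<Rightarrow> 'a) \<Rightarrow> real \<Rightarrow> 'a"
    and \<Lambda> :: "('b, 'm) monoid_scheme" (structure) and T Nk +
  fixes \<rho> :: "'a \<Rightarrow> 'a \<Rightarrow> real" and t :: real and g :: "'b set \<Rightarrow> 'a" and f :: "'a \<Rightarrow> 'b set"
    and P C :: real and R Rq r M1 M \<theta> :: nat
  assumes metric: "Metric_space UNIV \<rho>"
    and t_pos: "t > 0" and \<rho>_dist: "\<rho> x y \<le> t * dist x y"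
    and \<rho>_jump: "fst a \<in> S \<Longrightarrow> \<rho> (letter_map a x) x \<le> 1"
    and P_bounds: "P \<ge> 3" "real (4 * \<theta>) \<le> P" "real M1 * C \<le> P" and C: "1 \<le> C" and M1: "1 \<le> M1"
    and f_V: "f x \<in> V"
    and g_step: "\<lbrakk>v \<in> V; s \<in> letters\<rbrakk> \<Longrightarrow> \<rho> (g v) (g (v #> s)) \<le> C"
    and gf: "\<rho> x (g (f x)) \<le> C"
    and f_word: "\<rho> x y \<le> P \<Longrightarrow> \<exists>p\<in>lists letters. length p \<le> R \<and> f x #> ev p = f y"
    and fg_word: "v \<in> V \<Longrightarrow> \<exists>p\<in>lists letters. length p \<le> Rq \<and> v #> ev p = f (g v)"
    and inj: "\<lbrakk>p \<in> lists letters; length p \<le> r; ev p \<in> Nk\<rbrakk> \<Longrightarrow> ev p = \<one>"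
    and r: "3 * R \<le> r" "R + 2 * Rq + 1 \<le> r"
    and small_ex: "\<rho> x y \<le> C \<Longrightarrow> \<exists>h. small (C / t) M1 x h y"
    and small_trivial: "\<lbrakk>small (C / t) M x h x; path q; pathstart q = x0; pathfinish q = x\<rbrakk> \<Longrightarrow>
      (path_class q, []) \<star> h \<star> jinv (path_class q, []) \<in> \<Psi> ` N \<theta>"
    and connected: "\<exists>q. path q \<and> pathstart q = x0 \<and> pathfinish q = x"
begin

text \<open>Realises an edge of the Cayley graph in the groupoid. Any choice will do: two small
  morphisms with the same end points agree modulo \<open>D\<close> by \<open>hol_unique\<close> and
  have the same development by \<open>Phi_small\<close>.\<close>

definition em :: "'b set \<Rightarrow> 'b \<Rightarrow> 'a jelem" where
  "em v s = (SOME h. small (C / t) M1 (g v) h (g (v #> s)))"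

primrec gpath :: "'b list \<Rightarrow> 'b set \<Rightarrow> 'a jelem" where
  "gpath [] = (\<lambda>v. jone (g v))"
| "gpath (s # p) = (\<lambda>v. em v s \<star> gpath p (v #> s))"

text \<open>A correction term: \<open>f \<circ> g\<close> is not the identity on vertices, and
  \<open>uw v\<close> is a short word measuring the difference at \<open>v\<close>.\<close>

definition uw :: "'b set \<Rightarrow> 'b list" where
  "uw v = (SOME p. p \<in> lists letters \<and> length p \<le> Rq \<and> v #> ev p = f (g v))"

lemma em_small: "\<lbrakk>v \<in> V; s \<in> letters\<rbrakk> \<Longrightarrow> small (C / t) M1 (g v) (em v s) (g (v #> s))"
  unfolding em_def using small_ex[OF g_step] by (rule someI_ex)

lemma uw:
  assumes "v \<in> V"
  shows "uw v \<in> lists letters" "length (uw v) \<le> Rq" "v #> ev (uw v) = f (g v)"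
  using someI_ex[of "\<lambda>p. p \<in> lists letters \<and> length p \<le> Rq \<and> v #> ev p = f (g v)"] fg_word[OF assms]
  unfolding uw_def by blast+

lemma V_ev_closed: "\<lbrakk>v \<in> V; p \<in> lists letters\<rbrakk> \<Longrightarrow> v #> ev p \<in> V"
  by (simp add: V_closed ev_closed)

lemma V_ev_append:
  "\<lbrakk>v \<in> V; p \<in> lists letters; q \<in> lists letters\<rbrakk> \<Longrightarrow> v #> ev (p @ q) = (v #> ev p) #> ev q"
  by (simp add: ev_append V_coset_mult ev_closed)

lemma V_ev_Cons:
  "\<lbrakk>v \<in> V; s \<in> letters; p \<in> lists letters\<rbrakk> \<Longrightarrow> v #> ev (s # p) = (v #> s) #> ev p"
  by (simp add: V_coset_mult ev_closed letters_closed)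

lemma gpath_small:
  "\<lbrakk>p \<in> lists letters; v \<in> V\<rbrakk> \<Longrightarrow> small (C / t) (length p * M1) (g v) (gpath p v) (g (v #> ev p))"
proof (induction p arbitrary: v)
  case (Cons s p)
  then have s: "s \<in> letters" "p \<in> lists letters" "v #> s \<in> V" by (auto simp: V_closed letters_closed)
  from small_mult[OF em_small[OF Cons.prems(2) s(1)] Cons.IH[OF s(2,3)]] show ?case
    using Cons.prems(2) s V_ev_Cons[OF Cons.prems(2) s(1,2)] by simp
qed (simp add: V_one small.unit)

lemma gpath_J: "\<lbrakk>p \<in> lists letters; v \<in> V\<rbrakk> \<Longrightarrow> gpath p v \<in> J (g v) (g (v #> ev p))"
  using gpath_small small_in_J by blast

lemma gpath_append:
  "\<lbrakk>p \<in> lists letters; q \<in> lists letters; v \<in> V\<rbrakk> \<Longrightarrow> gpath (p @ q) v = gpath p v \<star> gpath q (v #> ev p)"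
proof (induction p arbitrary: v)
  case Nil
  then show ?case using jone_left[OF gpath_J[of q v]] by (simp add: V_one)
next
  case (Cons s p)
  then have s: "s \<in> letters" "p \<in> lists letters" "v #> s \<in> V" by (auto simp: V_closed letters_closed)
  have "(em v s \<star> gpath p (v #> s)) \<star> gpath q ((v #> s) #> ev p) =
      em v s \<star> gpath p (v #> s) \<star> gpath q ((v #> s) #> ev p)"
    using s Cons.prems
    by (intro jmult_assoc[OF small_in_J[OF em_small] gpath_J gpath_J] V_ev_closed)
  with Cons.IH[OF s(2) Cons.prems(2) s(3)] show ?case
    using V_ev_Cons[OF Cons.prems(3) s(1,2)] by simp
qed

end

text \<open>\<open>U\<close> and \<open>rep\<close> stay abstract because of the two uses:
  \<open>presented r\<close> with \<open>wclass r\<close>, before anything is known about the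
  relations of \<open>\<Lambda>\<close>, and \<open>\<Lambda>\<close> with \<open>ev\<close> for the
  final isomorphism. Only relations of total length at most \<open>r\<close> may be assumed in the
  first case.\<close>

locale comparison_rep = comparison S x0 \<alpha> \<Lambda> T Nk \<rho> t g f P C R Rq r M1 M \<theta> + U: group U
  for S :: "('a::metric_space \<Rightarrow> 'a) set" and x0 :: 'a and \<alpha> :: "('a \<Rightarrow> 'a) \<Rightarrow> real \<Rightarrow> 'a"
    and \<Lambda> :: "('b, 'm) monoid_scheme" (structure) and T Nk \<rho> t g f P C R Rq r M1 M \<theta>
    and U :: "('u, 'k) monoid_scheme" +
  fixes rep :: "'b list \<Rightarrow> 'u"
  assumes rep_closed: "p \<in> lists letters \<Longrightarrow> rep p \<in> carrier U"
    and rep_append: "\<lbrakk>p \<in> lists letters; q \<in> lists letters\<rbrakk> \<Longrightarrow> rep (p @ q) = rep p \<otimes>\<^bsub>U\<^esub> rep q"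
    and rep_relation: "\<lbrakk>p \<in> lists letters; q \<in> lists letters; length p + length q \<le> r; ev p = ev q\<rbrakk>
      \<Longrightarrow> rep p = rep q"
begin

lemma rep_Nil: "rep [] = \<one>\<^bsub>U\<^esub>"
  using rep_append[of "[]" "[]"] rep_closed[of "[]"] by simp

definition c :: "'a \<Rightarrow> 'a \<Rightarrow> 'u" where
  "c x y = rep (SOME p. p \<in> lists letters \<and> length p \<le> R \<and> f x #> ev p = f y)"

text \<open>Two words between the same vertices differ by an element of \<open>Nk\<close>. Their
  total length is at most \<open>r\<close>, so \<open>inj\<close> makes this element trivial in
  \<open>\<Lambda>\<close> and \<open>rep_relation\<close> gives equal values in \<open>U\<close>.
  Thus any word of length up to \<open>r - R\<close> computes \<open>c\<close>.\<close>

lemma c_eq: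
  assumes "\<rho> x y \<le> P" and p: "p \<in> lists letters" "R + length p \<le> r" "f x #> ev p = f y"
  shows "c x y = rep p"
proof -
  define q where "q = (SOME p. p \<in> lists letters \<and> length p \<le> R \<and> f x #> ev p = f y)"
  have q: "q \<in> lists letters" "length q \<le> R" "f x #> ev q = f y"
    using someI_ex[of "\<lambda>p. p \<in> lists letters \<and> length p \<le> R \<and> f x #> ev p = f y"] f_word[OF assms(1)]
    unfolding q_def by blast+
  have "ev q \<otimes> inv (ev p) \<in> Nk"
    using V_stabilizer[OF f_V[of x], of "ev q" "ev p"] p q by (simp add: ev_closed)
  then have "ev (q @ word_inv p) \<in> Nk"
    using p q by (simp add: ev_append word_inv_closed ev_word_inv)
  then have "ev (q @ word_inv p) = \<one>"
    using p q word_inv_closed[OF p(1)] by (intro inj) auto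
  then have "ev q \<otimes> inv (ev p) = \<one>"
    using p q by (simp add: ev_append word_inv_closed ev_word_inv)
  then have "ev q = ev p"
    using ev_closed[OF p(1)] ev_closed[OF q(1)] by (metis inv_equality inv_inv inv_closed)
  then have "rep q = rep p"
    using p q by (intro rep_relation) auto
  then show ?thesis by (simp add: c_def q_def)
qed

sublocale local_cocycle S x0 \<alpha> U \<rho> t P c
proof (intro local_cocycle.intro local_cocycle_axioms.intro)
  show "c x y \<in> carrier U" if xy: "\<rho> x y \<le> P" for x y
  proof -
    obtain p where p: "p \<in> lists letters" "length p \<le> R" "f x #> ev p = f y" using f_word[OF xy] by blast
    then show ?thesis using c_eq[OF xy, of p] r(1) by (simp add: rep_closed del: in_lists_conv_set)
  qed
  show "c x y \<otimes>\<^bsub>U\<^esub> c y z = c x z" if xy: "\<rho> x y \<le> P" and yz: "\<rho> y z \<le> P" and xz: "\<rho> x z \<le> P" for x y z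
  proof -
    obtain p where p: "p \<in> lists letters" "length p \<le> R" "f x #> ev p = f y" using f_word[OF xy] by blast
    obtain q where q: "q \<in> lists letters" "length q \<le> R" "f y #> ev q = f z" using f_word[OF yz] by blast
    have pq: "p @ q \<in> lists letters" using p q by simp
    \<comment> \<open>Around a triangle the concatenation has length at most 2 * R and is compared
      with a word of length at most \<open>R\<close>, whence the requirement 3 * R \<le> r.\<close>
    have "c x y = rep p" "c y z = rep q" "c x z = rep (p @ q)"
      using p q r(1) pq c_eq[OF xy, of p] c_eq[OF yz, of q] c_eq[OF xz, of "p @ q"] f_V[of x]
      by (simp_all add: V_ev_append del: in_lists_conv_set)
    then show ?thesis using p q by (simp add: rep_append)
  qed
qed (fact warped_paths_axioms U.group_axioms metric t_pos \<rho>_dist \<rho>_jump P_bounds(1))+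

lemma Phi_small_unit:
  assumes "small (C / t) M1 x h y"
  shows "Phi h = c x y" "\<rho> x y \<le> P"
  using Phi_small[OF assms, of C] C P_bounds(3) t_pos by auto

lemma rep_cancel:
  assumes "p \<in> lists letters" "2 * length p \<le> r"
  shows "rep (word_inv p) \<otimes>\<^bsub>U\<^esub> rep p = \<one>\<^bsub>U\<^esub>" "rep p \<otimes>\<^bsub>U\<^esub> rep (word_inv p) = \<one>\<^bsub>U\<^esub>"
proof -
  note inv_p = word_inv_closed[OF assms(1)]
  have "ev (word_inv p @ p) = ev []" "ev (p @ word_inv p) = ev []"
    using assms(1) inv_p by (simp_all add: ev_append ev_word_inv ev_closed del: in_lists_conv_set)
  then have "rep (word_inv p @ p) = rep []" "rep (p @ word_inv p) = rep []"
    using assms inv_p by (intro rep_relation; simp del: in_lists_conv_set)+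
  then show "rep (word_inv p) \<otimes>\<^bsub>U\<^esub> rep p = \<one>\<^bsub>U\<^esub>" "rep p \<otimes>\<^bsub>U\<^esub> rep (word_inv p) = \<one>\<^bsub>U\<^esub>"
    using assms word_inv_closed[OF assms(1)] by (simp_all add: rep_append rep_Nil)
qed

text \<open>An edge develops to \<open>c\<close> between its end points, and \<open>c\<close> may be
  read off the detour back along \<open>uw v\<close>, across \<open>s\<close>, and out along
  \<open>uw (v #> s)\<close>. Its length, at most 2 * Rq + 1, is within the range of
  \<open>c_eq\<close>.\<close>

lemma Phi_em:
  assumes v: "v \<in> V" "s \<in> letters"
  shows "Phi (em v s) = rep (word_inv (uw v)) \<otimes>\<^bsub>U\<^esub> (rep [s] \<otimes>\<^bsub>U\<^esub> rep (uw (v #> s)))"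
proof -
  let ?p = "word_inv (uw v) @ [s] @ uw (v #> s)"
  have vs: "v #> s \<in> V" using v by (simp add: V_closed letters_closed)
  note u = uw[OF v(1)] uw[OF vs]
  have p: "?p \<in> lists letters" using u v word_inv_closed by simp
  have "f (g v) #> ev ?p = (v #> ev (uw v)) #> (inv (ev (uw v)) \<otimes> (s \<otimes> ev (uw (v #> s))))"
    using u v word_inv_closed[OF u(1)] by (simp add: ev_append ev_word_inv)
  also have "\<dots> = v #> (ev (uw v) \<otimes> (inv (ev (uw v)) \<otimes> (s \<otimes> ev (uw (v #> s)))))"
    using u v by (intro V_coset_mult) (auto simp: ev_closed letters_closed)
  also have "ev (uw v) \<otimes> (inv (ev (uw v)) \<otimes> (s \<otimes> ev (uw (v #> s)))) = s \<otimes> ev (uw (v #> s))"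
    using u v by (simp add: ev_closed letters_closed m_assoc[symmetric])
  also have "v #> \<dots> = f (g (v #> s))"
    using u v by (simp add: V_coset_mult[symmetric] ev_closed letters_closed)
  finally have end_p: "f (g v) #> ev ?p = f (g (v #> s))" .
  have "R + length ?p \<le> r" using u r(2) by simp
  with c_eq[OF Phi_small_unit(2)[OF em_small[OF v]] p _ end_p] Phi_small_unit(1)[OF em_small[OF v]]
  have "Phi (em v s) = rep ?p" by simp
  then show ?thesis
    using u v word_inv_closed[OF u(1)] rep_append[of "[s]" "uw (v #> s)"]
      rep_append[of "word_inv (uw v)" "[s] @ uw (v #> s)"] by simp
qed

text \<open>The corrections at intermediate vertices cancel in pairs and those at the two ends
  remain, so a closed word develops to a conjugate of its value under \<open>rep\<close>.\<close>

lemma Phi_gpath: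
  "\<lbrakk>p \<in> lists letters; v \<in> V\<rbrakk> \<Longrightarrow>
    Phi (gpath p v) = rep (word_inv (uw v)) \<otimes>\<^bsub>U\<^esub> (rep p \<otimes>\<^bsub>U\<^esub> rep (uw (v #> ev p)))"
proof (induction p arbitrary: v)
  case Nil
  have "2 * length (uw v) \<le> r" using uw(2)[OF Nil(2)] r(2) by linarith
  then show ?case
    using rep_cancel(1)[OF uw(1)[OF Nil(2)]] uw(1)[OF Nil(2)] Nil
    by (simp add: V_one Phi_jone rep_Nil rep_closed del: in_lists_conv_set)
next
  case (Cons s p)
  let ?w = "v #> s"
  have s: "s \<in> letters" "p \<in> lists letters" "?w \<in> V" using Cons.prems by (auto simp: V_closed letters_closed)
  have z: "?w #> ev p \<in> V" using s by (simp add: V_ev_closed)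
  note u = uw[OF Cons.prems(2)] uw[OF s(3)] uw[OF z]
  have wu: "word_inv (uw v) \<in> lists letters" "word_inv (uw ?w) \<in> lists letters" "[s] \<in> lists letters"
    using u s word_inv_closed by auto
  have mem: "rep (word_inv (uw v)) \<in> carrier U" "rep (word_inv (uw ?w)) \<in> carrier U" "rep [s] \<in> carrier U"
    "rep p \<in> carrier U" "rep (uw ?w) \<in> carrier U" "rep (uw (?w #> ev p)) \<in> carrier U"
    by (rule rep_closed, fact)+
  have "2 * length (uw ?w) \<le> r" using u(5) r(2) by linarith
  note cancel = rep_cancel(2)[OF u(4) this]
  have "Phi (gpath (s # p) v) = Phi (em v s) \<otimes>\<^bsub>U\<^esub> Phi (gpath p ?w)"
    using s Cons.prems(2) by (simp add: Phi_mult[OF small_in_J[OF em_small] gpath_J])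
  also have "\<dots> = rep (word_inv (uw v)) \<otimes>\<^bsub>U\<^esub> (rep [s] \<otimes>\<^bsub>U\<^esub> ((rep (uw ?w) \<otimes>\<^bsub>U\<^esub> rep (word_inv (uw ?w))) \<otimes>\<^bsub>U\<^esub>
      (rep p \<otimes>\<^bsub>U\<^esub> rep (uw (?w #> ev p)))))"
    using mem unfolding Cons.IH[OF s(2,3)] Phi_em[OF Cons.prems(2) s(1)] by (simp add: U.m_assoc)
  also have "\<dots> = rep (word_inv (uw v)) \<otimes>\<^bsub>U\<^esub> (rep ([s] @ p) \<otimes>\<^bsub>U\<^esub> rep (uw (?w #> ev p)))"
    unfolding cancel rep_append[OF wu(3) s(2)] using mem by (simp add: U.m_assoc)
  finally show ?case
    using V_ev_Cons[OF Cons.prems(2) s(1,2)] by simp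
qed

lemma Phi_kills: "h \<in> \<Psi> ` N \<theta> \<Longrightarrow> Phi h = \<one>\<^bsub>U\<^esub>"
  by (rule kills_N[OF Phi_hom Phi_fixers[OF _ P_bounds(2)]])

text \<open>A closed word of bounded length gives a small loop, which dies in the limit group and hence in
  every group in which the short relations hold.\<close>

lemma rep_relator:
  assumes p: "p \<in> lists letters" "ev p = \<one>" "length p * M1 \<le> M"
  shows "rep p = \<one>\<^bsub>U\<^esub>"
proof -
  let ?v = "f x0"
  have v: "?v \<in> V" "?v #> ev p = ?v" using f_V p by (simp_all add: V_one)
  obtain q where q: "path q" "pathstart q = x0" "pathfinish q = g ?v" using connected by blast
  let ?h = "gpath p ?v" and ?k = "(path_class q, [])"
  have h: "small (C / t) M (g ?v) ?h (g ?v)"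
    using small_mono[OF gpath_small[OF p(1) v(1)] p(3)] v(2) by simp
  have k: "?k \<in> J x0 (g ?v)" using path_in_J[OF q(1)] q by simp
  have hJ: "?h \<in> J (g ?v) (g ?v)" using small_in_J[OF h] .
  have "?k \<star> ?h \<star> jinv ?k \<in> \<Psi> ` N \<theta>"
    using small_trivial[OF h q] .
  then have "Phi (?k \<star> ?h \<star> jinv ?k) = \<one>\<^bsub>U\<^esub>"
    by (rule Phi_kills)
  then have "Phi ?k \<otimes>\<^bsub>U\<^esub> (Phi ?h \<otimes>\<^bsub>U\<^esub> inv\<^bsub>U\<^esub> Phi ?k) = \<one>\<^bsub>U\<^esub>"
    using k hJ jinv_closed[OF k]
    by (simp add: Phi_mult[OF k jmult_closed[OF hJ jinv_closed[OF k]]] Phi_mult[OF hJ jinv_closed[OF k]] Phi_jinv[OF k])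
  then have "Phi ?h = \<one>\<^bsub>U\<^esub>"
    by (rule U.conj_eq_one[OF _ Phi_closed[OF k] Phi_closed[OF hJ]])
  moreover have "Phi ?h = rep (word_inv (uw ?v)) \<otimes>\<^bsub>U\<^esub> (rep p \<otimes>\<^bsub>U\<^esub> rep (uw ?v))"
    using Phi_gpath[OF p(1) v(1)] v(2) by simp
  moreover have mem: "rep (word_inv (uw ?v)) \<in> carrier U" "rep p \<in> carrier U" "rep (uw ?v) \<in> carrier U"
    using uw(1)[OF v(1)] word_inv_closed p by (auto intro!: rep_closed simp del: in_lists_conv_set)
  moreover have "2 * length (uw ?v) \<le> r" using uw(2)[OF v(1)] r(2) by linarith
  then have "rep (uw ?v) \<otimes>\<^bsub>U\<^esub> rep (word_inv (uw ?v)) = \<one>\<^bsub>U\<^esub>" by (rule rep_cancel(2)[OF uw(1)[OF v(1)]])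
  then have "inv\<^bsub>U\<^esub> rep (word_inv (uw ?v)) = rep (uw ?v)"
    using mem by (intro U.inv_equality)
  ultimately show ?thesis
    by (intro U.conj_eq_one[of "rep (word_inv (uw ?v))" "rep p"]) simp_all
qed

end

section \<open>Transport to the vertex group modulo \<open>D\<close>\<close>

context comparison
begin

text \<open>The constant path is prescribed at \<open>x0\<close> so that \<open>hol x0 h x0\<close>
  is the coset of \<open>h\<close> itself.\<close>

definition tau :: "'a \<Rightarrow> 'a jelem" where
  "tau x = (path_class (if x = x0 then (\<lambda>_. x0)
     else (SOME q. path q \<and> pathstart q = x0 \<and> pathfinish q = x)), [])"

lemma tau_path: "\<exists>q. tau x = (path_class q, []) \<and> path q \<and> pathstart q = x0 \<and> pathfinish q = x"
proof (cases "x = x0")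
  case False
  then show ?thesis
    using someI_ex[OF connected[of x]] unfolding tau_def by auto
qed (auto simp: tau_def)

lemma tau_J: "tau x \<in> J x0 x"
  using tau_path[of x] path_in_J by auto

lemma tau_base: "tau x0 = jone x0"
  by (simp add: tau_def jone_def)

abbreviation "D \<equiv> \<Psi> ` N \<theta>"
definition "Q = J0 x0 Mod D"

sublocale D: normal D "J0 x0"
  by (rule \<Psi>_N_normal)

sublocale Q: group Q
  unfolding Q_def by (rule D.factorgroup_is_group)

text \<open>A functor from the whole groupoid to the quotient \<open>Q\<close>, obtained by closing
  up morphisms along the paths \<open>tau\<close>. It is the counterpart of \<open>Phi\<close> on
  the side of the warped system.\<close>

definition hol :: "'a \<Rightarrow> 'a jelem \<Rightarrow> 'a \<Rightarrow> 'a jelem set" where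
  "hol x h y = D #>\<^bsub>J0 x0\<^esub> (tau x \<star> h \<star> jinv (tau y))"

lemma conj_J: "h \<in> J x y \<Longrightarrow> tau x \<star> h \<star> jinv (tau y) \<in> J x0 x0"
  by (meson jmult_closed jinv_closed tau_J)

lemma hol_closed [simp]: "h \<in> J x y \<Longrightarrow> hol x h y \<in> carrier Q"
  using conj_J by (auto simp: hol_def Q_def carrier_FactGroup)

lemma hol_mult:
  assumes "h \<in> J x y" "k \<in> J y z"
  shows "hol x (h \<star> k) z = hol x h y \<otimes>\<^bsub>Q\<^esub> hol y k z"
proof -
  note ty = jinv_closed[OF tau_J[of y]] and tz = jinv_closed[OF tau_J[of z]]
  have kz: "k \<star> jinv (tau z) \<in> J y x0" by (rule jmult_closed[OF assms(2) tz])
  have "(tau x \<star> h \<star> jinv (tau y)) \<star> tau y \<star> k \<star> jinv (tau z) =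
      tau x \<star> (h \<star> jinv (tau y)) \<star> tau y \<star> k \<star> jinv (tau z)"
    by (rule jmult_assoc[OF tau_J jmult_closed[OF assms(1) ty] jmult_closed[OF tau_J kz]])
  also have "(h \<star> jinv (tau y)) \<star> tau y \<star> k \<star> jinv (tau z) =
      h \<star> jinv (tau y) \<star> tau y \<star> k \<star> jinv (tau z)"
    by (rule jmult_assoc[OF assms(1) ty jmult_closed[OF tau_J kz]])
  also have "jinv (tau y) \<star> tau y \<star> k \<star> jinv (tau z) = (jinv (tau y) \<star> tau y) \<star> k \<star> jinv (tau z)"
    by (rule jmult_assoc[OF ty tau_J kz, symmetric])
  also have "\<dots> = k \<star> jinv (tau z)"
    unfolding jinv_left[OF tau_J] by (rule jone_left[OF kz])
  also have "h \<star> k \<star> jinv (tau z) = (h \<star> k) \<star> jinv (tau z)"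
    by (rule jmult_assoc[OF assms tz, symmetric])
  finally show ?thesis
    using D.rcos_sum[of "tau x \<star> h \<star> jinv (tau y)" "tau y \<star> k \<star> jinv (tau z)"]
      conj_J[OF assms(1)] conj_J[OF assms(2)]
    by (simp add: hol_def Q_def)
qed

lemma hol_eq_one: "tau x \<star> h \<star> jinv (tau y) \<in> D \<Longrightarrow> hol x h y = \<one>\<^bsub>Q\<^esub>"
  using D.coset_join2[OF _ D.is_subgroup, of "tau x \<star> h \<star> jinv (tau y)"] D.subset
  by (auto simp: hol_def Q_def)

lemma hol_jone [simp]: "hol x (jone x) x = \<one>\<^bsub>Q\<^esub>"
  using jone_left[OF jinv_closed[OF tau_J[of x]]] jinv_right[OF tau_J[of x]]
    subgroup.one_closed[OF D.is_subgroup]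
  by (intro hol_eq_one) simp

lemma hol_jinv: "h \<in> J x y \<Longrightarrow> hol y (jinv h) x = inv\<^bsub>Q\<^esub> (hol x h y)"
  using hol_mult[OF jinv_closed, of h x y h y] jinv_left[of h x y]
  by (intro Q.inv_equality[symmetric]) (simp_all add: jinv_closed)

lemma hol_trivial:
  assumes "small (C / t) M x h x"
  shows "hol x h x = \<one>\<^bsub>Q\<^esub>"
proof -
  obtain q where q: "tau x = (path_class q, [])" "path q" "pathstart q = x0" "pathfinish q = x"
    using tau_path by blast
  have "tau x \<star> h \<star> jinv (tau x) \<in> D"
    using small_trivial[OF assms q(2-4)] by (simp add: q(1))
  then show ?thesis by (rule hol_eq_one)
qed

text \<open>One morphism followed by the inverse of the other is a loop of at most \<open>M\<close>
  small steps, which \<open>small_trivial\<close> puts into \<open>D\<close> up to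
  conjugation.\<close>

lemma hol_unique:
  assumes "small (C / t) m x h y" "small (C / t) n x k y" "m + n \<le> M"
  shows "hol x h y = hol x k y"
proof -
  note h = small_in_J[OF assms(1)] and k = small_in_J[OF assms(2)]
  have "hol y (jinv k \<star> h) y = \<one>\<^bsub>Q\<^esub>"
    using small_mono[OF small_mult[OF small_jinv[OF assms(2)] assms(1)], of M] assms(3)
    by (intro hol_trivial) simp
  then have "inv\<^bsub>Q\<^esub> (hol x k y) \<otimes>\<^bsub>Q\<^esub> hol x h y = \<one>\<^bsub>Q\<^esub>"
    using hol_mult[OF jinv_closed[OF k] h] hol_jinv[OF k] by simp
  then have "inv\<^bsub>Q\<^esub> (hol x h y) = inv\<^bsub>Q\<^esub> (hol x k y)"
    using h k by (intro Q.inv_equality) auto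
  then show ?thesis using h k by (metis Q.inv_inv hol_closed)
qed

text \<open>A relation of length at most \<open>r\<close> becomes a loop of at most r * M1 small
  steps, so by \<open>hol_unique\<close> one side may be exchanged for the other; functoriality of
  \<open>hol\<close> leaves the rest of the word untouched.\<close>

lemma hol_weq:
  assumes "weq r p q" "v \<in> V" "r * M1 \<le> M"
  shows "hol (g v) (gpath p v) (g (v #> ev p)) = hol (g v) (gpath q v) (g (v #> ev q))"
  using assms(1)
proof (induction rule: weq.induct)
  case (relation u p q w)
  let ?x = "v #> ev u"
  have x: "?x \<in> V" using relation assms(2) by (simp add: V_ev_closed)
  have y: "?x #> ev p \<in> V" using relation x by (simp add: V_ev_closed)
  have eq: "?x #> ev q = ?x #> ev p" using relation by simp
  have len: "length p * M1 + length q * M1 \<le> M"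
    using mult_right_mono[OF relation(5), of M1] assms(3) by (simp add: add_mult_distrib)
  have mid: "hol (g ?x) (gpath p ?x) (g (?x #> ev p)) = hol (g ?x) (gpath q ?x) (g (?x #> ev p))"
    using hol_unique[OF gpath_small[OF relation(2) x] _ len] gpath_small[OF relation(3) x] eq by simp
  have split: "hol (g v) (gpath (u @ s @ w) v) (g (v #> ev (u @ s @ w))) =
      hol (g v) (gpath u v) (g ?x) \<otimes>\<^bsub>Q\<^esub> (hol (g ?x) (gpath s ?x) (g (?x #> ev s)) \<otimes>\<^bsub>Q\<^esub>
      hol (g (?x #> ev s)) (gpath w (?x #> ev s)) (g ((?x #> ev s) #> ev w)))"
    if s: "s \<in> lists letters" for s
  proof -
    have xs: "?x #> ev s \<in> V" using s x by (simp add: V_ev_closed)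
    have sw: "s @ w \<in> lists letters" using s relation by simp
    have "gpath (u @ s @ w) v = gpath u v \<star> gpath s ?x \<star> gpath w (?x #> ev s)"
      using gpath_append[OF relation(1) sw assms(2)] gpath_append[OF s relation(4) x] by simp
    moreover have "v #> ev (u @ s @ w) = (?x #> ev s) #> ev w"
      using V_ev_append[OF assms(2) relation(1) sw] V_ev_append[OF x s relation(4)] by simp
    ultimately show ?thesis
      using hol_mult[OF gpath_J[OF relation(1) assms(2)] jmult_closed[OF gpath_J[OF s x] gpath_J[OF relation(4) xs]]]
        hol_mult[OF gpath_J[OF s x] gpath_J[OF relation(4) xs]] by simp
  qed
  show ?case
    unfolding split[OF relation(2)] split[OF relation(3)] eq mid ..
qed simp

text \<open>A small morphism joining \<open>x\<close> to its approximation \<open>g (f x)\<close> in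
  the image of the Cayley graph.\<close>

definition hx :: "'a \<Rightarrow> 'a jelem" where
  "hx x = (SOME h. small (C / t) M1 x h (g (f x)))"

lemma hx_small: "small (C / t) M1 x (hx x) (g (f x))"
  unfolding hx_def using small_ex[OF gf] by (rule someI_ex)

end

section \<open>The isomorphism of the limit group with a term of the filtration\<close>

locale comparison_presented = comparison +
  assumes presented: "\<lbrakk>p \<in> lists letters; ev p = \<one>\<rbrakk> \<Longrightarrow> weq r p []"
    and M: "1 + (2 * M1 + R * M1) \<le> M" "r * M1 \<le> M"
begin

sublocale comparison_rep S x0 \<alpha> \<Lambda> T Nk \<rho> t g f P C R Rq r M1 M \<theta> \<Lambda> ev
  by unfold_locales (auto simp: ev_closed ev_append)

text \<open>A single step and its detour, along \<open>hx y\<close>, at most \<open>R\<close> edges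
  and \<open>hx z\<close> reversed, form a loop of at most 1 + (2 * M1 + R * M1) small steps; this
  is the first bound on \<open>M\<close>. The word of the detour also computes \<open>c\<close>, and
  hence \<open>Phi e\<close>.\<close>

lemma track_step:
  assumes e: "small (C / t) 1 y e z"
  obtains p where "p \<in> lists letters" "f y #> ev p = f z" "Phi e = ev p"
    "hol y e z = hol y (hx y) (g (f y)) \<otimes>\<^bsub>Q\<^esub> (hol (g (f y)) (gpath p (f y)) (g (f z)) \<otimes>\<^bsub>Q\<^esub>
      inv\<^bsub>Q\<^esub> hol z (hx z) (g (f z)))"
proof -
  have "C \<le> real M1 * C" using C M1 by simp
  then have CP: "C \<le> P" using P_bounds(3) by linarith
  have Phi: "Phi e = c y z" "\<rho> y z \<le> P"
    using Phi_small[OF e, of C] C CP t_pos by auto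
  obtain p where p: "p \<in> lists letters" "length p \<le> R" "f y #> ev p = f z"
    using f_word[OF Phi(2)] by blast
  have "c y z = ev p" using c_eq[OF Phi(2) p(1) _ p(3)] p(2) r(1) by simp
  have gp: "small (C / t) (R * M1) (g (f y)) (gpath p (f y)) (g (f z))"
    using small_mono[OF gpath_small[OF p(1) f_V[of y]], of "R * M1"] p by simp
  note j = small_in_J[OF hx_small[of y]] small_in_J[OF gp] jinv_closed[OF small_in_J[OF hx_small[of z]]]
  have s: "small (C / t) (M1 + (R * M1 + M1)) y (hx y \<star> gpath p (f y) \<star> jinv (hx z)) z"
    by (intro small_mult[OF hx_small] small_mult[OF gp] small_jinv hx_small)
  have "hol y e z = hol y (hx y \<star> gpath p (f y) \<star> jinv (hx z)) z"
    using M(1) by (intro hol_unique[OF e s]) simp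
  also have "\<dots> = hol y (hx y) (g (f y)) \<otimes>\<^bsub>Q\<^esub> (hol (g (f y)) (gpath p (f y)) (g (f z)) \<otimes>\<^bsub>Q\<^esub>
      inv\<^bsub>Q\<^esub> hol z (hx z) (g (f z)))"
    using hol_mult[OF j(1) jmult_closed[OF j(2,3)]] hol_mult[OF j(2,3)] hol_jinv[OF small_in_J[OF hx_small[of z]]]
    by simp
  finally show ?thesis using that p Phi(1) \<open>c y z = ev p\<close> by simp
qed

text \<open>Every jumping path is shadowed by a word in \<open>\<Lambda>\<close>, which determines both its image
  under \<open>Phi\<close> and its class modulo \<open>D\<close>.\<close>

definition tracked :: "'a \<Rightarrow> 'a jelem \<Rightarrow> 'a \<Rightarrow> bool" where
  "tracked x h y \<longleftrightarrow> (\<exists>p\<in>lists letters. f x #> ev p = f y \<and> Phi h = ev p \<and>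
     hol x h y = hol x (hx x) (g (f x)) \<otimes>\<^bsub>Q\<^esub> (hol (g (f x)) (gpath p (f x)) (g (f y)) \<otimes>\<^bsub>Q\<^esub>
       inv\<^bsub>Q\<^esub> hol y (hx y) (g (f y))))"

lemma tracked_mult:
  assumes h: "tracked x h y" "h \<in> J x y" and e: "small (C / t) 1 y e z"
  shows "tracked x (h \<star> e) z"
proof -
  obtain p where p: "p \<in> lists letters" "f x #> ev p = f y" "Phi h = ev p"
    "hol x h y = hol x (hx x) (g (f x)) \<otimes>\<^bsub>Q\<^esub> (hol (g (f x)) (gpath p (f x)) (g (f y)) \<otimes>\<^bsub>Q\<^esub>
      inv\<^bsub>Q\<^esub> hol y (hx y) (g (f y)))"
    using h(1) unfolding tracked_def by blast
  obtain q where q: "q \<in> lists letters" "f y #> ev q = f z" "Phi e = ev q"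
    "hol y e z = hol y (hx y) (g (f y)) \<otimes>\<^bsub>Q\<^esub> (hol (g (f y)) (gpath q (f y)) (g (f z)) \<otimes>\<^bsub>Q\<^esub>
      inv\<^bsub>Q\<^esub> hol z (hx z) (g (f z)))"
    using track_step[OF e] .
  have pq: "p @ q \<in> lists letters" using p q by simp
  note eJ = small_in_J[OF e]
  have gp: "gpath p (f x) \<in> J (g (f x)) (g (f y))" "gpath q (f y) \<in> J (g (f y)) (g (f z))"
    using gpath_J[OF p(1) f_V[of x]] gpath_J[OF q(1) f_V[of y]] p q by simp_all
  have mem: "hol x (hx x) (g (f x)) \<in> carrier Q" "hol y (hx y) (g (f y)) \<in> carrier Q"
    "hol z (hx z) (g (f z)) \<in> carrier Q" "hol (g (f x)) (gpath p (f x)) (g (f y)) \<in> carrier Q"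
    "hol (g (f y)) (gpath q (f y)) (g (f z)) \<in> carrier Q"
    using gp small_in_J[OF hx_small] by (auto intro: hol_closed)
  \<comment> \<open>The two comparison terms at the intermediate point \<open>y\<close> cancel and
    leave the concatenation of the two words.\<close>
  have "hol x (h \<star> e) z = hol x (hx x) (g (f x)) \<otimes>\<^bsub>Q\<^esub> ((hol (g (f x)) (gpath p (f x)) (g (f y)) \<otimes>\<^bsub>Q\<^esub>
      (inv\<^bsub>Q\<^esub> hol y (hx y) (g (f y)) \<otimes>\<^bsub>Q\<^esub> hol y (hx y) (g (f y))) \<otimes>\<^bsub>Q\<^esub>
      hol (g (f y)) (gpath q (f y)) (g (f z))) \<otimes>\<^bsub>Q\<^esub> inv\<^bsub>Q\<^esub> hol z (hx z) (g (f z)))"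
    unfolding hol_mult[OF h(2) eJ] p(4) q(4) using mem by (simp only: Q.m_assoc Q.m_closed Q.inv_closed)
  also have "\<dots> = hol x (hx x) (g (f x)) \<otimes>\<^bsub>Q\<^esub> ((hol (g (f x)) (gpath p (f x)) (g (f y)) \<otimes>\<^bsub>Q\<^esub>
      hol (g (f y)) (gpath q (f y)) (g (f z))) \<otimes>\<^bsub>Q\<^esub> inv\<^bsub>Q\<^esub> hol z (hx z) (g (f z)))"
    using mem by (simp only: Q.l_inv Q.r_one)
  also have "hol (g (f x)) (gpath p (f x)) (g (f y)) \<otimes>\<^bsub>Q\<^esub> hol (g (f y)) (gpath q (f y)) (g (f z)) =
      hol (g (f x)) (gpath (p @ q) (f x)) (g (f z))"
    using hol_mult[OF gp] gpath_append[OF p(1) q(1) f_V[of x]] p(2) by simp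
  finally have "hol x (h \<star> e) z = hol x (hx x) (g (f x)) \<otimes>\<^bsub>Q\<^esub> (hol (g (f x)) (gpath (p @ q) (f x)) (g (f z)) \<otimes>\<^bsub>Q\<^esub>
      inv\<^bsub>Q\<^esub> hol z (hx z) (g (f z)))" .
  moreover have "f x #> ev (p @ q) = f z"
    using V_ev_append[OF f_V[of x] p(1) q(1)] p(2) q(2) by simp
  moreover have "Phi (h \<star> e) = ev (p @ q)"
    using Phi_mult[OF h(2) eJ] p q by (simp add: ev_append)
  ultimately show ?thesis unfolding tracked_def using pq by blast
qed

lemma tracked_jone: "tracked x (jone x) x"
  unfolding tracked_def
  using f_V[of x] small_in_J[OF hx_small[of x]]
  by (intro bexI[of _ "[]"]) (simp_all add: V_one Phi_jone)

lemma small_tracked: "small (C / t) n x h y \<Longrightarrow> tracked x h y"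
proof (induction rule: small.induct)
  case (unit x)
  show ?case by (rule tracked_jone)
next
  case (path n x h p)
  show ?case
    by (rule tracked_mult[OF path.IH small_in_J[OF path.hyps(1)] small_path[OF path.hyps(2,3)]])
next
  case (jump n x h a z)
  show ?case
    by (rule tracked_mult[OF jump.IH small_in_J[OF jump.hyps(1)] small_jump[OF jump.hyps(2)]])
qed

text \<open>The number of small steps is unrestricted here: tracking composes, and \<open>M\<close>
  only limits the loop used for each single step.\<close>

lemma J_tracked: "h \<in> J x y \<Longrightarrow> tracked x h y"
  using J_small[of h x y "C / t"] small_tracked[of _ x h y] C t_pos by auto

text \<open>The tracking word of a loop at \<open>x0\<close> is closed at the vertex
  \<open>f x0\<close>, so its value lies in the stabiliser \<open>Nk\<close>.\<close>

lemma Phi_in_Nk: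
  assumes "h \<in> J x0 x0"
  shows "Phi h \<in> Nk"
proof -
  obtain p where p: "p \<in> lists letters" "f x0 #> ev p = f x0" "Phi h = ev p"
    using J_tracked[OF assms] unfolding tracked_def by blast
  then have "f x0 #> ev p = f x0 #> \<one>" using V_one[OF f_V] by simp
  then have "ev p \<otimes> inv \<one> \<in> Nk"
    using p by (subst (asm) V_stabilizer) (simp_all add: ev_closed f_V)
  then show ?thesis using p by (simp add: ev_closed)
qed

text \<open>Here the presentation by short relations is essential: a tracking word with value
  \<open>\<one>\<close> can be shrunk to \<open>[]\<close> by relations of length at most
  \<open>r\<close>, and \<open>hol_weq\<close> shows that \<open>hol\<close> does not
  notice.\<close>

lemma Phi_kernel:
  assumes h: "h \<in> J x0 x0" and Phi: "Phi h = \<one>"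
  shows "h \<in> D"
proof -
  let ?v = "f x0"
  let ?a = "hol x0 (hx x0) (g ?v)"
  obtain p where p: "p \<in> lists letters" "f x0 #> ev p = f x0" "Phi h = ev p"
    "hol x0 h x0 = ?a \<otimes>\<^bsub>Q\<^esub> (hol (g ?v) (gpath p ?v) (g ?v) \<otimes>\<^bsub>Q\<^esub> inv\<^bsub>Q\<^esub> ?a)"
    using J_tracked[OF h] unfolding tracked_def by blast
  have a: "?a \<in> carrier Q" using small_in_J[OF hx_small] by (rule hol_closed)
  have "weq r p []" using presented p Phi by simp
  from hol_weq[OF this f_V M(2), of x0] have "hol (g ?v) (gpath p ?v) (g ?v) = \<one>\<^bsub>Q\<^esub>"
    using p(2) V_one[OF f_V[of x0]] by simp
  then have "hol x0 h x0 = \<one>\<^bsub>Q\<^esub>" using p(4) a by simp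
  moreover have "tau x0 \<star> h \<star> jinv (tau x0) = h"
    unfolding tau_base jinv_jone using h by (simp add: jone_left[OF h] jone_right[OF h])
  ultimately have "D #>\<^bsub>J0 x0\<^esub> h = D" by (simp add: hol_def Q_def)
  then show ?thesis using D.rcos_self[of h D] D.is_subgroup h by simp
qed

text \<open>A word for \<open>n\<close> is realised as a loop at \<open>g (f x0)\<close>, which
  develops to a conjugate of \<open>n\<close>. Carrying it to \<open>x0\<close> along
  \<open>hx x0\<close>, whose development is the same \<open>uw\<close>, undoes the
  conjugation.\<close>

lemma Phi_surj:
  assumes "n \<in> Nk"
  shows "\<exists>h\<in>J x0 x0. Phi h = n"
proof -
  let ?v = "f x0"
  have n: "n \<in> carrier \<Lambda>" using assms N.subset by blast
  obtain p where p: "p \<in> lists letters" "ev p = n" using ev_surj[OF n] by blast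
  have v: "?v \<in> V" by (rule f_V)
  have "?v #> n = ?v #> \<one>" using V_stabilizer[OF v n one_closed] assms n by simp
  then have vn: "?v #> ev p = ?v" using p V_one[OF v] by simp
  have gp: "gpath p ?v \<in> J (g ?v) (g ?v)" using gpath_J[OF p(1) v] vn by simp
  note k = small_in_J[OF hx_small[of x0]]
  note u = uw[OF v]
  have "Phi (hx x0) = c x0 (g ?v)" "\<rho> x0 (g ?v) \<le> P" using Phi_small_unit[OF hx_small] by auto
  moreover have "R + length (uw ?v) \<le> r" using u(2) r(2) by linarith
  ultimately have Phi_k: "Phi (hx x0) = ev (uw ?v)" using c_eq[of x0 "g ?v" "uw ?v"] u by simp
  have "Phi (hx x0 \<star> gpath p ?v \<star> jinv (hx x0)) =
      ev (uw ?v) \<otimes> (inv (ev (uw ?v)) \<otimes> (n \<otimes> ev (uw ?v)) \<otimes> inv (ev (uw ?v)))"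
    using Phi_gpath[OF p(1) v] vn p u(1) Phi_k
    by (simp add: Phi_mult[OF k jmult_closed[OF gp jinv_closed[OF k]]] Phi_mult[OF gp jinv_closed[OF k]]
        Phi_jinv[OF k] ev_word_inv)
  also have "\<dots> = n"
    using n ev_closed[OF u(1)] by (simp add: m_assoc) (simp add: m_assoc[symmetric])
  finally show ?thesis using jmult_closed[OF k jmult_closed[OF gp jinv_closed[OF k]]] by blast
qed

text \<open>The first isomorphism theorem for \<open>Phi \<circ> \<Psi>\<close>:
  \<open>Phi_kills\<close> and \<open>Phi_kernel\<close> identify the kernel with
  \<open>N \<theta>\<close>.\<close>

theorem limit_group_iso: "\<Gamma> Mod N \<theta> \<cong> \<Lambda>\<lparr>carrier := Nk\<rparr>"
proof -
  interpret Nk: group "\<Lambda>\<lparr>carrier := Nk\<rparr>"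
    using N.is_subgroup by (rule subgroup_imp_group)
  have \<Psi>: "\<Psi> \<gamma> \<in> J x0 x0" if "\<gamma> \<in> carrier \<Gamma>" for \<gamma>
    using \<Psi>_hom that by (auto simp: hom_def)
  have "Phi \<circ> \<Psi> \<in> hom \<Gamma> (\<Lambda>\<lparr>carrier := Nk\<rparr>)"
    using \<Psi>_hom by (auto simp: hom_def Pi_iff Phi_in_Nk \<Psi> Phi_mult[OF \<Psi> \<Psi>])
  then interpret h: group_hom \<Gamma> "\<Lambda>\<lparr>carrier := Nk\<rparr>" "Phi \<circ> \<Psi>"
    by (simp add: group_hom_def group_hom_axioms_def group_\<Gamma> Nk.group_axioms)
  have inj: "inj_on \<Psi> (carrier \<Gamma>)" and surj: "\<Psi> ` carrier \<Gamma> = J x0 x0"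
    using \<Psi>_bij by (auto simp: bij_betw_def)
  have N: "N \<theta> \<subseteq> carrier \<Gamma>"
    using N_normal normal_imp_subgroup subgroup.subset by blast
  have "kernel \<Gamma> (\<Lambda>\<lparr>carrier := Nk\<rparr>) (Phi \<circ> \<Psi>) = N \<theta>"
  proof (intro subset_antisym subsetI)
    fix \<gamma> assume \<gamma>: "\<gamma> \<in> kernel \<Gamma> (\<Lambda>\<lparr>carrier := Nk\<rparr>) (Phi \<circ> \<Psi>)"
    then have "\<Psi> \<gamma> \<in> D" "\<gamma> \<in> carrier \<Gamma>"
      using Phi_kernel[OF \<Psi>] by (auto simp: kernel_def)
    then show "\<gamma> \<in> N \<theta>" using inj N by (auto simp: inj_on_def)
  next
    fix \<gamma> assume \<gamma>: "\<gamma> \<in> N \<theta>"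
    then have "Phi (\<Psi> \<gamma>) = \<one>"
      by (intro Phi_kills imageI)
    with \<gamma> N show "\<gamma> \<in> kernel \<Gamma> (\<Lambda>\<lparr>carrier := Nk\<rparr>) (Phi \<circ> \<Psi>)"
      by (auto simp: kernel_def)
  qed
  moreover have "(Phi \<circ> \<Psi>) ` carrier \<Gamma> = carrier (\<Lambda>\<lparr>carrier := Nk\<rparr>)"
    unfolding image_comp[symmetric] surj using Phi_surj Phi_in_Nk by auto
  ultimately show ?thesis using h.FactGroup_iso by simp
qed

end

section \<open>The direct limit in the stable case\<close>

context warped_paths
begin

abbreviation "pt \<equiv> pi_theta S x0 \<alpha>"
abbreviation "qm \<equiv> quotient_map_theta S x0 \<alpha>"

lemma pt_carrier: "carrier (pt \<theta>) = (\<lambda>a. N \<theta> #>\<^bsub>\<Gamma>\<^esub> a) ` carrier \<Gamma>"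
  by (simp add: pi_theta_def carrier_FactGroup)

lemma group_pt: "group (pt \<theta>)"
  unfolding pi_theta_def by (rule normal.factorgroup_is_group[OF N_normal])

lemma N_mono: "\<theta> \<le> \<theta>' \<Longrightarrow> N \<theta> \<subseteq> N \<theta>'"
proof -
  assume "\<theta> \<le> \<theta>'"
  then have "K \<theta> \<subseteq> K \<theta>'" by (force simp: K_theta_def)
  then show ?thesis
    using normal_closure_superset[of "K \<theta>'" \<Gamma>] by (intro normal_closure_minimal[OF N_normal]) blast
qed

lemma qm_coset:
  assumes "\<theta> \<le> \<theta>'" "a \<in> carrier \<Gamma>"
  shows "qm \<theta> \<theta>' (N \<theta> #>\<^bsub>\<Gamma>\<^esub> a) = N \<theta>' #>\<^bsub>\<Gamma>\<^esub> a"
proof -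
  interpret group \<Gamma> by (rule group_\<Gamma>)
  interpret N: normal "N \<theta>" \<Gamma> by (rule N_normal)
  interpret N': normal "N \<theta>'" \<Gamma> by (rule N_normal)
  have "N \<theta>' <#>\<^bsub>\<Gamma>\<^esub> N \<theta> = N \<theta>'"
  proof
    show "N \<theta>' <#>\<^bsub>\<Gamma>\<^esub> N \<theta> \<subseteq> N \<theta>'"
      using N_mono[OF assms(1)] by (auto simp: set_mult_def intro: N'.m_closed)
    show "N \<theta>' \<subseteq> N \<theta>' <#>\<^bsub>\<Gamma>\<^esub> N \<theta>"
    proof
      fix x assume "x \<in> N \<theta>'"
      then have "x = x \<otimes>\<^bsub>\<Gamma>\<^esub> \<one>\<^bsub>\<Gamma>\<^esub>" using N'.subset by auto
      with \<open>x \<in> N \<theta>'\<close> show "x \<in> N \<theta>' <#>\<^bsub>\<Gamma>\<^esub> N \<theta>"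
        unfolding set_mult_def using N.one_closed by blast
    qed
  qed
  then show ?thesis
    unfolding quotient_map_theta_def
    using setmult_rcos_assoc[OF N'.subset N.subset assms(2)] by simp
qed

lemma qm_qm:
  assumes "i \<le> j" "j \<le> k" "y \<in> carrier (pt i)"
  shows "qm j k (qm i j y) = qm i k y"
  using assms by (auto simp: pt_carrier qm_coset)

abbreviation "lm \<equiv> limit_map {1..} pt qm"

lemma limit_map_eqI:
  assumes "1 \<le> i" "x \<in> carrier (pt i)" "1 \<le> i'" "x' \<in> carrier (pt i')" "i \<le> k" "i' \<le> k"
    and eq: "qm i k x = qm i' k x'"
  shows "lm i x = lm i' x'"
proof -
  have *: "lm i x \<subseteq> lm i' x'"
    if "1 \<le> i" "x \<in> carrier (pt i)" "1 \<le> i'" "x' \<in> carrier (pt i')" "i \<le> k" "i' \<le> k" "qm i k x = qm i' k x'"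
    for i i' x x'
  proof
    fix z assume "z \<in> lm i x"
    then obtain j y l where z: "z = (j, y)" "1 \<le> j" "y \<in> carrier (pt j)" "i \<le> l" "j \<le> l" "qm i l x = qm j l y"
      by (auto simp: limit_map_def limit_rel_def)
    let ?m = "max k l"
    have "qm i' ?m x' = qm k ?m (qm i' k x')" using that by (simp add: qm_qm)
    also have "\<dots> = qm k ?m (qm i k x)" using that by simp
    also have "\<dots> = qm l ?m (qm i l x)"
      using qm_qm[of i k ?m x] qm_qm[of i l ?m x] that(2,5) z(4) by simp
    also have "\<dots> = qm j ?m y" unfolding z(6) using z by (simp add: qm_qm)
    finally have eq: "qm i' ?m x' = qm j ?m y" .
    have "\<exists>m\<in>{1..}. i' \<le> m \<and> j \<le> m \<and> qm i' m x' = qm j m y"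
      by (rule bexI[of _ ?m]) (use that z eq in \<open>auto simp: le_max_iff_disj\<close>)
    with that z show "z \<in> lm i' x'"
      unfolding limit_map_def limit_rel_def by simp
  qed
  show ?thesis
    using *[OF assms] *[OF assms(3,4,1,2,6,5) eq[symmetric]] by blast
qed

lemma one_pt: "N \<theta> \<in> carrier (pt \<theta>)" "\<one>\<^bsub>pt \<theta>\<^esub> = N \<theta>" "N \<theta> #>\<^bsub>\<Gamma>\<^esub> \<one>\<^bsub>\<Gamma>\<^esub> = N \<theta>"
proof -
  interpret group \<Gamma> by (rule group_\<Gamma>)
  show "N \<theta> #>\<^bsub>\<Gamma>\<^esub> \<one>\<^bsub>\<Gamma>\<^esub> = N \<theta>"
    using normal_imp_subgroup[OF N_normal] by (simp add: subgroup.subset)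
  then show "N \<theta> \<in> carrier (pt \<theta>)" unfolding pt_carrier by (metis imageI one_closed)
  show "\<one>\<^bsub>pt \<theta>\<^esub> = N \<theta>" by (simp add: pi_theta_def)
qed

text \<open>The classes of the units of all stages coincide. Transporting the group structure along
  \<open>lm \<theta>\<close> makes the image of the unit the new unit, which has to be recognised as
  that of the limit.\<close>

lemma one_pi_infinity:
  assumes "1 \<le> \<theta>"
  shows "\<one>\<^bsub>pi_infinity S x0 \<alpha>\<^esub> = lm \<theta> \<one>\<^bsub>pt \<theta>\<^esub>"
proof -
  interpret group \<Gamma> by (rule group_\<Gamma>)
  have "lm i (N i) = lm \<theta> (N \<theta>)" if "1 \<le> i" for i
    using that assms qm_coset[of i "max i \<theta>" "\<one>\<^bsub>\<Gamma>\<^esub>"] qm_coset[of \<theta> "max i \<theta>" "\<one>\<^bsub>\<Gamma>\<^esub>"]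
    by (intro limit_map_eqI[where k = "max i \<theta>"]) (auto simp: one_pt)
  then have "(\<Union>i\<in>{1..}. lm i (N i)) = (\<Union>i\<in>{1::nat..}. lm \<theta> (N \<theta>))"
    by (intro SUP_cong) auto
  also have "\<dots> = lm \<theta> (N \<theta>)" by (rule UN_constant[THEN trans]) auto
  finally show ?thesis
    unfolding pi_infinity_def direct_limit_def by (simp add: one_pt)
qed

text \<open>An element of \<open>N \<theta>'\<close> becomes trivial at stage
  \<open>\<theta>'\<close>, hence in the limit; injectivity of \<open>lm \<theta>\<close> makes it
  trivial already at stage \<open>\<theta>\<close>.\<close>

lemma stable_N:
  assumes iso: "lm \<theta> \<in> iso (pt \<theta>) (pi_infinity S x0 \<alpha>)" and \<theta>: "1 \<le> \<theta>" "\<theta> \<le> \<theta>'"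
  shows "N \<theta>' = N \<theta>"
proof
  interpret group \<Gamma> by (rule group_\<Gamma>)
  interpret N: normal "N \<theta>" \<Gamma> by (rule N_normal)
  interpret N': normal "N \<theta>'" \<Gamma> by (rule N_normal)
  show "N \<theta>' \<subseteq> N \<theta>"
  proof
    fix a assume a: "a \<in> N \<theta>'"
    then have a': "a \<in> carrier \<Gamma>" using N'.subset by blast
    have "N \<theta>' #>\<^bsub>\<Gamma>\<^esub> a = N \<theta>'" by (rule coset_join2[OF a' N'.is_subgroup a])
    then have "qm \<theta> \<theta>' (N \<theta> #>\<^bsub>\<Gamma>\<^esub> a) = qm \<theta> \<theta>' (N \<theta>)"
      using qm_coset[OF \<theta>(2) a'] qm_coset[OF \<theta>(2), of "\<one>\<^bsub>\<Gamma>\<^esub>"] by (simp add: one_pt)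
    moreover have mem: "N \<theta> #>\<^bsub>\<Gamma>\<^esub> a \<in> carrier (pt \<theta>)" using a' by (simp add: pt_carrier)
    ultimately have "lm \<theta> (N \<theta> #>\<^bsub>\<Gamma>\<^esub> a) = lm \<theta> (N \<theta>)"
      using \<theta> by (intro limit_map_eqI[where k = \<theta>']) (auto simp: one_pt)
    then have "N \<theta> #>\<^bsub>\<Gamma>\<^esub> a = N \<theta>"
      using iso mem one_pt(1) by (auto simp: iso_iff inj_on_def)
    then show "a \<in> N \<theta>" using rcos_self[OF a' N.is_subgroup] by simp
  qed
qed (rule N_mono[OF \<theta>(2)])

end

text \<open>The self-embedding is found inside \<open>\<Lambda>\<close>, whereas the hypothesis to
  be contradicted concerns the direct limit.\<close>

lemma no_self_embedding_transfer:
  assumes \<phi>: "\<phi> \<in> iso K G" and K: "group K" and G: "group G"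
    and H: "H \<lhd> K" "H \<noteq> carrier K" "finite (rcosets\<^bsub>K\<^esub> H)" "K\<lparr>carrier := H\<rparr> \<cong> K"
  shows "\<exists>H'. H' \<lhd> G \<and> H' \<noteq> carrier G \<and> finite (rcosets\<^bsub>G\<^esub> H') \<and> G\<lparr>carrier := H'\<rparr> \<cong> G"
proof (intro exI conjI)
  have inj: "inj_on \<phi> (carrier K)" and surj: "\<phi> ` carrier K = carrier G"
    and hom: "\<And>x y. \<lbrakk>x \<in> carrier K; y \<in> carrier K\<rbrakk> \<Longrightarrow> \<phi> (x \<otimes>\<^bsub>K\<^esub> y) = \<phi> x \<otimes>\<^bsub>G\<^esub> \<phi> y"
    using \<phi> by (auto simp: iso_iff hom_def)
  have HK: "subgroup H K" using normal_imp_subgroup[OF H(1)] .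
  have sub: "H \<subseteq> carrier K" using subgroup.subset[OF HK] .
  show "\<phi> ` H \<lhd> G" by (rule iso_normal_subgroup[OF \<phi> K G H(1)])
  show "\<phi> ` H \<noteq> carrier G"
    using inj sub H(2) unfolding surj[symmetric] by (simp add: inj_on_image_eq_iff)
  have "rcosets\<^bsub>G\<^esub> (\<phi> ` H) = (`) \<phi> ` (rcosets\<^bsub>K\<^esub> H)"
  proof -
    have "\<phi> ` H #>\<^bsub>G\<^esub> \<phi> a = \<phi> ` (H #>\<^bsub>K\<^esub> a)" if "a \<in> carrier K" for a
    proof -
      have "h \<in> H \<Longrightarrow> \<phi> (h \<otimes>\<^bsub>K\<^esub> a) = \<phi> h \<otimes>\<^bsub>G\<^esub> \<phi> a" for h
        using that sub by (intro hom) auto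
      then show ?thesis unfolding r_coset_def image_UN by simp
    qed
    then show ?thesis unfolding RCOSETS_def surj[symmetric] by (auto simp: image_iff)
  qed
  then show "finite (rcosets\<^bsub>G\<^esub> (\<phi> ` H))" using H(3) by simp
  have "restrict \<phi> H \<in> iso (K\<lparr>carrier := H\<rparr>) (G\<lparr>carrier := \<phi> ` H\<rparr>)"
    by (rule iso_restrict[OF \<phi> K G HK])
  then have "K\<lparr>carrier := H\<rparr> \<cong> G\<lparr>carrier := \<phi> ` H\<rparr>" by (rule is_isoI)
  then have "G\<lparr>carrier := \<phi> ` H\<rparr> \<cong> K\<lparr>carrier := H\<rparr>"
    by (rule group.iso_sym[OF group.subgroup_imp_group[OF K HK]])
  also note H(4)
  also have "K \<cong> G" using \<phi> by (rule is_isoI)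
  finally show "G\<lparr>carrier := \<phi> ` H\<rparr> \<cong> G" .
qed

section \<open>Box spaces coarsely equivalent to a warped system\<close>

text \<open>The scales need not tend to infinity, so large scales are available only for infinitely
  many indices; these can still be taken beyond any \<open>m\<close>.\<close>

lemma unbounded_frequently_large:
  fixes t :: "nat \<Rightarrow> real" and m :: nat
  assumes "\<not> bdd_above (range t)"
  shows "\<exists>k\<ge>m. c \<le> t k"
proof (rule ccontr)
  assume *: "\<not> (\<exists>k\<ge>m. c \<le> t k)"
  have "t k \<le> max c (Max (t ` {..m}))" for k
  proof (cases "k \<le> m")
    case True
    then have "t k \<le> Max (t ` {..m})" by (intro Max_ge) auto
    then show ?thesis by simp
  next
    case False
    then have "m \<le> k" by simp
    with * have "\<not> c \<le> t k" by blast
    then show ?thesis by simp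
  qed
  then have "bdd_above (range t)" by (rule bdd_aboveI2)
  with assms show False ..
qed

context homeo_system
begin

text \<open>There are n + 1 paths and \<open>n\<close> jumps. In a morphism the letter
  \<open>a\<close> leads from \<open>a z\<close> to \<open>z\<close>, so a jump by \<open>s\<close>
  is recorded by the letter of the inverse of \<open>s\<close>.\<close>

lemma jumping_path_small:
  assumes jp: "jumping_path S n \<gamma> s" and diam: "\<And>i. i \<le> n \<Longrightarrow> path_diam_le \<eta> (\<gamma> i)"
  shows "\<exists>h. small \<eta> (2 * n + 1) (pathstart (\<gamma> 0)) h (pathfinish (\<gamma> n))"
proof -
  have path: "path (\<gamma> i)" if "i \<le> n" for i using jp that by (simp add: jumping_path_def)
  have "\<exists>h. small \<eta> (2 * i + 1) (pathstart (\<gamma> 0)) h (pathfinish (\<gamma> i))" if "i \<le> n" for i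
    using that
  proof (induction i)
    case 0
    then show ?case using small_path[OF path[OF le0] diam[OF le0]] by auto
  next
    case (Suc i)
    then obtain h where h: "small \<eta> (2 * i + 1) (pathstart (\<gamma> 0)) h (pathfinish (\<gamma> i))" by auto
    let ?u = "pathfinish (\<gamma> i)" and ?s = "s (Suc i)"
    have s: "?s \<in> S \<union> inv_into UNIV ` S" "pathstart (\<gamma> (Suc i)) = ?s ?u"
      using jp Suc.prems by (auto simp: jumping_path_def dest!: bspec[of _ _ "Suc i"])
    have "\<exists>a. fst a \<in> S \<and> letter_map a (?s ?u) = ?u"
    proof (cases "?s \<in> S")
      case True
      then show ?thesis
        using homeo[OF True] by (intro exI[of _ "(?s, False)"]) (simp add: letter_map_def homeomorphism_def)
    next
      case False
      with s(1) obtain s0 where "s0 \<in> S" "?s = inv_into UNIV s0" by blast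
      then show ?thesis
        using homeo[of s0] by (intro exI[of _ "(s0, True)"]) (simp add: letter_map_def homeomorphism_def)
    qed
    then obtain a where a: "fst a \<in> S" "letter_map a (?s ?u) = ?u" by blast
    have "small \<eta> (2 * i + 1) (pathstart (\<gamma> 0)) h (letter_map a (?s ?u))" using h a by simp
    from small.path[OF small.jump[OF this a(1), folded s(2)] path[OF Suc.prems] diam[OF Suc.prems]]
    have "\<exists>h. small \<eta> (Suc (Suc (2 * i + 1))) (pathstart (\<gamma> 0)) h (pathfinish (\<gamma> (Suc i)))" by (rule exI)
    then show ?case by simp
  qed
  then show ?thesis by simp
qed

lemma warped_dist_jump:
  assumes "t > 0" "fst a \<in> S"
  shows "warped_dist S t (letter_map a x) x \<le> 1"
proof -
  interpret Metric_space UNIV "warped_dist S t" by (rule warped_dist_greatest(1)[OF assms(1)])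
  have *: "warped_dist S t y (fst a y) \<le> 1" for y
    using warped_dist_greatest(3)[OF assms] .
  show ?thesis
  proof (cases "snd a")
    case True
    then show ?thesis using *[of x] by (simp add: letter_map_def commute)
  next
    case False
    have "fst a (inv_into UNIV (fst a) x) = x"
      using homeo[OF assms(2)] by (simp add: homeomorphism_def)
    with False show ?thesis using *[of "inv_into UNIV (fst a) x"] by (simp add: letter_map_def)
  qed
qed

text \<open>A jumping path realising the distance has at most \<open>C\<close> jumps, and the length
  of each of its paths multiplied by t is at most \<open>C\<close>. This is the origin of
  \<open>M1\<close> and of the scale \<open>C / t\<close>.\<close>

lemma small_of_warped_dist:
  assumes jg: "jumping_geodesic S t" and t: "t > 0" and C: "warped_dist S t x y \<le> C"
  shows "\<exists>h. small (C / t) (2 * nat \<lceil>C\<rceil> + 1) x h y"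
proof -
  interpret Metric_space UNIV "warped_dist S t" by (rule warped_dist_greatest(1)[OF t])
  have C0: "0 \<le> C" using nonneg[of x y] C by linarith
  obtain n \<gamma> s where \<gamma>: "jumping_path S n \<gamma> s" "pathstart (\<gamma> 0) = x" "pathfinish (\<gamma> n) = y"
    "jumping_length t n \<gamma> = ennreal (warped_dist S t x y)"
    using jg unfolding jumping_geodesic_def by blast
  have len: "of_nat n + (\<Sum>i=0..n. ennreal t * path_length (\<gamma> i)) \<le> ennreal C"
    using \<gamma>(4) C by (simp add: jumping_length_def ennreal_leI)
  have "ennreal (real n) \<le> of_nat n + (\<Sum>i=0..n. ennreal t * path_length (\<gamma> i))"
    by (simp add: ennreal_of_nat_eq_real_of_nat)
  also note len
  finally have n: "real n \<le> C" using C0 by simp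
  have diam: "path_diam_le (C / t) (\<gamma> i)" if "i \<le> n" for i
    unfolding path_diam_le_def
  proof (intro ballI)
    fix a b :: real assume ab: "a \<in> {0..1}" "b \<in> {0..1}"
    have "ennreal (t * dist (\<gamma> i a) (\<gamma> i b)) = ennreal t * ennreal (dist (\<gamma> i a) (\<gamma> i b))"
      using t by (simp add: ennreal_mult)
    also have "\<dots> \<le> ennreal t * path_length (\<gamma> i)"
      by (intro mult_left_mono dist_le_path_length ab) simp
    also have "\<dots> \<le> (\<Sum>i=0..n. ennreal t * path_length (\<gamma> i))"
      using that by (intro member_le_sum) auto
    also have "\<dots> \<le> of_nat n + (\<Sum>i=0..n. ennreal t * path_length (\<gamma> i))" by simp
    also note len
    finally have "t * dist (\<gamma> i a) (\<gamma> i b) \<le> C" using C0 by simp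
    then show "dist (\<gamma> i a) (\<gamma> i b) \<le> C / t" using t by (simp add: field_simps)
  qed
  obtain h where "small (C / t) (2 * n + 1) x h y"
    using jumping_path_small[OF \<gamma>(1) diam] \<gamma> by auto
  moreover have "2 * n + 1 \<le> 2 * nat \<lceil>C\<rceil> + 1" using n by linarith
  ultimately show ?thesis using small_mono by blast
qed

end

section \<open>Uniform constants and the self-embedding\<close>

locale coarse_box = warped_paths S x0 \<alpha> + generated_group \<Lambda> T
  for S :: "('a::metric_space \<Rightarrow> 'a) set" and x0 :: 'a and \<alpha> :: "('a \<Rightarrow> 'a) \<Rightarrow> real \<Rightarrow> 'a"
    and \<Lambda> :: "'b monoid" (structure) and T +
  fixes Nf :: "nat \<Rightarrow> 'b set" and tk :: "nat \<Rightarrow> real" and L A :: real and \<theta> :: nat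
  assumes warped: "warped_system S"
    and infinite: "infinite (carrier \<Lambda>)" and fin_T: "finite T"
    and filtration: "residual_filtration \<Lambda> Nf"
    and LA: "1 \<le> L" "0 \<le> A"
    and tk: "1 \<le> tk k" "\<not> bdd_above (range tk)"
    and qi: "quasi_isometric L A (cayley_metric (\<Lambda> Mod Nf k) ((\<lambda>s. Nf k #> s) ` T)) (warped_metric S (tk k))"
    and stable: "\<theta> \<le> \<theta>' \<Longrightarrow> N \<theta>' = N \<theta>"
begin

text \<open>Images of adjacent vertices are at distance at most L + A, points are within A of the
  image of \<open>g\<close>, and a jump costs at most 1. None of the constants from here to
  \<open>r\<close> depends on the index k or on \<open>M\<close>.\<close>

definition "C = L + A + 1"
definition "M1 = 2 * nat \<lceil>C\<rceil> + 1"
text \<open>4 * \<theta> lets the development kill the generators of \<open>N \<theta>\<close>, and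
  M1 * C lets it be computed on realised edges.\<close>

definition "P = max 3 (max (real (4 * \<theta>)) (real M1 * C))"
text \<open>Passing from x, y to \<open>g (f x)\<close>, \<open>g (f y)\<close> adds 2 * A to a
  distance \<open>P\<close>, and the lower quasi-isometry bound adds another A. The same bound,
  applied to v and \<open>f (g v)\<close>, yields \<open>Rq\<close>.\<close>

definition "R = nat \<lceil>L * (P + 3 * A)\<rceil>"
definition "Rq = nat \<lceil>2 * L * A\<rceil>"
text \<open>Covers the triangles (3 * R) and the edges with corrections (R + 2 * Rq + 1) of the
  cocycle, and is at least 2, as free cancellation in \<open>presented r\<close> requires.\<close>

definition "r = 3 * R + 2 * Rq + 2"

lemma Nf: "Nf k \<lhd> \<Lambda>" "finite (rcosets Nf k)" "(\<Inter>k. Nf k) = {\<one>}" "Nf (Suc k) \<subseteq> Nf k"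
proof -
  show "Nf k \<lhd> \<Lambda>" "finite (rcosets Nf k)" "(\<Inter>k. Nf k) = {\<one>}"
    using filtration by (auto simp: residual_filtration_def)
  have "Nf (Suc k) \<lhd> \<Lambda>\<lparr>carrier := Nf k\<rparr>" using filtration by (auto simp: residual_filtration_def)
  from subgroup.subset[OF normal_imp_subgroup[OF this]] show "Nf (Suc k) \<subseteq> Nf k" by simp
qed

lemma Nf_antimono: "k \<le> k' \<Longrightarrow> Nf k' \<subseteq> Nf k"
  using Nf(4) by (rule lift_Suc_antimono_le)

lemma eventually_excludes:
  assumes "finite W"
  shows "\<exists>k0. \<forall>k\<ge>k0. Nf k \<inter> W \<subseteq> {\<one>}"
  using assms
proof (induction W rule: finite_induct)
  case (insert a W)
  then obtain k0 where k0: "\<forall>k\<ge>k0. Nf k \<inter> W \<subseteq> {\<one>}" by blast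
  show ?case
  proof (cases "a = \<one>")
    case False
    then obtain k1 where "a \<notin> Nf k1" using Nf(3) by blast
    then have "\<forall>k\<ge>k1. a \<notin> Nf k" using Nf_antimono by blast
    with k0 show ?thesis by (intro exI[of _ "max k0 k1"]) auto
  qed (use k0 in auto)
qed simp

lemma short_words_inject: "\<exists>k0. \<forall>k\<ge>k0. \<forall>p\<in>lists letters. length p \<le> n \<and> ev p \<in> Nf k \<longrightarrow> ev p = \<one>"
proof -
  obtain k0 where "\<forall>k\<ge>k0. Nf k \<inter> ev ` {p \<in> lists letters. length p \<le> n} \<subseteq> {\<one>}"
    using eventually_excludes[OF finite_imageI[OF finite_short_words[OF fin_T]]] by blast
  then show ?thesis by blast
qed

lemma bounds: "1 \<le> C" "A \<le> C" "L + A \<le> C" "1 \<le> M1" "3 \<le> P" "real (4 * \<theta>) \<le> P" "real M1 * C \<le> P"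
  using LA by (auto simp: C_def M1_def P_def)

text \<open>\<open>M\<close> is arbitrary and affects only the threshold \<open>c\<close>: the scale
  must be so large that \<open>C / tk k\<close> falls below the \<eta> which
  \<open>small_loop_fixer\<close> gives for loops of \<open>M\<close> steps. The threshold
  \<open>k0\<close> makes words of length at most \<open>r\<close> inject into the quotient.\<close>

lemma comparison_exists:
  "\<exists>c k0. \<forall>k\<ge>k0. tk k \<ge> c \<longrightarrow> (\<exists>g f. comparison S x0 \<alpha> \<Lambda> T (Nf k) (warped_dist S (tk k)) (tk k) g f P C R Rq r M1 M \<theta>)"
proof -
  have ws: "compact (UNIV :: 'a set)" "finite S" "semilocally_simply_connected (UNIV :: 'a set)"
    "path_connected (UNIV :: 'a set)" "\<forall>\<^sub>F t in at_top. jumping_geodesic S t"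
    using warped by (auto simp: warped_system_def)
  obtain t1 where t1: "\<And>t. t \<ge> t1 \<Longrightarrow> jumping_geodesic S t"
    using ws(5) unfolding eventually_at_top_linorder by blast
  have geo: "geodesic_metric (euclidean_metric :: 'a metric)"
    using t1[of t1] by (simp add: jumping_geodesic_def)
  obtain \<eta> where \<eta>: "\<eta> > 0" "\<And>x h q. \<lbrakk>small \<eta> M x h x; path q; pathstart q = x0; pathfinish q = x\<rbrakk> \<Longrightarrow>
      (path_class q, []) \<star> h \<star> jinv (path_class q, []) \<in> fixers M"
    using small_loop_fixer[OF ws(1,2) geo ws(3), of M] by blast
  have fixers: "fixers M \<subseteq> \<Psi> ` N \<theta>"
  proof -
    \<comment> \<open>This is where stability replaces words of length \<open>M\<close> by those of
      length at most 4 * \<theta>.\<close>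
    have "fixers M \<subseteq> fixers (4 * max M \<theta>)" by (force simp: fixers_def)
    also have "\<dots> \<subseteq> \<Psi> ` N (max M \<theta>)" by (rule fixers_subset)
    finally show ?thesis using stable[of "max M \<theta>"] by simp
  qed
  obtain k0 where k0: "\<And>k p. \<lbrakk>k \<ge> k0; p \<in> lists letters; length p \<le> r; ev p \<in> Nf k\<rbrakk> \<Longrightarrow> ev p = \<one>"
    using short_words_inject[of r] by blast
  show ?thesis
  proof (intro exI[of _ "max t1 (C / \<eta>)"] exI[of _ k0] allI impI)
    fix k assume k: "k \<ge> k0" "tk k \<ge> max t1 (C / \<eta>)"
    interpret normal "Nf k" \<Lambda> by (rule Nf)
    interpret generated_quotient \<Lambda> T "Nf k" ..
    let ?t = "tk k" and ?\<rho> = "warped_dist S (tk k)"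
    have t: "?t > 0" using tk(1)[of k] by linarith
    interpret \<rho>: Metric_space UNIV ?\<rho> by (rule warped_dist_greatest(1)[OF t])
    have W: "mspace (warped_metric S ?t) = UNIV" "mdist (warped_metric S ?t) = ?\<rho>"
      by (simp_all add: warped_metric_def \<rho>.mspace_metric \<rho>.mdist_metric)
    obtain g where g: "\<And>v u. \<lbrakk>v \<in> V; u \<in> V\<rbrakk> \<Longrightarrow> mdist cayley v u / L - A \<le> ?\<rho> (g v) (g u)"
      "\<And>v u. \<lbrakk>v \<in> V; u \<in> V\<rbrakk> \<Longrightarrow> ?\<rho> (g v) (g u) \<le> L * mdist cayley v u + A"
      "\<And>x. \<exists>v\<in>V. ?\<rho> x (g v) \<le> A"
      using qi[of k] unfolding quasi_isometric_def W cayley_simps(1) by auto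
    obtain f where f: "\<And>x. f x \<in> V" "\<And>x. ?\<rho> x (g (f x)) \<le> A" using g(3) by metis
    have lower: "mdist cayley v u \<le> L * (?\<rho> (g v) (g u) + A)" if "v \<in> V" "u \<in> V" for v u
      using g(1)[OF that] LA(1) by (simp add: field_simps)
    have "comparison S x0 \<alpha> \<Lambda> T (Nf k) ?\<rho> ?t g f P C R Rq r M1 M \<theta>"
    proof (intro comparison.intro comparison_axioms.intro)
      show "warped_paths S x0 \<alpha>" by (rule warped_paths_axioms)
      show "generated_quotient \<Lambda> T (Nf k)" by (rule generated_quotient_axioms)
      show "Metric_space UNIV ?\<rho>" by (rule warped_dist_greatest(1)[OF t])
      show "?\<rho> x y \<le> ?t * dist x y" for x y by (rule warped_dist_greatest(2)[OF t])
      show "?\<rho> (letter_map a x) x \<le> 1" if "fst a \<in> S" for a x by (rule warped_dist_jump[OF t that])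
      show "?\<rho> (g v) (g (v #> s)) \<le> C" if v: "v \<in> V" "s \<in> letters" for v s
      proof -
        have "mdist cayley v (v #> s) \<le> 1" using mdist_cayley_word[OF v(1), of "[s]"] v letters_closed by simp
        then have "L * mdist cayley v (v #> s) \<le> L" using LA(1) by simp
        with g(2)[OF v(1) V_closed[OF v(1) letters_closed[OF v(2)]]] show ?thesis using bounds(3) by linarith
      qed
      show "?\<rho> x (g (f x)) \<le> C" for x using f(2)[of x] bounds(2) by linarith
      show "\<exists>p\<in>lists letters. length p \<le> R \<and> f x #> ev p = f y" if "?\<rho> x y \<le> P" for x y
      proof -
        have "?\<rho> (g (f x)) (g (f y)) \<le> ?\<rho> (g (f x)) x + (?\<rho> x y + ?\<rho> y (g (f y)))"
          using \<rho>.triangle[of "g (f x)" x "g (f y)"] \<rho>.triangle[of x y "g (f y)"] by simp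
        also have "\<dots> \<le> P + 2 * A" using that f(2)[of x] f(2)[of y] \<rho>.commute[of x "g (f x)"] by simp
        finally have "L * (?\<rho> (g (f x)) (g (f y)) + A) \<le> L * (P + 3 * A)" using LA(1) by simp
        with lower[OF f(1)[of x] f(1)[of y]] have "mdist cayley (f x) (f y) \<le> L * (P + 3 * A)" by linarith
        moreover obtain p where "p \<in> lists letters" "f x #> ev p = f y" "real (length p) = mdist cayley (f x) (f y)"
          using word_of_mdist_cayley[OF f(1) f(1)] by blast
        ultimately show ?thesis unfolding R_def by (intro bexI[of _ p]) (simp_all, linarith)
      qed
      show "\<exists>p\<in>lists letters. length p \<le> Rq \<and> v #> ev p = f (g v)" if v: "v \<in> V" for v
      proof -
        have "L * (?\<rho> (g v) (g (f (g v))) + A) \<le> L * (2 * A)" using f(2)[of "g v"] LA(1) by simp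
        with lower[OF v f(1)[of "g v"]] have "mdist cayley v (f (g v)) \<le> L * (2 * A)" by linarith
        also have "L * (2 * A) = 2 * L * A" by simp
        finally have "mdist cayley v (f (g v)) \<le> 2 * L * A" .
        moreover obtain p where "p \<in> lists letters" "v #> ev p = f (g v)" "real (length p) = mdist cayley v (f (g v))"
          using word_of_mdist_cayley[OF v f(1)] by blast
        ultimately show ?thesis unfolding Rq_def by (intro bexI[of _ p]) (simp_all, linarith)
      qed
      show "\<exists>h. small (C / ?t) M1 x h y" if "?\<rho> x y \<le> C" for x y
        unfolding M1_def using k t1[of ?t] by (intro small_of_warped_dist t that) simp
      show "(path_class q, []) \<star> h \<star> jinv (path_class q, []) \<in> \<Psi> ` N \<theta>"
        if "small (C / ?t) M x h x" "path q" "pathstart q = x0" "pathfinish q = x" for x h q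
      proof -
        have "C / ?t \<le> \<eta>" using k(2) t \<eta>(1) by (simp add: field_simps)
        then show ?thesis using \<eta>(2)[OF small_antimono_scale[OF that(1)] that(2-4)] fixers by blast
      qed
      show "\<exists>q. path q \<and> pathstart q = x0 \<and> pathfinish q = x" for x
        using ws(4) by (auto simp: path_connected_def)
      show "ev p = \<one>" if "p \<in> lists letters" "length p \<le> r" "ev p \<in> Nf k" for p
        by (rule k0[OF k(1) that])
      show "3 * R \<le> r" "R + 2 * Rq + 1 \<le> r" by (simp_all add: r_def)
    qed (fact t bounds f)+
    then show "\<exists>g f. comparison S x0 \<alpha> \<Lambda> T (Nf k) ?\<rho> ?t g f P C R Rq r M1 M \<theta>" by blast
  qed
qed

lemma frequently_comparison:
  "\<exists>k\<ge>m. \<exists>g f. comparison S x0 \<alpha> \<Lambda> T (Nf k) (warped_dist S (tk k)) (tk k) g f P C R Rq r M1 M \<theta>"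
proof -
  obtain c k0 where *: "\<forall>k\<ge>k0. tk k \<ge> c \<longrightarrow> (\<exists>g f. comparison S x0 \<alpha> \<Lambda> T (Nf k) (warped_dist S (tk k)) (tk k) g f P C R Rq r M1 M \<theta>)"
    using comparison_exists by blast
  obtain k where "k \<ge> max m k0" "tk k \<ge> c" using unbounded_frequently_large[OF tk(2)] by blast
  with * show ?thesis by auto
qed

text \<open>\<open>M\<close> is adapted to the length of \<open>p\<close>, which merely forces a
  larger scale, while \<open>r\<close> is the same for all \<open>p\<close>. Development into
  \<open>presented r\<close> then kills \<open>p\<close> by \<open>rep_relator\<close>.\<close>

lemma finitely_presented:
  assumes p: "p \<in> lists letters" "ev p = \<one>"
  shows "weq r p []"
proof -
  obtain k g f where "comparison S x0 \<alpha> \<Lambda> T (Nf k) (warped_dist S (tk k)) (tk k) g f P C R Rq r M1 (length p * M1) \<theta>"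
    using frequently_comparison by blast
  then interpret comparison S x0 \<alpha> \<Lambda> T "Nf k" "warped_dist S (tk k)" "tk k" g f P C R Rq r M1 "length p * M1" \<theta> .
  interpret comparison_rep S x0 \<alpha> \<Lambda> T "Nf k" "warped_dist S (tk k)" "tk k" g f P C R Rq r M1 "length p * M1" \<theta>
    "presented r" "wclass r"
  proof (intro comparison_rep.intro comparison_rep_axioms.intro)
    show "group (presented r)" by (rule group_presented) (simp add: r_def)
    show "wclass r p \<in> carrier (presented r)" if "p \<in> lists letters" for p
      using that unfolding presented_simps by (rule imageI)
    show "wclass r (p @ q) = wclass r p \<otimes>\<^bsub>presented r\<^esub> wclass r q"
      if "p \<in> lists letters" "q \<in> lists letters" for p q
      using presented_mult[OF that] ..
    show "wclass r p = wclass r q"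
      if "p \<in> lists letters" "q \<in> lists letters" "length p + length q \<le> r" "ev p = ev q" for p q
      using that weq.relation[of "[]" p q "[]" r] by (simp add: wclass_eq_iff del: in_lists_conv_set)
  qed (fact comparison_axioms)
  have "wclass r p = \<one>\<^bsub>presented r\<^esub>" by (rule rep_relator[OF p]) simp
  then show ?thesis using p(1) by (simp add: presented_simps wclass_eq_iff)
qed

lemma frequently_limit_group_iso: "\<exists>k\<ge>m. \<Gamma> Mod N \<theta> \<cong> \<Lambda>\<lparr>carrier := Nf k\<rparr>"
proof -
  \<comment> \<open>The sum of the two lower bounds demanded by
    \<open>comparison_presented\<close>.\<close>
  let ?M = "1 + (2 * M1 + R * M1) + r * M1"
  obtain k g f where k: "k \<ge> m"
    "comparison S x0 \<alpha> \<Lambda> T (Nf k) (warped_dist S (tk k)) (tk k) g f P C R Rq r M1 ?M \<theta>"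
    using frequently_comparison by blast
  then interpret comparison S x0 \<alpha> \<Lambda> T "Nf k" "warped_dist S (tk k)" "tk k" g f P C R Rq r M1 ?M \<theta> by simp
  interpret comparison_presented S x0 \<alpha> \<Lambda> T "Nf k" "warped_dist S (tk k)" "tk k" g f P C R Rq r M1 ?M \<theta>
    by (intro comparison_presented.intro comparison_presented_axioms.intro comparison_axioms)
      (simp_all add: finitely_presented del: in_lists_conv_set)
  show ?thesis using limit_group_iso k(1) by blast
qed

lemma Nf_infinite: "infinite (Nf k)"
proof
  interpret N: normal "Nf k" \<Lambda> by (rule Nf)
  assume fin: "finite (Nf k)"
  have "finite c" if "c \<in> rcosets Nf k" for c
    using that fin by (auto simp: RCOSETS_def r_coset_def)
  then have "finite (\<Union> (rcosets Nf k))" using Nf(2) by blast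
  then show False using rcosets_part_G[OF N.is_subgroup] infinite by simp
qed

text \<open>The filtration may be constant for long stretches. As \<open>Nf k\<close> is infinite,
  it contains some \<open>a \<noteq> \<one>\<close>; a later term that omits \<open>a\<close> and is
  again isomorphic to the limit group is a proper subgroup.\<close>

lemma self_embedding:
  "\<exists>K H. group K \<and> \<Gamma> Mod N \<theta> \<cong> K \<and> H \<lhd> K \<and> H \<noteq> carrier K \<and> finite (rcosets\<^bsub>K\<^esub> H) \<and> K\<lparr>carrier := H\<rparr> \<cong> (K :: 'b monoid)"
proof -
  obtain k where k: "\<Gamma> Mod N \<theta> \<cong> \<Lambda>\<lparr>carrier := Nf k\<rparr>" using frequently_limit_group_iso by blast
  have "\<not> Nf k \<subseteq> {\<one>}" using Nf_infinite[of k] finite_subset by blast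
  then obtain a where a: "a \<in> Nf k" "a \<noteq> \<one>" by blast
  obtain k1 where k1: "a \<notin> Nf k1" using a(2) Nf(3) by blast
  obtain k' where k': "k' \<ge> max k k1" "\<Gamma> Mod N \<theta> \<cong> \<Lambda>\<lparr>carrier := Nf k'\<rparr>"
    using frequently_limit_group_iso by blast
  have sub: "Nf k' \<subseteq> Nf k" using Nf_antimono k'(1) by simp
  have "a \<notin> Nf k'" using k1 Nf_antimono[of k1 k'] k'(1) by auto
  with a have ne: "Nf k' \<noteq> Nf k" by blast
  have sg: "subgroup (Nf k) \<Lambda>" using normal_imp_subgroup[OF Nf(1)] .
  let ?K = "\<Lambda>\<lparr>carrier := Nf k\<rparr>"
  have "rcosets\<^bsub>?K\<^esub> Nf k' \<subseteq> rcosets Nf k'"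
    using subgroup.subset[OF sg] by (auto simp: RCOSETS_def r_coset_def)
  then have fin: "finite (rcosets\<^bsub>?K\<^esub> Nf k')" using Nf(2) finite_subset by blast
  have "\<Lambda>\<lparr>carrier := Nf k'\<rparr> \<cong> \<Gamma> Mod N \<theta>"
    using k'(2) normal.factorgroup_is_group[OF N_normal] by (rule group.iso_sym[rotated])
  then have "?K\<lparr>carrier := Nf k'\<rparr> \<cong> ?K" using iso_trans[OF _ k] by simp
  moreover have "Nf k' \<lhd> ?K" by (rule normal_restrict_supergroup[OF sg Nf(1) sub])
  moreover have "group ?K" by (rule subgroup_imp_group[OF sg])
  ultimately show ?thesis using k ne fin by (intro exI[of _ ?K] exI[of _ "Nf k'"]) simp
qed

end

theorem corollary9p8:
  fixes S :: "('a::metric_space \<Rightarrow> 'a) set"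
    and x0 :: 'a
    and \<alpha> :: "('a \<Rightarrow> 'a) \<Rightarrow> real \<Rightarrow> 'a"
    and B :: "nat \<Rightarrow> 'b set metric"
  assumes "warped_system S"
    and "\<And>s. s \<in> S \<Longrightarrow> path (\<alpha> s) \<and> pathstart (\<alpha> s) = x0 \<and> pathfinish (\<alpha> s) = s x0"
    and "stable_discrete_fundamental_group S x0 \<alpha>"
    and "\<not> (\<exists>H. H \<lhd> pi_infinity S x0 \<alpha> \<and> H \<noteq> carrier (pi_infinity S x0 \<alpha>) \<and>
            finite (rcosets\<^bsub>pi_infinity S x0 \<alpha>\<^esub> H) \<and>
            (pi_infinity S x0 \<alpha>)\<lparr>carrier := H\<rparr> \<cong> pi_infinity S x0 \<alpha>)"
    and "box_space B"
  shows "\<not> coarsely_equivalent_warped B S"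
proof
  assume "coarsely_equivalent_warped B S"
  then obtain tk :: "nat \<Rightarrow> real" and L A where
    tk: "\<forall>k. 1 \<le> tk k" "\<not> bdd_above (range tk)" and LA: "1 \<le> L" "0 \<le> A"
    and qi: "\<forall>k. quasi_isometric L A (B k) (warped_metric S (tk k))"
    unfolding coarsely_equivalent_warped_def coarsely_equivalent_def by (elim exE conjE) (rule that)
  obtain \<Lambda> :: "'b monoid" and T Nf where box: "group \<Lambda>" "infinite (carrier \<Lambda>)" "finite T" "T \<subseteq> carrier \<Lambda>"
    "generate \<Lambda> T = carrier \<Lambda>" "residual_filtration \<Lambda> Nf"
    "\<forall>k. B k = cayley_metric (\<Lambda> Mod Nf k) ((\<lambda>s. Nf k #>\<^bsub>\<Lambda>\<^esub> s) ` T)"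
    using assms(5) unfolding box_space_def by blast
  interpret warped_paths S x0 \<alpha>
    using assms(1,2) by unfold_locales (auto simp: warped_system_def)
  obtain \<theta> where \<theta>: "1 \<le> \<theta>" "lm \<theta> \<in> iso (pt \<theta>) (pi_infinity S x0 \<alpha>)"
    using assms(3) unfolding stable_discrete_fundamental_group_def by blast
  interpret coarse_box S x0 \<alpha> \<Lambda> T Nf tk L A \<theta>
  proof (intro coarse_box.intro coarse_box_axioms.intro generated_group.intro generated_group_axioms.intro)
    show "quasi_isometric L A (cayley_metric (\<Lambda> Mod Nf k) ((\<lambda>s. Nf k #>\<^bsub>\<Lambda>\<^esub> s) ` T)) (warped_metric S (tk k))" for k
      using qi box(7) by metis
    show "1 \<le> tk k" for k using tk(1) by blast
    show "N \<theta>' = N \<theta>" if "\<theta> \<le> \<theta>'" for \<theta>' by (rule stable_N[OF \<theta>(2,1) that])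
  qed (fact warped_paths_axioms assms(1) tk(2) LA box)+
  obtain K :: "'b monoid" and H where K: "group K" "\<Gamma> Mod N \<theta> \<cong> K" "H \<lhd> K" "H \<noteq> carrier K"
    "finite (rcosets\<^bsub>K\<^esub> H)" "K\<lparr>carrier := H\<rparr> \<cong> K"
    using self_embedding by blast
  \<comment> \<open>The stabilising isomorphism \<open>lm \<theta>\<close> carries the group axioms
    from stage \<theta> to the direct limit.\<close>
  have "group (pi_infinity S x0 \<alpha>)"
    using group.iso_imp_img_group[OF group_pt \<theta>(2)] one_pi_infinity[OF \<theta>(1)] by (metis (full_types) monoid.surjective monoid.update_convs(2))
  moreover have "K \<cong> pi_infinity S x0 \<alpha>"
    using iso_trans[OF group.iso_sym[OF group_pt[of \<theta>], of K] is_isoI[OF \<theta>(2)]] K(2)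
    by (simp add: pi_theta_def)
  then obtain \<phi> where "\<phi> \<in> iso K (pi_infinity S x0 \<alpha>)" by (auto simp: is_iso_def)
  ultimately show False
    using no_self_embedding_transfer[OF _ K(1) _ K(3-6)] assms(4) by blast
qed

end
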